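(* Let $p,q\in[1,\infty)$ with $p<q$. For every nonzero finite-dimensional linear subspace $X$ of $\mathsf{S}_p$, $$\mathsf{c}_{\mathsf{S}_q}(X)\le\begin{cases}\dim(X)^{\frac1p-\frac1q}&\text{if }p\in[1,2],\\[2pt]\dim(X)^{\frac p2\left(\frac1p-\frac1q\right)}&\text{if }p\in(2,\infty).\end{cases}$$
   Context: $\ell_2$ is the real Hilbert space of square-summable sequences. For $p\in[1,\infty)$, $\mathsf{S}_p$ is the Schatten--von Neumann class: the Banach space of all compact linear operators $T:\ell_2\to\ell_2$ with $\|T\|_{\mathsf{S}_p}=\big(\sum_{j=1}^\infty\sigma_j(T)^p\big)^{1/p}<\infty$, where $\sigma_1(T)\ge\sigma_2(T)\ge\cdots$ are the singular values of $T$. Normed spaces and their subspaces carry the metric induced by the norm. For metric spaces $(\mathcal{M},d_{\mathcal{M}})$ and $(\mathcal{N},d_{\mathcal{N}})$, the distortion $\mathsf{c}_{\mathcal{N}}(\mathcal{M})$ is the infimum over those $\alpha\in[1,\infty]$ for which there exist $f:\mathcal{M}\to\mathcal{N}$ and $\lambda\in(0,\infty)$ such that $\lambda d_{\mathcal{N}}(f(x),f(y))\le d_{\mathcal{M}}(x,y)\le\alpha\lambda d_{\mathcal{N}}(f(x),f(y))$ for all $x,y\in\mathcal{M}$. *)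

theory Defs
  imports "HOL-Analysis.Analysis"
begin

section \<open>The real Hilbert space of square-summable sequences\<close>

typedef ell2 = "{x :: nat \<Rightarrow> real. summable (\<lambda>n. (x n)\<^sup>2)}"
  morphisms coord Abs_ell2
  by (rule exI[of _ "\<lambda>_. 0"]) simp

setup_lifting type_definition_ell2

lemma summable_coord_square: "summable (\<lambda>n. (coord x n)\<^sup>2)"
  using coord[of x] by simp

lemma summable_mult_of_squares:
  fixes x y :: "nat \<Rightarrow> real"
  assumes "summable (\<lambda>n. (x n)\<^sup>2)" "summable (\<lambda>n. (y n)\<^sup>2)"
  shows "summable (\<lambda>n. x n * y n)"
proof (rule summable_comparison_test'[of "\<lambda>n. (x n)\<^sup>2 + (y n)\<^sup>2" 0])
  show "summable (\<lambda>n. (x n)\<^sup>2 + (y n)\<^sup>2)"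
    using assms by (rule summable_add)
  fix n
  have "2 * \<bar>x n\<bar> * \<bar>y n\<bar> \<le> (x n)\<^sup>2 + (y n)\<^sup>2"
    using sum_squares_bound[of "\<bar>x n\<bar>" "\<bar>y n\<bar>"] by simp
  moreover have "0 \<le> \<bar>x n\<bar> * \<bar>y n\<bar>" by simp
  ultimately show "norm (x n * y n) \<le> (x n)\<^sup>2 + (y n)\<^sup>2"
    unfolding real_norm_def abs_mult by linarith
qed

lemma summable_square_add:
  fixes x y :: "nat \<Rightarrow> real"
  assumes "summable (\<lambda>n. (x n)\<^sup>2)" "summable (\<lambda>n. (y n)\<^sup>2)"
  shows "summable (\<lambda>n. (x n + y n)\<^sup>2)"
proof -
  have "summable (\<lambda>n. (x n)\<^sup>2 + (y n)\<^sup>2 + 2 * (x n * y n))"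
    by (intro summable_add summable_mult assms summable_mult_of_squares)
  then show ?thesis by (simp add: power2_sum mult.assoc)
qed

instantiation ell2 :: real_vector
begin

lift_definition zero_ell2 :: ell2 is "\<lambda>_. 0" by simp

lift_definition plus_ell2 :: "ell2 \<Rightarrow> ell2 \<Rightarrow> ell2" is "\<lambda>x y n. x n + y n"
  by (rule summable_square_add)

lift_definition uminus_ell2 :: "ell2 \<Rightarrow> ell2" is "\<lambda>x n. - x n" by simp

lift_definition minus_ell2 :: "ell2 \<Rightarrow> ell2 \<Rightarrow> ell2" is "\<lambda>x y n. x n - y n"
  using summable_square_add[of _ "\<lambda>n. - _ n"] by simp

lift_definition scaleR_ell2 :: "real \<Rightarrow> ell2 \<Rightarrow> ell2" is "\<lambda>c x n. c * x n"
  by (simp add: power_mult_distrib summable_mult)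

instance
  by standard (transfer; simp add: fun_eq_iff algebra_simps)+

end

instantiation ell2 :: real_inner
begin

definition inner_ell2 :: "ell2 \<Rightarrow> ell2 \<Rightarrow> real"
  where "inner_ell2 x y = (\<Sum>n. coord x n * coord y n)"

definition norm_ell2 :: "ell2 \<Rightarrow> real"
  where "norm_ell2 x = sqrt (inner x x)"

definition dist_ell2 :: "ell2 \<Rightarrow> ell2 \<Rightarrow> real"
  where "dist_ell2 x y = norm (x - y)"

definition sgn_ell2 :: "ell2 \<Rightarrow> ell2"
  where "sgn_ell2 x = x /\<^sub>R norm x"

definition uniformity_ell2 :: "(ell2 \<times> ell2) filter"
  where "uniformity_ell2 = (INF e\<in>{0 <..}. principal {(x, y). dist x y < e})"

definition open_ell2 :: "ell2 set \<Rightarrow> bool"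
  where "open_ell2 U = (\<forall>x\<in>U. \<forall>\<^sub>F (x', y) in uniformity. x' = x \<longrightarrow> y \<in> U)"

instance
proof
  fix x y z :: ell2 and r :: real
  have s: "summable (\<lambda>n. coord a n * coord b n)" for a b
    by (intro summable_mult_of_squares summable_coord_square)
  show "inner x y = inner y x"
    by (simp add: inner_ell2_def mult.commute)
  show "inner (x + y) z = inner x z + inner y z"
    by (simp add: inner_ell2_def plus_ell2.rep_eq distrib_right suminf_add s)
  show "inner (r *\<^sub>R x) y = r * inner x y"
    by (simp add: inner_ell2_def scaleR_ell2.rep_eq mult.assoc suminf_mult s)
  show "0 \<le> inner x x"
    unfolding inner_ell2_def by (rule suminf_nonneg[OF s]) simp
  show "inner x x = 0 \<longleftrightarrow> x = 0"
    unfolding inner_ell2_def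
    by (subst suminf_eq_zero_iff[OF s])
       (auto simp: zero_ell2.rep_eq fun_eq_iff simp flip: coord_inject)
qed (simp_all add: norm_ell2_def dist_ell2_def sgn_ell2_def uniformity_ell2_def open_ell2_def)

end

lemma norm_ell2_square: "(norm x)\<^sup>2 = (\<Sum>n. (coord x n)\<^sup>2)"
  unfolding power2_norm_eq_inner inner_ell2_def by (simp add: power2_eq_square)

lemma sum_coord_square_le: "(\<Sum>n<N. (coord x n)\<^sup>2) \<le> (norm x)\<^sup>2"
  unfolding norm_ell2_square by (intro sum_le_suminf summable_coord_square) auto

lemma abs_coord_le_norm: "\<bar>coord x n\<bar> \<le> norm x"
proof (rule power2_le_imp_le)
  have "(coord x n)\<^sup>2 \<le> (\<Sum>k<Suc n. (coord x k)\<^sup>2)"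
    by (rule member_le_sum) auto
  then show "\<bar>coord x n\<bar>\<^sup>2 \<le> (norm x)\<^sup>2"
    using sum_coord_square_le[of x "Suc n"] by simp
qed simp

instance ell2 :: complete_space
proof
  fix X :: "nat \<Rightarrow> ell2"
  assume X: "Cauchy X"
  have "Cauchy (\<lambda>k. coord (X k) n)" for n
  proof (rule metric_CauchyI)
    fix e :: real assume "0 < e"
    then obtain M where M: "\<forall>i\<ge>M. \<forall>j\<ge>M. dist (X i) (X j) < e"
      by (rule metric_CauchyD[OF X, THEN exE])
    have le: "dist (coord (X i) n) (coord (X j) n) \<le> dist (X i) (X j)" for i j
      using abs_coord_le_norm[of "X i - X j" n]
      by (simp add: dist_norm minus_ell2.rep_eq)
    show "\<exists>M. \<forall>i\<ge>M. \<forall>j\<ge>M. dist (coord (X i) n) (coord (X j) n) < e"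
      by (intro exI[of _ M] allI impI le_less_trans[OF le] M[rule_format])
  qed
  then have "\<exists>l. (\<lambda>k. coord (X k) n) \<longlonglongrightarrow> l" for n
    by (intro Cauchy_convergent[unfolded convergent_def])
  then obtain l where l: "\<And>n. (\<lambda>k. coord (X k) n) \<longlonglongrightarrow> l n" by metis
  have bound: "(\<Sum>n<N. (coord (X i) n - l n)\<^sup>2) \<le> e\<^sup>2"
    if M: "\<forall>i\<ge>M. \<forall>j\<ge>M. dist (X i) (X j) < e" and "i \<ge> M" for M e i N
  proof (rule LIMSEQ_le_const2)
    show "(\<lambda>k. \<Sum>n<N. (coord (X i) n - coord (X k) n)\<^sup>2)
        \<longlonglongrightarrow> (\<Sum>n<N. (coord (X i) n - l n)\<^sup>2)"
      by (intro tendsto_intros l)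
    show "\<exists>K. \<forall>k\<ge>K. (\<Sum>n<N. (coord (X i) n - coord (X k) n)\<^sup>2) \<le> e\<^sup>2"
    proof (intro exI allI impI)
      fix k assume "k \<ge> M"
      have "(\<Sum>n<N. (coord (X i) n - coord (X k) n)\<^sup>2) \<le> (dist (X i) (X k))\<^sup>2"
        using sum_coord_square_le[of "X i - X k" N]
        by (simp add: dist_norm minus_ell2.rep_eq)
      also have "\<dots> \<le> e\<^sup>2"
        using M \<open>i \<ge> M\<close> \<open>k \<ge> M\<close> by (intro power_mono) (auto intro: less_imp_le)
      finally show "(\<Sum>n<N. (coord (X i) n - coord (X k) n)\<^sup>2) \<le> e\<^sup>2" .
    qed
  qed
  have diff: "summable (\<lambda>n. (coord (X i) n - l n)\<^sup>2)"
    if "\<forall>i\<ge>M. \<forall>j\<ge>M. dist (X i) (X j) < e" "i \<ge> M" for M e i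
    by (rule summableI_nonneg_bounded[OF _ bound[OF that]]) simp
  obtain M1 where M1: "\<forall>i\<ge>M1. \<forall>j\<ge>M1. dist (X i) (X j) < 1"
    by (rule metric_CauchyD[OF X zero_less_one, THEN exE])
  have "summable (\<lambda>n. (- (coord (X M1) n - l n) + coord (X M1) n)\<^sup>2)"
    by (intro summable_square_add summable_coord_square)
       (simp only: power2_minus diff[OF M1 order_refl])
  then have "summable (\<lambda>n. (l n)\<^sup>2)" by simp
  then have L: "coord (Abs_ell2 l) = l" by (simp add: Abs_ell2_inverse)
  have "X \<longlonglongrightarrow> Abs_ell2 l"
  proof (rule metric_LIMSEQ_I)
    fix r :: real assume "0 < r"
    then have "0 < r / 2" by simp
    then obtain M where M: "\<forall>i\<ge>M. \<forall>j\<ge>M. dist (X i) (X j) < r / 2"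
      by (rule metric_CauchyD[OF X, THEN exE])
    have "dist (X i) (Abs_ell2 l) < r" if "i \<ge> M" for i
    proof -
      have "(dist (X i) (Abs_ell2 l))\<^sup>2 = (\<Sum>n. (coord (X i) n - l n)\<^sup>2)"
        by (simp add: dist_norm norm_ell2_square minus_ell2.rep_eq L)
      also have "\<dots> \<le> (r / 2)\<^sup>2"
        by (rule suminf_le_const[OF diff[OF M that] bound[OF M that]])
      finally have "dist (X i) (Abs_ell2 l) \<le> r / 2"
        by (rule power2_le_imp_le) (use \<open>0 < r\<close> in simp)
      then show ?thesis using \<open>0 < r\<close> by simp
    qed
    then show "\<exists>M. \<forall>i\<ge>M. dist (X i) (Abs_ell2 l) < r" by blast
  qed
  then show "convergent X" by (auto simp: convergent_def)
qed

instance ell2 :: banach ..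


section \<open>Singular values and Schatten--von Neumann classes\<close>

definition compact_operator :: "('a::real_normed_vector \<Rightarrow>\<^sub>L 'b::real_normed_vector) \<Rightarrow> bool"
  where "compact_operator T \<longleftrightarrow>
    (\<forall>S. bounded S \<longrightarrow> compact (closure (blinfun_apply T ` S)))"

text \<open>
  The singular values of \<open>T\<close> are the square roots of the eigenvalues of \<open>T\<^sup>* T\<close>, listed
  in decreasing order and repeated according to multiplicity. Indices start at \<open>0\<close>, so
  \<open>\<sigma> j\<close> is usually written with index \<open>j + 1\<close>. Only positive values are counted: if there
  are finitely many of them, the sequence is continued by zeros; if there are infinitely
  many, then \<open>0\<close> does not occur in it, whether or not \<open>T\<close> has a kernel.
  For compact \<open>T\<close> the eigenspaces below are finite-dimensional.
\<close>

definition is_singular_value_seq :: "(ell2 \<Rightarrow>\<^sub>L ell2) \<Rightarrow> (nat \<Rightarrow> real) \<Rightarrow> bool"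
  where "is_singular_value_seq T \<sigma> \<longleftrightarrow>
    decseq \<sigma> \<and> (\<forall>j. 0 \<le> \<sigma> j) \<and>
    (\<forall>s>0. finite {j. \<sigma> j = s} \<and>
       card {j. \<sigma> j = s} =
         dim {x. adjoint (blinfun_apply T) (blinfun_apply T x) = s\<^sup>2 *\<^sub>R x})"

lemma is_singular_value_seq_unique:
  assumes "is_singular_value_seq T \<sigma>" "is_singular_value_seq T \<tau>"
  shows "\<sigma> = \<tau>"
proof (rule ccontr)
  have aux: False
    if \<sigma>: "is_singular_value_seq T \<sigma>" and \<tau>: "is_singular_value_seq T \<tau>"
      and below: "\<And>i. i < j \<Longrightarrow> \<sigma> i = \<tau> i" and less: "\<tau> j < \<sigma> j" for \<sigma> \<tau> j
  proof -
    note \<sigma>' = \<sigma>[unfolded is_singular_value_seq_def]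
    note \<tau>' = \<tau>[unfolded is_singular_value_seq_def]
    have nonneg: "0 \<le> \<tau> j" and dec: "decseq \<tau>" using \<tau>' by blast+
    have pos: "0 < \<sigma> j"
      using nonneg less by linarith
    have lt: "i < j" if "\<tau> i = \<sigma> j" for i
    proof (rule ccontr)
      assume "\<not> i < j"
      then have "\<tau> i \<le> \<tau> j"
        by (intro decseqD[OF dec]) simp
      then show False using less that by simp
    qed
    have "{i. \<tau> i = \<sigma> j} \<subseteq> {i. \<sigma> i = \<sigma> j}"
    proof
      fix i assume "i \<in> {i. \<tau> i = \<sigma> j}"
      then show "i \<in> {i. \<sigma> i = \<sigma> j}" using below[OF lt] by simp
    qed
    moreover have "j \<in> {i. \<sigma> i = \<sigma> j}" "j \<notin> {i. \<tau> i = \<sigma> j}"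
      using less by simp_all
    ultimately have "{i. \<tau> i = \<sigma> j} \<subset> {i. \<sigma> i = \<sigma> j}" by blast
    moreover have "finite {i. \<sigma> i = \<sigma> j}"
      using \<sigma>' pos by blast
    ultimately have less_card: "card {i. \<tau> i = \<sigma> j} < card {i. \<sigma> i = \<sigma> j}"
      by (intro psubset_card_mono)
    have "card {i. \<tau> i = \<sigma> j} = card {i. \<sigma> i = \<sigma> j}"
      using \<sigma>' \<tau>' pos by metis
    with less_card show False by simp
  qed
  assume "\<sigma> \<noteq> \<tau>"
  then have ex: "\<exists>j. \<sigma> j \<noteq> \<tau> j" by auto
  define j where "j = (LEAST j. \<sigma> j \<noteq> \<tau> j)"
  have neq: "\<sigma> j \<noteq> \<tau> j"
    unfolding j_def by (rule LeastI_ex[OF ex])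
  have eq: "\<sigma> i = \<tau> i" if "i < j" for i
    using not_less_Least[OF that[unfolded j_def]] by simp
  show False
  proof (cases "\<sigma> j < \<tau> j")
    case True
    show False by (rule aux[OF assms(2,1) _ True]) (simp add: eq)
  next
    case False
    then have "\<tau> j < \<sigma> j" using neq by simp
    then show False by (intro aux[OF assms eq])
  qed
qed

definition singular_value :: "(ell2 \<Rightarrow>\<^sub>L ell2) \<Rightarrow> nat \<Rightarrow> real"
  where "singular_value T = (THE \<sigma>. is_singular_value_seq T \<sigma>)"

definition schatten :: "real \<Rightarrow> (ell2 \<Rightarrow>\<^sub>L ell2) set"
  where "schatten p = {T. compact_operator T \<and> summable (\<lambda>j. singular_value T j powr p)}"

definition schatten_norm :: "real \<Rightarrow> (ell2 \<Rightarrow>\<^sub>L ell2) \<Rightarrow> real"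
  where "schatten_norm p T = (\<Sum>j. singular_value T j powr p) powr (1 / p)"

definition schatten_dist :: "real \<Rightarrow> (ell2 \<Rightarrow>\<^sub>L ell2) \<Rightarrow> (ell2 \<Rightarrow>\<^sub>L ell2) \<Rightarrow> real"
  where "schatten_dist p S T = schatten_norm p (S - T)"


section \<open>Distortion\<close>

text \<open>
  \<open>distortion M d\<^sub>M N d\<^sub>N\<close> is the least distortion of an embedding of the metric space
  \<open>(M, d\<^sub>M)\<close> into the metric space \<open>(N, d\<^sub>N)\<close>. The metrics are passed explicitly because the
  Schatten metrics differ from the operator norm metric that their elements carry as bounded
  linear functions. The infimum is taken in \<open>[0, \<infinity>]\<close>, and is \<open>\<infinity>\<close> if no embedding exists.
\<close>

definition distortion ::
  "'a set \<Rightarrow> ('a \<Rightarrow> 'a \<Rightarrow> real) \<Rightarrow> 'b set \<Rightarrow> ('b \<Rightarrow> 'b \<Rightarrow> real) \<Rightarrow> ennreal"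
  where "distortion M dM N dN =
    Inf {\<alpha>. 1 \<le> \<alpha> \<and>
      (\<exists>f c. f ` M \<subseteq> N \<and> 0 < c \<and>
        (\<forall>x\<in>M. \<forall>y\<in>M.
           ennreal (c * dN (f x) (f y)) \<le> ennreal (dM x y) \<and>
           ennreal (dM x y) \<le> \<alpha> * ennreal (c * dN (f x) (f y))))}"

end

theory Submission
  imports Defs "Jordan_Normal_Form.Determinant"
begin

text \<open>
  The proof transports the change of density of D. R. Lewis from \<open>L\<^sub>p\<close> to the Schatten classes.
  Write \<open>n\<close> for the dimension of \<open>X\<close>. Among all \<open>n\<close>-tuples in \<open>X\<close> whose column
  \<open>C = (T\<^sub>1, \<dots>, T\<^sub>n)\<close> has Schatten \<open>p\<close>-norm at most \<open>1\<close>, one of maximal determinant is chosen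
  (\<open>maximal_determinant\<close>, \<open>exists_lewis_position\<close>). It is a basis of \<open>X\<close>. Let \<open>\<rho>\<close> be the \<open>p\<close>-th power
  of the modulus of \<open>C\<close>, a density of trace at most \<open>1\<close>. Every element of \<open>X\<close> is
  \<open>T = \<Sum>i. a i *\<^sub>R T\<^sub>i = R C\<close>, where the row \<open>R\<close> has operator norm at most \<open>L\<close>, the Euclidean norm
  of \<open>a\<close>; and \<open>C\<close> is, up to a partial isometry, \<open>\<rho>\<close> to the power \<open>1 / p\<close>. The embedding replaces
  this power by \<open>1 / q\<close>. Thus \<open>T\<close> and its image \<open>G\<close> are the same row \<open>R\<close> regarded as an element of
  \<open>L\<^sub>p\<close> and of \<open>L\<^sub>q\<close> of the density \<open>\<rho>\<close>.

  Hence the norm of \<open>T\<close> is at most that of \<open>G\<close>, as for functions on a probability space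
  (\<open>twist_lower\<close>), and interpolation with the operator norm (\<open>twist_upper\<close>) gives
  \<open>\<parallel>G\<parallel>\<^sub>q\<^sup>q \<le> L\<^sup>q\<^sup>-\<^sup>p \<parallel>T\<parallel>\<^sub>p\<^sup>p\<close>. What remains is a bound for \<open>L\<close> by \<open>\<parallel>T\<parallel>\<^sub>p\<close>, and this is what the maximality
  of the determinant provides. Adding a small multiple of \<open>a i *\<^sub>R T\<close> to each \<open>T\<^sub>i\<close> increases the
  determinant at a rate proportional to \<open>L\<^sup>2\<close>, so the norm of the column must grow accordingly. For
  \<open>p \<ge> 2\<close> convexity yields \<open>L\<^sup>2 \<le> n \<parallel>T\<parallel>\<^sub>p\<^sup>2\<close> (\<open>Lewis_high\<close>); for \<open>p \<le> 2\<close> the growth is controlled by the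
  squared norm of \<open>R\<close> in \<open>L\<^sub>2\<close> of the density, which is at most \<open>L\<^sup>2\<^sup>-\<^sup>p \<parallel>T\<parallel>\<^sub>p\<^sup>p\<close>, and
  \<open>L\<^sup>p \<le> n \<parallel>T\<parallel>\<^sub>p\<^sup>p\<close> follows (\<open>Lewis_low\<close>). Inserting these bounds gives the two exponents of the theorem.

  The inequalities between Schatten norms are not derived from trace inequalities or complex
  interpolation. They all reduce to Jensen's inequality, through two estimates for the sum of
  \<open>\<parallel>T x\<^sub>j\<parallel>\<^sup>p\<close> over an orthonormal system: it is at most \<open>\<parallel>T\<parallel>\<^sub>p\<^sup>p\<close> if \<open>p \<ge> 2\<close>, and at least \<open>\<parallel>T\<parallel>\<^sub>p\<^sup>p\<close> if
  \<open>p \<le> 2\<close> and the system is complete. Evaluating along the singular vectors of one of the two operators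
  under comparison is exact for that operator, and a scalar inequality for single vectors suffices.
  Both estimates need a singular value decomposition of compact operators, which is constructed by
  repeatedly splitting off a vector at which the norm is attained (\<open>compact_svd_exists\<close>).
\<close>

section \<open>Power means with subprobability weights\<close>

text \<open>
  Jensen's inequality. Weights of total mass \<open>m \<le> 1\<close> suffice because normalising
  them costs the factor \<open>m powr r \<le> m\<close>.
\<close>

lemma powr_sum_le_sum_powr:
  fixes w \<alpha> :: "'i \<Rightarrow> real"
  assumes fin: "finite I" and w: "\<And>i. i \<in> I \<Longrightarrow> 0 \<le> w i" "(\<Sum>i\<in>I. w i) \<le> 1"
    and \<alpha>: "\<And>i. i \<in> I \<Longrightarrow> 0 \<le> \<alpha> i" and r: "1 \<le> r"
  shows "(\<Sum>i\<in>I. w i * \<alpha> i) powr r \<le> (\<Sum>i\<in>I. w i * \<alpha> i powr r)"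
proof -
  define P where "P = {i \<in> I. 0 < w i \<and> 0 < \<alpha> i}"
  define m where "m = (\<Sum>i\<in>P. w i)"
  have P: "finite P" "P \<subseteq> I" using fin by (auto simp: P_def)
  have z: "w i * \<alpha> i = 0" "w i * \<alpha> i powr r = 0" if "i \<in> I - P" for i
    using that w(1)[of i] \<alpha>[of i] by (auto simp: P_def not_less)
  have e1: "(\<Sum>i\<in>I. w i * \<alpha> i) = (\<Sum>i\<in>P. w i * \<alpha> i)"
    by (rule sum.mono_neutral_right) (use fin P z in auto)
  have e2: "(\<Sum>i\<in>I. w i * \<alpha> i powr r) = (\<Sum>i\<in>P. w i * \<alpha> i powr r)"
    by (rule sum.mono_neutral_right) (use fin P z in auto)
  show ?thesis
  proof (cases "P = {}")
    case True
    then show ?thesis unfolding e1 e2 by simp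
  next
    case False
    have m0: "0 < m" unfolding m_def by (rule sum_pos) (use P False in \<open>auto simp: P_def\<close>)
    have "m \<le> (\<Sum>i\<in>I. w i)" unfolding m_def by (rule sum_mono2) (use fin P w in auto)
    then have m1: "m \<le> 1" using w by simp
    have pos: "0 < (\<Sum>i\<in>P. w i / m * \<alpha> i)"
      by (rule sum_pos) (use P False m0 in \<open>auto simp: P_def\<close>)
    have "(\<Sum>i\<in>P. (w i / m) *\<^sub>R \<alpha> i) powr r \<le> (\<Sum>i\<in>P. w i / m * \<alpha> i powr r)"
    proof (rule convex_on_sum[OF P(1) False powr_convex[OF r]])
      show "(\<Sum>i\<in>P. w i / m) = 1"
        using m0 by (simp add: m_def flip: sum_divide_distrib)
      fix i assume "i \<in> P"
      then show "0 \<le> w i / m" "\<alpha> i \<in> {0<..}" using m0 by (auto simp: P_def)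
    qed
    then have jensen: "(\<Sum>i\<in>P. w i / m * \<alpha> i) powr r \<le> (\<Sum>i\<in>P. w i / m * \<alpha> i powr r)"
      by simp
    have "(\<Sum>i\<in>P. w i * \<alpha> i) = m * (\<Sum>i\<in>P. w i / m * \<alpha> i)"
      using m0 by (simp add: sum_distrib_left)
    then have "(\<Sum>i\<in>P. w i * \<alpha> i) powr r = m powr r * (\<Sum>i\<in>P. w i / m * \<alpha> i) powr r"
      using m0 pos by (simp add: powr_mult)
    also have "\<dots> \<le> m * (\<Sum>i\<in>P. w i / m * \<alpha> i powr r)"
    proof (rule mult_mono[OF _ jensen])
      have "m powr r \<le> m powr 1" by (rule powr_mono') (use m0 m1 r in auto)
      then show "m powr r \<le> m" using m0 by simp
    qed (use m0 in auto)
    also have "\<dots> = (\<Sum>i\<in>P. w i * \<alpha> i powr r)"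
      using m0 by (simp add: sum_distrib_left)
    finally show ?thesis unfolding e1 e2 .
  qed
qed

text \<open>
  The concave counterpart, obtained from the convex one for the exponent \<open>1 / r\<close>.
\<close>

lemma sum_powr_le_powr_sum:
  fixes w \<alpha> :: "'i \<Rightarrow> real"
  assumes fin: "finite I" and w: "\<And>i. i \<in> I \<Longrightarrow> 0 \<le> w i" "(\<Sum>i\<in>I. w i) \<le> 1"
    and \<alpha>: "\<And>i. i \<in> I \<Longrightarrow> 0 \<le> \<alpha> i" and r: "0 < r" "r \<le> 1"
  shows "(\<Sum>i\<in>I. w i * \<alpha> i powr r) \<le> (\<Sum>i\<in>I. w i * \<alpha> i) powr r"
proof -
  have nn: "0 \<le> (\<Sum>i\<in>I. w i * \<alpha> i powr r)" by (intro sum_nonneg mult_nonneg_nonneg w) auto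
  have "(\<Sum>i\<in>I. w i * \<alpha> i powr r) powr (1 / r) \<le> (\<Sum>i\<in>I. w i * (\<alpha> i powr r) powr (1 / r))"
    by (rule powr_sum_le_sum_powr) (use fin w r in auto)
  also have "\<dots> = (\<Sum>i\<in>I. w i * \<alpha> i)"
    by (rule sum.cong) (use \<alpha> r in \<open>auto simp: powr_powr\<close>)
  finally have "((\<Sum>i\<in>I. w i * \<alpha> i powr r) powr (1 / r)) powr r \<le> (\<Sum>i\<in>I. w i * \<alpha> i) powr r"
    by (intro powr_mono2) (use r in auto)
  then show ?thesis using nn r by (simp add: powr_powr)
qed

text \<open>
  This is Jensen's inequality for the weights \<open>\<beta> i powr t\<close>: the exponents are
  related so that the factor \<open>\<beta> i powr (r - t)\<close>, raised to the power \<open>s /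
  r\<close>, cancels the weight.
\<close>

lemma Hoelder_sum_powr:
  fixes \<alpha> \<beta> :: "'i \<Rightarrow> real"
  assumes fin: "finite I" and \<alpha>: "\<And>i. i \<in> I \<Longrightarrow> 0 \<le> \<alpha> i" and \<beta>: "\<And>i. i \<in> I \<Longrightarrow> 0 \<le> \<beta> i"
    and r: "0 < r" "r < s" and t: "1 / t = 1 / r - 1 / s"
    and le1: "(\<Sum>i\<in>I. \<beta> i powr t) \<le> 1"
  shows "(\<Sum>i\<in>I. (\<alpha> i * \<beta> i) powr r) \<le> (\<Sum>i\<in>I. \<alpha> i powr s) powr (r / s)"
proof -
  have "1 / t = (s - r) / (r * s)" using r unfolding t by (simp add: field_simps)
  then have "1 / (1 / t) = 1 / ((s - r) / (r * s))" by (rule arg_cong)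
  then have t': "t = r * s / (s - r)" by simp
  have t0: "0 < t" unfolding t' using r by simp
  define z where "z i = \<alpha> i powr r * \<beta> i powr (r - t)" for i
  have e: "(r - t) * (s / r) = - t" unfolding t' using r by (simp add: field_simps)
  have z1: "\<beta> i powr t * z i = (\<alpha> i * \<beta> i) powr r" if "i \<in> I" for i
  proof (cases "\<beta> i = 0")
    case False
    then have "\<beta> i powr t * \<beta> i powr (r - t) = \<beta> i powr r" by (simp flip: powr_add)
    then show ?thesis using \<alpha>[OF that] \<beta>[OF that]
      unfolding z_def by (simp add: powr_mult mult_ac)
  qed simp
  have z2: "\<beta> i powr t * z i powr (s / r) \<le> \<alpha> i powr s" if "i \<in> I" for i
  proof (cases "\<beta> i = 0")
    case False
    then have b: "0 < \<beta> i" using \<beta>[OF that] by simp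
    have "z i powr (s / r) = \<alpha> i powr s * \<beta> i powr (- t)"
      using r e \<alpha>[OF that] by (simp add: z_def powr_mult powr_powr)
    then show ?thesis using b by (simp add: mult_ac flip: powr_add)
  qed simp
  have "(\<Sum>i\<in>I. (\<alpha> i * \<beta> i) powr r) = (\<Sum>i\<in>I. \<beta> i powr t * z i)"
    by (rule sum.cong) (use z1 in auto)
  also have "\<dots> = ((\<Sum>i\<in>I. \<beta> i powr t * z i) powr (s / r)) powr (r / s)"
    using r by (simp add: powr_powr sum_nonneg z_def)
  also have "\<dots> \<le> (\<Sum>i\<in>I. \<beta> i powr t * z i powr (s / r)) powr (r / s)"
  proof (rule powr_mono2)
    show "(\<Sum>i\<in>I. \<beta> i powr t * z i) powr (s / r) \<le> (\<Sum>i\<in>I. \<beta> i powr t * z i powr (s / r))"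
      by (rule powr_sum_le_sum_powr) (use fin le1 r in \<open>auto simp: z_def\<close>)
  qed (use r in auto)
  also have "\<dots> \<le> (\<Sum>i\<in>I. \<alpha> i powr s) powr (r / s)"
    by (rule powr_mono2) (use r z2 in \<open>auto intro!: sum_mono sum_nonneg\<close>)
  finally show ?thesis .
qed

text \<open>
  Comparison of the first-order terms at \<open>\<epsilon> = 0\<close>. Extremality of a
  configuration enters the proof through inequalities of this form, one for each perturbation.
\<close>

lemma le_of_linear_le_powr:
  fixes a b m :: real
  assumes "0 \<le> b" "0 \<le> m" and le: "\<And>\<epsilon>. 0 < \<epsilon> \<Longrightarrow> 1 + \<epsilon> * a \<le> (1 + \<epsilon> * b) powr m"
  shows "a \<le> m * b"
proof -
  have "((\<lambda>\<epsilon>. (exp (\<epsilon> * (m * b)) - 1) / \<epsilon>) \<longlongrightarrow> m * b) (at_right 0)"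
  proof -
    have "((\<lambda>\<epsilon>. exp (\<epsilon> * (m * b))) has_field_derivative m * b) (at 0 within {0<..})"
      by (rule derivative_eq_intros | simp)+
    then show ?thesis by (simp add: has_field_derivative_iff)
  qed
  moreover have "eventually (\<lambda>\<epsilon>. a \<le> (exp (\<epsilon> * (m * b)) - 1) / \<epsilon>) (at_right 0)"
    unfolding eventually_at_right_field
  proof (intro exI[of _ 1] conjI allI impI)
    fix \<epsilon> :: real assume "0 < \<epsilon>" "\<epsilon> < 1"
    have "1 + \<epsilon> * a \<le> (1 + \<epsilon> * b) powr m" using le \<open>0 < \<epsilon>\<close> by simp
    also have "\<dots> \<le> exp (\<epsilon> * b) powr m"
      by (rule powr_mono2) (use assms \<open>0 < \<epsilon>\<close> in auto)
    also have "\<dots> = exp (\<epsilon> * (m * b))" by (simp add: powr_def mult_ac)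
    finally show "a \<le> (exp (\<epsilon> * (m * b)) - 1) / \<epsilon>"
      using \<open>0 < \<epsilon>\<close> by (simp add: field_simps)
  qed simp
  ultimately show ?thesis by (rule tendsto_lowerbound) simp
qed

section \<open>Adjoints on the sequence space\<close>

lift_definition unit_vec :: "nat \<Rightarrow> ell2" is "\<lambda>k n. if n = k then 1 else (0::real)"
  by (rule summable_finite[of "{_}"]) auto

lemma inner_unit_vec: "inner (unit_vec k) x = coord x k"
proof -
  have "inner (unit_vec k) x = (\<Sum>n. coord (unit_vec k) n * coord x n)" by (simp add: inner_ell2_def)
  also have "\<dots> = (\<Sum>n\<in>{k}. coord (unit_vec k) n * coord x n)"
    by (rule suminf_finite) (auto simp: unit_vec.rep_eq)
  finally show ?thesis by (simp add: unit_vec.rep_eq)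
qed

lemma coord_sum: "coord (\<Sum>i\<in>I. f i) n = (\<Sum>i\<in>I. coord (f i) n)"
  by (induction I rule: infinite_finite_induct) (auto simp: zero_ell2.rep_eq plus_ell2.rep_eq)

lemma inner_ell2_sums: "(\<lambda>n. coord x n * coord y n) sums inner x y"
  unfolding inner_ell2_def
  by (intro summable_sums summable_mult_of_squares summable_coord_square)

lemma unit_vec_expansion: "(\<lambda>n. coord x n *\<^sub>R unit_vec n) sums x"
proof -
  have sq: "(norm (x - (\<Sum>n<N. coord x n *\<^sub>R unit_vec n)))\<^sup>2 = (norm x)\<^sup>2 - (\<Sum>n<N. (coord x n)\<^sup>2)" for N
  proof -
    let ?p = "\<Sum>n<N. coord x n *\<^sub>R unit_vec n"
    have px: "inner ?p y = (\<Sum>n<N. coord x n * coord y n)" for y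
      by (simp add: inner_sum_left inner_unit_vec)
    have "coord ?p n = coord x n" if "n < N" for n
      using that by (simp add: coord_sum scaleR_ell2.rep_eq unit_vec.rep_eq if_distrib cong: if_cong)
    then have pp: "inner ?p ?p = (\<Sum>n<N. (coord x n)\<^sup>2)"
      unfolding px by (intro sum.cong) (auto simp: power2_eq_square)
    show ?thesis unfolding power2_norm_eq_inner inner_diff_left inner_diff_right
      using pp px[of x] by (simp add: inner_commute power2_eq_square)
  qed
  have "(\<lambda>N. (norm x)\<^sup>2 - (\<Sum>n<N. (coord x n)\<^sup>2)) \<longlonglongrightarrow> (norm x)\<^sup>2 - (norm x)\<^sup>2"
    by (intro tendsto_intros) (use inner_ell2_sums[of x x] in \<open>simp add: sums_def power2_norm_eq_inner flip: power2_eq_square\<close>)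
  then have "(\<lambda>N. sqrt ((norm (x - (\<Sum>n<N. coord x n *\<^sub>R unit_vec n)))\<^sup>2)) \<longlonglongrightarrow> sqrt 0"
    unfolding sq by (intro tendsto_real_sqrt) simp
  then have "(\<lambda>N. x - (\<Sum>n<N. coord x n *\<^sub>R unit_vec n)) \<longlonglongrightarrow> 0"
    by (simp add: tendsto_norm_zero_iff)
  from tendsto_diff[OF tendsto_const[of x] this] show ?thesis unfolding sums_def by simp
qed

text \<open>
  The function \<^const>\<open>adjoint\<close> is defined by choice, and its defining equation
  holds for a bounded operator only because bounded functionals are represented by vectors. The
  representing vector has the coordinates \<open>\<phi> (unit_vec n)\<close>; testing
  \<open>\<phi>\<close> on their partial sums shows that they are square-summable.
\<close>

lemma Riesz_ell2:
  fixes \<phi> :: "ell2 \<Rightarrow> real"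
  assumes "bounded_linear \<phi>"
  shows "\<exists>y. \<forall>x. \<phi> x = inner x y"
proof -
  interpret \<phi>: bounded_linear \<phi> by fact
  obtain K where K: "0 < K" "\<And>x. norm (\<phi> x) \<le> norm x * K" using \<phi>.pos_bounded by blast
  define c where "c n = \<phi> (unit_vec n)" for n
  have bound: "(\<Sum>n<N. (c n)\<^sup>2) \<le> K\<^sup>2" for N
  proof -
    let ?y = "\<Sum>n<N. c n *\<^sub>R unit_vec n" and ?S = "\<Sum>n<N. (c n)\<^sup>2"
    have S: "0 \<le> ?S" by (simp add: sum_nonneg)
    have 1: "\<phi> ?y = ?S" by (simp add: \<phi>.sum \<phi>.scaleR c_def power2_eq_square)
    have "inner ?y ?y = (\<Sum>n<N. c n * coord ?y n)" by (simp add: inner_sum_left inner_unit_vec)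
    also have "\<dots> = ?S"
      by (intro sum.cong) (auto simp: coord_sum scaleR_ell2.rep_eq unit_vec.rep_eq if_distrib
          power2_eq_square cong: if_cong)
    finally have 2: "norm ?y = sqrt ?S" by (simp add: norm_eq_sqrt_inner)
    have "?S \<le> sqrt ?S * K" using K(2)[of ?y] unfolding 1 2 using S by simp
    then have "sqrt ?S * sqrt ?S \<le> sqrt ?S * K" using S by simp
    then have "sqrt ?S \<le> K" using K(1) S
      by (metis less_eq_real_def mult_le_cancel_left_pos real_sqrt_gt_0_iff real_sqrt_zero)
    then show ?thesis by (rule sqrt_le_D)
  qed
  have "summable (\<lambda>n. (c n)\<^sup>2)" by (rule summableI_nonneg_bounded[OF _ bound]) simp
  then have c: "coord (Abs_ell2 c) = c" by (simp add: Abs_ell2_inverse)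
  have "\<phi> x = inner x (Abs_ell2 c)" for x
  proof (rule sums_unique2)
    show "(\<lambda>n. coord x n * c n) sums \<phi> x"
      using \<phi>.sums[OF unit_vec_expansion[of x]] by (simp add: \<phi>.scaleR c_def)
    show "(\<lambda>n. coord x n * c n) sums inner x (Abs_ell2 c)"
      using inner_ell2_sums[of x "Abs_ell2 c"] by (simp add: c)
  qed
  then show ?thesis by blast
qed

type_synonym operator = "ell2 \<Rightarrow>\<^sub>L ell2"

lemma adjoint_blinfun_works:
  fixes T :: operator
  shows "inner (blinfun_apply T x) y = inner x (adjoint (blinfun_apply T) y)"
proof -
  have "\<exists>z. \<forall>x. inner (blinfun_apply T x) y = inner x z" for y
    by (rule Riesz_ell2) (intro bounded_linear_intros)
  then have "\<exists>g. \<forall>x y. inner (blinfun_apply T x) y = inner x (g y)" by metis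
  then show ?thesis unfolding adjoint_def by (rule someI2_ex) blast
qed

lemma adjoint_blinfun_bounded_linear: "bounded_linear (adjoint (blinfun_apply (T :: operator)))"
proof (rule bounded_linear_intro[of _ "norm T"])
  let ?A = "adjoint (blinfun_apply T)"
  fix x y :: ell2 and r :: real
  have "inner z (?A (x + y)) = inner z (?A x + ?A y)" for z
    by (simp add: inner_add_right flip: adjoint_blinfun_works)
  then show "?A (x + y) = ?A x + ?A y" by (metis vector_eq_rdot inner_commute)
  have "inner z (?A (r *\<^sub>R x)) = inner z (r *\<^sub>R ?A x)" for z
    by (simp flip: adjoint_blinfun_works)
  then show "?A (r *\<^sub>R x) = r *\<^sub>R ?A x" by (metis vector_eq_rdot inner_commute)
  have "(norm (?A x))\<^sup>2 = inner (T (?A x)) x"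
    by (simp add: power2_norm_eq_inner adjoint_blinfun_works)
  also have "\<dots> \<le> norm (T (?A x)) * norm x" by (rule norm_cauchy_schwarz)
  also have "\<dots> \<le> norm T * norm (?A x) * norm x" by (intro mult_right_mono norm_blinfun) simp
  finally have "norm (?A x) * norm (?A x) \<le> norm (?A x) * (norm x * norm T)"
    by (simp add: power2_eq_square mult_ac)
  then show "norm (?A x) \<le> norm x * norm T"
    by (cases "?A x = 0") (auto simp: mult_le_cancel_left)
qed

definition adj :: "operator \<Rightarrow> operator"
  where "adj T = Blinfun (adjoint (blinfun_apply T))"

lemma adj_apply: "blinfun_apply (adj T) = adjoint (blinfun_apply T)"
  unfolding adj_def by (rule bounded_linear_Blinfun_apply) (rule adjoint_blinfun_bounded_linear)

lemma inner_adj: "inner (blinfun_apply (adj T) y) x = inner y (blinfun_apply T x)"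
  by (simp add: adj_apply inner_commute[of _ x] inner_commute[of y] flip: adjoint_blinfun_works)

lemma operator_eqI:
  fixes S T :: operator
  assumes "\<And>x y. inner (blinfun_apply S x) y = inner (blinfun_apply T x) y"
  shows "S = T"
  by (rule blinfun_eqI) (metis assms vector_eq_rdot)

lemma adj_eqI:
  assumes "\<And>x y. inner (blinfun_apply S y) x = inner y (blinfun_apply T x)"
  shows "adj T = S"
  by (rule operator_eqI) (simp add: inner_adj assms)

lemma adj_adj [simp]: "adj (adj T) = T"
  by (rule adj_eqI) (metis inner_adj inner_commute)

lemma adj_add: "adj (S + T) = adj S + adj T"
  by (rule adj_eqI) (simp add: blinfun.add_left inner_add_left inner_add_right inner_adj)

lemma adj_scaleR: "adj (c *\<^sub>R T) = c *\<^sub>R adj T"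
  by (rule adj_eqI) (simp add: blinfun.scaleR_left inner_adj)

lemma adj_compose: "adj (S o\<^sub>L T) = adj T o\<^sub>L adj S"
  by (rule adj_eqI) (simp add: inner_adj)

lemma norm_adj_le: "norm (adj T) \<le> norm T"
proof (rule norm_blinfun_bound)
  fix x
  have "(norm (adj T x))\<^sup>2 = inner x (T (adj T x))"
    by (simp add: power2_norm_eq_inner inner_adj)
  also have "\<dots> \<le> norm x * norm (T (adj T x))" by (rule norm_cauchy_schwarz)
  also have "\<dots> \<le> norm x * (norm T * norm (adj T x))" by (intro mult_left_mono norm_blinfun) simp
  finally have "norm (adj T x) * norm (adj T x) \<le> norm (adj T x) * (norm T * norm x)"
    by (simp add: power2_eq_square mult_ac)
  then show "norm (adj T x) \<le> norm T * norm x"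
    by (cases "adj T x = 0") (auto simp: mult_le_cancel_left)
qed simp

lemma norm_adj: "norm (adj T) = norm T"
  using norm_adj_le[of T] norm_adj_le[of "adj T"] by simp

lemma bounded_linear_adj: "bounded_linear adj"
  by (rule bounded_linear_intro[of _ 1]) (auto simp: adj_add adj_scaleR norm_adj)

definition rank1 :: "ell2 \<Rightarrow> ell2 \<Rightarrow> operator"
  where "rank1 u v = Blinfun (\<lambda>x. inner v x *\<^sub>R u)"

lemma rank1_apply [simp]: "blinfun_apply (rank1 u v) x = inner v x *\<^sub>R u"
  unfolding rank1_def by (subst bounded_linear_Blinfun_apply) (auto intro!: bounded_linear_intros)

lemma adj_rank1: "adj (rank1 u v) = rank1 v u"
  by (rule adj_eqI) (simp add: inner_commute)

section \<open>Compact operators\<close>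

lemma compact_operatorI:
  fixes T :: operator
  assumes "\<And>S. bounded S \<Longrightarrow> \<exists>K. compact K \<and> blinfun_apply T ` S \<subseteq> K"
  shows "compact_operator T"
  unfolding compact_operator_def
proof (intro allI impI)
  fix S :: "ell2 set" assume "bounded S"
  from assms[OF this] obtain K where K: "compact K" "blinfun_apply T ` S \<subseteq> K" by blast
  then have "closure (blinfun_apply T ` S) \<subseteq> K" by (intro closure_minimal compact_imp_closed)
  then show "compact (closure (blinfun_apply T ` S))"
    using compact_Int_closed[OF K(1) closed_closure] by (metis Int_absorb1)
qed

lemma compact_operator_rank1: "compact_operator (rank1 u v)"
proof (rule compact_operatorI)
  fix S :: "ell2 set" assume "bounded S"
  then obtain M where M: "\<And>x. x \<in> S \<Longrightarrow> norm x \<le> M" by (auto simp: bounded_iff)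
  have "compact ((\<lambda>t. t *\<^sub>R u) ` {- (norm v * M) .. norm v * M})"
    by (intro compact_continuous_image continuous_intros) simp
  moreover have "inner v x \<in> {- (norm v * M) .. norm v * M}" if "x \<in> S" for x
  proof -
    have "\<bar>inner v x\<bar> \<le> norm v * M"
      using Cauchy_Schwarz_ineq2[of v x] M[OF that] by (meson mult_left_mono norm_ge_zero order_trans)
    then show ?thesis by auto
  qed
  ultimately show "\<exists>K. compact K \<and> blinfun_apply (rank1 u v) ` S \<subseteq> K" by (intro exI conjI) auto
qed

lemma compact_operator_add:
  fixes T U :: operator
  assumes "compact_operator T" "compact_operator U"
  shows "compact_operator (T + U)"
proof (rule compact_operatorI)
  fix S :: "ell2 set" assume "bounded S"
  let ?A = "closure (blinfun_apply T ` S)" and ?B = "closure (blinfun_apply U ` S)"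
  have "compact ?A" "compact ?B" using assms \<open>bounded S\<close> by (auto simp: compact_operator_def)
  then have "compact {x + y |x y. x \<in> ?A \<and> y \<in> ?B}" by (rule compact_sums)
  moreover have "T x \<in> ?A" "U x \<in> ?B" if "x \<in> S" for x
    by (rule subsetD[OF closure_subset imageI[OF that]])+
  then have "blinfun_apply (T + U) ` S \<subseteq> {x + y |x y. x \<in> ?A \<and> y \<in> ?B}"
    by (simp only: image_subset_iff blinfun.add_left) blast
  ultimately show "\<exists>K. compact K \<and> blinfun_apply (T + U) ` S \<subseteq> K" by blast
qed

lemma compact_operator_compose:
  fixes T R :: operator
  assumes "compact_operator T"
  shows "compact_operator (R o\<^sub>L T)"
proof (rule compact_operatorI)
  fix S :: "ell2 set" assume "bounded S"
  then have "compact (blinfun_apply R ` closure (blinfun_apply T ` S))"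
    using assms unfolding compact_operator_def
    by (intro compact_continuous_image linear_continuous_on blinfun.bounded_linear_right) blast
  moreover have "T x \<in> closure (blinfun_apply T ` S)" if "x \<in> S" for x
    by (rule subsetD[OF closure_subset imageI[OF that]])
  then have "blinfun_apply (R o\<^sub>L T) ` S \<subseteq> blinfun_apply R ` closure (blinfun_apply T ` S)"
    by (simp only: image_subset_iff blinfun_apply_blinfun_compose) blast
  ultimately show "\<exists>K. compact K \<and> blinfun_apply (R o\<^sub>L T) ` S \<subseteq> K" by blast
qed

lemma compact_operator_scaleR:
  fixes T :: operator
  assumes "compact_operator T"
  shows "compact_operator (c *\<^sub>R T)"
proof -
  have "c *\<^sub>R T = (c *\<^sub>R id_blinfun) o\<^sub>L T" by (rule blinfun_eqI) (simp add: blinfun.scaleR_left)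
  then show ?thesis using compact_operator_compose[OF assms] by simp
qed

lemma compact_operator_zero: "compact_operator (0 :: operator)"
proof -
  have "rank1 0 0 = 0" by (rule blinfun_eqI) simp
  then show ?thesis using compact_operator_rank1[of 0 0] by simp
qed

lemma compact_operator_sum:
  fixes T :: "'i \<Rightarrow> operator"
  assumes "\<And>i. i \<in> I \<Longrightarrow> compact_operator (T i)"
  shows "compact_operator (\<Sum>i\<in>I. T i)"
  using assms
  by (induction I rule: infinite_finite_induct) (auto intro: compact_operator_zero compact_operator_add)

text \<open>
  A finite net for the image of a bounded set under a nearby \<open>X n\<close> is also a net for
  its image under \<open>T\<close>.
\<close>

lemma compact_operator_limit:
  fixes T :: operator
  assumes X: "\<And>n. compact_operator (X n)" "X \<longlonglongrightarrow> T"
  shows "compact_operator T"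
  unfolding compact_operator_def
proof (intro allI impI)
  fix S :: "ell2 set" assume "bounded S"
  then obtain M where M: "\<And>x. x \<in> S \<Longrightarrow> norm x \<le> M" "0 < M" by (auto simp: bounded_pos)
  show "compact (closure (blinfun_apply T ` S))" unfolding compact_eq_totally_bounded
  proof (intro conjI allI impI)
    show "complete (closure (blinfun_apply T ` S))" by (simp add: complete_eq_closed)
    fix \<epsilon> :: real assume \<epsilon>: "0 < \<epsilon>"
    define \<eta> where "\<eta> = \<epsilon> / 4"
    have \<eta>: "0 < \<eta>" using \<epsilon> by (simp add: \<eta>_def)
    obtain n where n: "norm (X n - T) < \<eta> / M"
      using LIMSEQ_D[OF X(2), of "\<eta> / M"] \<eta> M by (auto simp: divide_pos_pos)
    have "compact (closure (blinfun_apply (X n) ` S))" using X(1) \<open>bounded S\<close> by (auto simp: compact_operator_def)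
    then obtain k where k: "finite k" "closure (blinfun_apply (X n) ` S) \<subseteq> (\<Union>x\<in>k. ball x \<eta>)"
      using \<eta> unfolding compact_eq_totally_bounded by blast
    have "\<exists>x\<in>k. y \<in> ball x \<epsilon>" if y: "y \<in> closure (blinfun_apply T ` S)" for y
    proof -
      obtain z where z: "z \<in> S" "dist (T z) y < \<eta>"
        using y \<eta> unfolding closure_approachable by blast
      have "X n z \<in> closure (blinfun_apply (X n) ` S)"
        by (rule subsetD[OF closure_subset imageI[OF z(1)]])
      then obtain x where x: "x \<in> k" "dist x (X n z) < \<eta>" using k by auto
      have "norm (X n z - T z) \<le> norm (X n - T) * norm z"
        using norm_blinfun[of "X n - T" z] by (simp add: blinfun.diff_left)
      also have "\<dots> \<le> \<eta> / M * M" by (intro mult_mono) (use n M z \<eta> in auto)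
      finally have "dist (X n z) (T z) \<le> \<eta>" using M by (simp add: dist_norm)
      then have "dist x y < \<epsilon>"
        using x z dist_triangle[of x y "T z"] dist_triangle[of x "T z" "X n z"] \<epsilon> by (simp add: \<eta>_def)
      then show ?thesis using x by auto
    qed
    then show "\<exists>k. finite k \<and> closure (blinfun_apply T ` S) \<subseteq> (\<Union>x\<in>k. ball x \<epsilon>)"
      using k(1) by (intro exI[of _ k]) auto
  qed
qed

section \<open>Singular value decompositions\<close>

text \<open>
  Upper estimates only need Bessel's inequality, which, unlike orthonormality, survives the
  application of a contraction.
\<close>

definition bessel :: "(nat \<Rightarrow> ell2) \<Rightarrow> bool"
  where "bessel x \<longleftrightarrow> (\<forall>y N. (\<Sum>j<N. (inner (x j) y)\<^sup>2) \<le> (norm y)\<^sup>2)"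

text \<open>
  Zero vectors are admitted, so that the singular vectors of an operator of finite rank are also
  indexed by all natural numbers.
\<close>

definition ons :: "(nat \<Rightarrow> ell2) \<Rightarrow> bool"
  where "ons x \<longleftrightarrow> (\<forall>i j. i \<noteq> j \<longrightarrow> inner (x i) (x j) = 0) \<and> (\<forall>i. norm (x i) = 0 \<or> norm (x i) = 1)"

lemma ons_orthogonal: "ons x \<Longrightarrow> i \<noteq> j \<Longrightarrow> inner (x i) (x j) = 0"
  by (simp add: ons_def)

lemma ons_norm_le: "ons x \<Longrightarrow> norm (x i) \<le> 1"
  unfolding ons_def by (metis order.refl zero_le_one)

lemma ons_inner_norm: "ons x \<Longrightarrow> (norm (x i))\<^sup>2 * inner (x i) y = inner (x i) y"
  unfolding ons_def by (metis inner_zero_left mult_1 mult_zero_right norm_eq_zero one_power2)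

lemma ons_norm_sum:
  assumes "ons x" "finite I"
  shows "(norm (\<Sum>j\<in>I. c j *\<^sub>R x j))\<^sup>2 = (\<Sum>j\<in>I. (c j)\<^sup>2 * (norm (x j))\<^sup>2)"
proof -
  have "(norm (\<Sum>j\<in>I. c j *\<^sub>R x j))\<^sup>2 = (\<Sum>j\<in>I. (norm (c j *\<^sub>R x j))\<^sup>2)"
    by (rule norm_sum_Pythagorean)
       (use assms in \<open>auto simp: pairwise_def real_inner_class.orthogonal_def ons_orthogonal\<close>)
  then show ?thesis by (simp add: power_mult_distrib)
qed

lemma ons_norm_diff:
  assumes "ons x" "finite I"
  shows "(norm (y - (\<Sum>j\<in>I. inner (x j) y *\<^sub>R x j)))\<^sup>2 = (norm y)\<^sup>2 - (\<Sum>j\<in>I. (inner (x j) y)\<^sup>2)"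
proof -
  let ?p = "\<Sum>j\<in>I. inner (x j) y *\<^sub>R x j" and ?s = "\<Sum>j\<in>I. (inner (x j) y)\<^sup>2"
  have "inner ?p y = ?s" by (simp add: inner_sum_left power2_eq_square)
  moreover have "inner ?p ?p = ?s"
    unfolding power2_norm_eq_inner[symmetric] ons_norm_sum[OF assms]
  proof (intro sum.cong refl)
    fix j
    show "(inner (x j) y)\<^sup>2 * (norm (x j))\<^sup>2 = (inner (x j) y)\<^sup>2"
      using ons_inner_norm[OF assms(1), of j y] by (simp add: power2_eq_square mult_ac)
  qed
  ultimately show ?thesis
    unfolding power2_norm_eq_inner inner_diff_left inner_diff_right
    by (simp add: inner_commute)
qed

lemma ons_bessel: "ons x \<Longrightarrow> bessel x"
  unfolding bessel_def
proof (intro allI)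
  fix y N assume "ons x"
  have "0 \<le> (norm (y - (\<Sum>j<N. inner (x j) y *\<^sub>R x j)))\<^sup>2" by simp
  then show "(\<Sum>j<N. (inner (x j) y)\<^sup>2) \<le> (norm y)\<^sup>2"
    unfolding ons_norm_diff[OF \<open>ons x\<close> finite_lessThan] by simp
qed

lemma bessel_sum_le: "bessel x \<Longrightarrow> (\<Sum>j<N. (inner (x j) y)\<^sup>2) \<le> (norm y)\<^sup>2"
  by (simp add: bessel_def)

lemma bessel_summable: "bessel x \<Longrightarrow> summable (\<lambda>j. (inner (x j) y)\<^sup>2)"
  by (rule summableI_nonneg_bounded[OF _ bessel_sum_le]) auto

lemma bessel_norm_le: "bessel x \<Longrightarrow> norm (x j) \<le> 1"
proof -
  assume b: "bessel x"
  have "(inner (x j) (x j))\<^sup>2 \<le> (\<Sum>k<Suc j. (inner (x k) (x j))\<^sup>2)" by (rule member_le_sum) auto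
  also have "\<dots> \<le> (norm (x j))\<^sup>2" by (rule bessel_sum_le[OF b])
  finally have "(norm (x j))\<^sup>2 * (norm (x j))\<^sup>2 \<le> (norm (x j))\<^sup>2 * 1"
    by (simp add: power2_eq_square dot_square_norm)
  moreover have "0 < (norm (x j))\<^sup>2" if "x j \<noteq> 0" using that by simp
  ultimately have "(norm (x j))\<^sup>2 \<le> 1"
    by (cases "x j = 0") (simp, metis mult_le_cancel_left_pos)
  then show "norm (x j) \<le> 1" by (simp add: power2_le_iff_abs_le abs_square_le_1)
qed

lemma bessel_sum_set_le: "bessel x \<Longrightarrow> finite I \<Longrightarrow> (\<Sum>j\<in>I. (inner (x j) y)\<^sup>2) \<le> (norm y)\<^sup>2"
proof -
  assume b: "bessel x" and "finite I"
  then obtain N where "I \<subseteq> {..<N}" using finite_nat_iff_bounded by blast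
  then have "(\<Sum>j\<in>I. (inner (x j) y)\<^sup>2) \<le> (\<Sum>j<N. (inner (x j) y)\<^sup>2)" by (intro sum_mono2) auto
  also have "\<dots> \<le> (norm y)\<^sup>2" by (rule bessel_sum_le[OF b])
  finally show ?thesis .
qed

text \<open>
  Convergence in the operator norm is required, not just pointwise: compactness and the passage to
  the adjoint are then immediate. At the singular value \<open>0\<close> either vector
  may vanish, which accommodates operators of finite rank.
\<close>

definition svd :: "operator \<Rightarrow> (nat \<Rightarrow> real) \<Rightarrow> (nat \<Rightarrow> ell2) \<Rightarrow> (nat \<Rightarrow> ell2) \<Rightarrow> bool"
  where "svd T s u v \<longleftrightarrow> (\<forall>k. 0 \<le> s k) \<and> ons u \<and> ons v \<and>
    (\<forall>k. s k \<noteq> 0 \<longrightarrow> norm (u k) = 1 \<and> norm (v k) = 1) \<and>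
    (\<lambda>k. s k *\<^sub>R rank1 (u k) (v k)) sums T"

text \<open>
  Pythagoras in the range and Bessel in the domain. Applied to the tails of a series whose
  coefficients tend to \<open>0\<close>, it gives convergence in the operator norm.
\<close>

lemma norm_sum_rank1_le:
  assumes u: "ons u" and v: "ons v" and "finite I" and c: "\<And>k. k \<in> I \<Longrightarrow> \<bar>c k\<bar> \<le> M" and M: "0 \<le> M"
  shows "norm (\<Sum>k\<in>I. c k *\<^sub>R rank1 (u k) (v k)) \<le> M"
proof (rule norm_blinfun_bound[OF M])
  fix x
  have "(norm ((\<Sum>k\<in>I. c k *\<^sub>R rank1 (u k) (v k)) x))\<^sup>2 = (norm (\<Sum>k\<in>I. (c k * inner (v k) x) *\<^sub>R u k))\<^sup>2"
    by (simp add: blinfun.sum_left blinfun.scaleR_left)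
  also have "\<dots> = (\<Sum>k\<in>I. (c k * inner (v k) x)\<^sup>2 * (norm (u k))\<^sup>2)"
    by (rule ons_norm_sum[OF u \<open>finite I\<close>])
  also have "\<dots> \<le> (\<Sum>k\<in>I. M\<^sup>2 * (inner (v k) x)\<^sup>2)"
  proof (rule sum_mono)
    fix k assume "k \<in> I"
    have "(c k)\<^sup>2 \<le> M\<^sup>2" using c[OF \<open>k \<in> I\<close>] by (metis power2_abs power_mono abs_ge_zero)
    moreover have "(norm (u k))\<^sup>2 \<le> 1" using ons_norm_le[OF u, of k] by (simp add: power_le_one)
    ultimately have "(c k)\<^sup>2 * (inner (v k) x)\<^sup>2 * (norm (u k))\<^sup>2 \<le> M\<^sup>2 * (inner (v k) x)\<^sup>2 * 1"
      by (intro mult_mono) auto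
    then show "(c k * inner (v k) x)\<^sup>2 * (norm (u k))\<^sup>2 \<le> M\<^sup>2 * (inner (v k) x)\<^sup>2"
      by (simp add: power_mult_distrib)
  qed
  also have "\<dots> = M\<^sup>2 * (\<Sum>k\<in>I. (inner (v k) x)\<^sup>2)" by (simp add: sum_distrib_left)
  also have "\<dots> \<le> M\<^sup>2 * (norm x)\<^sup>2"
    by (intro mult_left_mono bessel_sum_set_le ons_bessel v \<open>finite I\<close>) simp
  finally have "(norm ((\<Sum>k\<in>I. c k *\<^sub>R rank1 (u k) (v k)) x))\<^sup>2 \<le> (M * norm x)\<^sup>2"
    by (simp only: power_mult_distrib)
  then show "norm ((\<Sum>k\<in>I. c k *\<^sub>R rank1 (u k) (v k)) x) \<le> M * norm x"
    by (rule power2_le_imp_le) (simp add: M)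
qed

lemma svd_exists:
  assumes c: "\<And>k. 0 \<le> c k" "c \<longlonglongrightarrow> 0" and u: "ons u" and v: "ons v"
    and one: "\<And>k. c k \<noteq> 0 \<Longrightarrow> norm (u k) = 1 \<and> norm (v k) = 1"
  shows "\<exists>T. svd T c u v"
proof -
  have "summable (\<lambda>k. c k *\<^sub>R rank1 (u k) (v k))"
    unfolding summable_Cauchy
  proof (intro allI impI)
    fix e :: real assume e: "0 < e"
    then obtain N where N: "\<And>k. k \<ge> N \<Longrightarrow> \<bar>c k\<bar> < e / 2"
      using LIMSEQ_D[OF c(2), of "e / 2"] by auto
    have "norm (\<Sum>k\<in>{m..<n}. c k *\<^sub>R rank1 (u k) (v k)) < e" if "m \<ge> N" for m n
    proof -
      have "norm (\<Sum>k\<in>{m..<n}. c k *\<^sub>R rank1 (u k) (v k)) \<le> e / 2"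
        by (rule norm_sum_rank1_le[OF u v]) (use N that e in \<open>auto intro: less_imp_le\<close>)
      then show ?thesis using e by simp
    qed
    then show "\<exists>N. \<forall>m\<ge>N. \<forall>n. norm (\<Sum>k\<in>{m..<n}. c k *\<^sub>R rank1 (u k) (v k)) < e" by blast
  qed
  then obtain T where "(\<lambda>k. c k *\<^sub>R rank1 (u k) (v k)) sums T" by (auto simp: summable_def)
  then show ?thesis using c(1) u v one unfolding svd_def by blast
qed

lemma svd_nonneg: "svd T s u v \<Longrightarrow> 0 \<le> s k"
  by (simp add: svd_def)

lemma svd_ons: "svd T s u v \<Longrightarrow> ons u" "svd T s u v \<Longrightarrow> ons v"
  by (simp_all add: svd_def)

lemma svd_norm_one:
  "svd T s u v \<Longrightarrow> s k \<noteq> 0 \<Longrightarrow> norm (u k) = 1" "svd T s u v \<Longrightarrow> s k \<noteq> 0 \<Longrightarrow> norm (v k) = 1"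
  by (simp_all add: svd_def)

lemma svd_compact: "svd T s u v \<Longrightarrow> compact_operator T"
  unfolding svd_def sums_def
  by (rule compact_operator_limit[of "\<lambda>n. \<Sum>k<n. s k *\<^sub>R rank1 (u k) (v k)"])
     (auto intro!: compact_operator_sum compact_operator_scaleR compact_operator_rank1)

lemma svd_adj: "svd T s u v \<Longrightarrow> svd (adj T) s v u"
  using bounded_linear.sums[OF bounded_linear_adj, of "\<lambda>k. s k *\<^sub>R rank1 (u k) (v k)" T]
  by (auto simp: svd_def adj_scaleR adj_rank1)

lemma svd_apply_sums: "svd T s u v \<Longrightarrow> (\<lambda>k. (s k * inner (v k) x) *\<^sub>R u k) sums blinfun_apply T x"
  using bounded_linear.sums[OF blinfun.bounded_linear_left, of "\<lambda>k. s k *\<^sub>R rank1 (u k) (v k)" T x]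
  by (auto simp: svd_def blinfun.scaleR_left)

lemma svd_inner_sums:
  "svd T s u v \<Longrightarrow> (\<lambda>k. s k * inner (v k) x * inner (u k) y) sums inner (blinfun_apply T x) y"
  using bounded_linear.sums[OF bounded_linear_inner_left svd_apply_sums] by simp

lemma svd_inner_left:
  assumes "svd T s u v"
  shows "inner (u k) (blinfun_apply T x) = s k * inner (v k) x"
proof -
  have "(\<lambda>l. inner (u k) ((s l * inner (v l) x) *\<^sub>R u l)) sums inner (u k) (blinfun_apply T x)"
    by (rule bounded_linear.sums[OF bounded_linear_inner_right svd_apply_sums[OF assms]])
  moreover have "(\<lambda>l. inner (u k) ((s l * inner (v l) x) *\<^sub>R u l)) sums (s k * inner (v k) x)"
  proof -
    have "(\<lambda>l. inner (u k) ((s l * inner (v l) x) *\<^sub>R u l)) = (\<lambda>l. if l = k then s k * inner (v k) x else 0)"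
    proof
      fix l
      show "inner (u k) ((s l * inner (v l) x) *\<^sub>R u l) = (if l = k then s k * inner (v k) x else 0)"
        using ons_orthogonal[OF svd_ons(1)[OF assms], of k l] svd_norm_one(1)[OF assms, of k]
        by (cases "s k = 0") (auto simp: dot_square_norm)
    qed
    then show ?thesis using sums_single[of k "\<lambda>_. s k * inner (v k) x"] by (simp add: eq_commute)
  qed
  ultimately show ?thesis by (rule sums_unique2)
qed

lemma svd_norm_sums:
  assumes "svd T s u v"
  shows "(\<lambda>k. (s k)\<^sup>2 * (inner (v k) x)\<^sup>2) sums (norm (blinfun_apply T x))\<^sup>2"
proof -
  have "(\<lambda>k. s k * inner (v k) x * inner (u k) (T x)) sums (norm (T x))\<^sup>2"
    using svd_inner_sums[OF assms, of x "T x"] by (simp add: power2_norm_eq_inner)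
  then show ?thesis by (simp add: svd_inner_left[OF assms] power2_eq_square mult_ac)
qed

lemma svd_apply_right:
  assumes "svd T s u v"
  shows "blinfun_apply T (v k) = s k *\<^sub>R u k"
proof -
  have "(\<lambda>l. (s l * inner (v l) (v k)) *\<^sub>R u l) = (\<lambda>l. if l = k then s k *\<^sub>R u k else 0)"
  proof
    fix l
    show "(s l * inner (v l) (v k)) *\<^sub>R u l = (if l = k then s k *\<^sub>R u k else 0)"
      using ons_orthogonal[OF svd_ons(2)[OF assms], of l k] svd_norm_one(2)[OF assms, of k]
      by (cases "s k = 0") (auto simp: dot_square_norm)
  qed
  then have "(\<lambda>l. (s l * inner (v l) (v k)) *\<^sub>R u l) sums (s k *\<^sub>R u k)"
    using sums_single[of k "\<lambda>_. s k *\<^sub>R u k"] by (simp add: eq_commute)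
  then show ?thesis using svd_apply_sums[OF assms] by (metis sums_unique2)
qed

lemma svd_norm_apply:
  assumes "svd T s u v"
  shows "norm (blinfun_apply T (v k)) = s k"
  using svd_apply_right[OF assms, of k] svd_nonneg[OF assms, of k] svd_norm_one(1)[OF assms, of k]
  by (cases "s k = 0") auto

lemma svd_tendsto_zero:
  assumes "svd T s u v"
  shows "s \<longlonglongrightarrow> 0"
proof -
  have "(\<lambda>k. s k *\<^sub>R rank1 (u k) (v k)) \<longlonglongrightarrow> 0"
    using assms unfolding svd_def by (meson summable_LIMSEQ_zero sums_summable)
  then have lim: "(\<lambda>k. norm (s k *\<^sub>R rank1 (u k) (v k))) \<longlonglongrightarrow> 0" by (rule tendsto_norm_zero)
  have "s k \<le> norm (s k *\<^sub>R rank1 (u k) (v k))" for k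
  proof (cases "s k = 0")
    case False
    have "norm ((s k *\<^sub>R rank1 (u k) (v k)) (v k)) \<le> norm (s k *\<^sub>R rank1 (u k) (v k)) * norm (v k)"
      by (rule norm_blinfun)
    then show ?thesis
      using svd_norm_one[OF assms False] by (simp add: blinfun.scaleR_left dot_square_norm)
  qed simp
  then show ?thesis
    by (intro tendsto_sandwich[OF _ _ tendsto_const lim]) (use svd_nonneg[OF assms] in auto)
qed

text \<open>
  Comparing the coefficients in the expansion of \<open>T\<^sup>* T x = r\<^sup>2 x\<close> shows
  that the eigenspace is spanned by the right singular vectors with singular value
  \<open>r\<close>, which are linearly independent.
\<close>

lemma svd_singular_value:
  assumes svd: "svd T s u v" and dec: "decseq s"
  shows "singular_value T = s"
proof -
  have lim: "s \<longlonglongrightarrow> 0" by (rule svd_tendsto_zero[OF svd])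
  have fin: "finite {j. s j = r}" if r: "0 < r" for r
  proof -
    obtain N where "\<And>k. k \<ge> N \<Longrightarrow> norm (s k - 0) < r" using LIMSEQ_D[OF lim r] by blast
    then have "{j. s j = r} \<subseteq> {..<N}" by (force simp: not_less[symmetric])
    then show ?thesis by (rule finite_subset) simp
  qed
  have "card {j. s j = r} = dim {x. adjoint (blinfun_apply T) (blinfun_apply T x) = r\<^sup>2 *\<^sub>R x}" if r: "0 < r" for r
  proof -
    let ?J = "{j. s j = r}"
    let ?E = "{x. adjoint (blinfun_apply T) (blinfun_apply T x) = r\<^sup>2 *\<^sub>R x}"
    have TT: "(\<lambda>k. ((s k)\<^sup>2 * inner (v k) x) *\<^sub>R v k) sums adjoint (blinfun_apply T) (blinfun_apply T x)" for x
      using svd_apply_sums[OF svd_adj[OF svd], of "T x"]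
      by (simp add: adj_apply svd_inner_left[OF svd] power2_eq_square mult_ac)
    have one: "norm (v j) = 1" if "j \<in> ?J" for j using svd_norm_one(2)[OF svd, of j] that r by auto
    have inj: "inj_on v ?J"
    proof (rule inj_onI, rule ccontr)
      fix i j assume "i \<in> ?J" "j \<in> ?J" "v i = v j" "i \<noteq> j"
      then show False
        using ons_orthogonal[OF svd_ons(2)[OF svd] \<open>i \<noteq> j\<close>] one[of j] by (auto simp: dot_square_norm)
    qed
    have "?E = span (v ` ?J)"
    proof
      show "?E \<subseteq> span (v ` ?J)"
      proof
        fix x assume "x \<in> ?E"
        then have x: "(\<lambda>k. ((s k)\<^sup>2 * inner (v k) x) *\<^sub>R v k) sums (r\<^sup>2 *\<^sub>R x)" using TT[of x] by simp
        have zero: "inner (v k) x = 0 \<or> s k = r" for k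
        proof -
          have "inner (v k) (r\<^sup>2 *\<^sub>R x) = inner (v k) (adj T (T x))" using \<open>x \<in> ?E\<close> by (simp add: adj_apply)
          also have "\<dots> = (s k)\<^sup>2 * inner (v k) x"
            by (simp add: svd_inner_left[OF svd_adj[OF svd]] svd_inner_left[OF svd] power2_eq_square)
          finally have "(r\<^sup>2 - (s k)\<^sup>2) * inner (v k) x = 0" by (simp add: algebra_simps)
          then show ?thesis using r svd_nonneg[OF svd, of k] by (auto simp: power2_eq_iff)
        qed
        have "(\<lambda>k. ((s k)\<^sup>2 * inner (v k) x) *\<^sub>R v k) sums (\<Sum>k\<in>?J. ((s k)\<^sup>2 * inner (v k) x) *\<^sub>R v k)"
          by (rule sums_finite[OF fin[OF r]]) (use zero in auto)
        then have "r\<^sup>2 *\<^sub>R x = (\<Sum>k\<in>?J. ((s k)\<^sup>2 * inner (v k) x) *\<^sub>R v k)" using x sums_unique2 by blast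
        also have "\<dots> \<in> span (v ` ?J)" by (intro span_sum span_scale span_base) auto
        finally have "(1 / r\<^sup>2) *\<^sub>R (r\<^sup>2 *\<^sub>R x) \<in> span (v ` ?J)" by (rule span_scale)
        then show "x \<in> span (v ` ?J)" using r by simp
      qed
      show "span (v ` ?J) \<subseteq> ?E"
      proof (rule span_minimal)
        show "v ` ?J \<subseteq> ?E"
          by (auto simp: svd_apply_right[OF svd] svd_apply_right[OF svd_adj[OF svd]] blinfun.scaleR_right
              power2_eq_square simp flip: adj_apply)
        show "subspace ?E"
          unfolding subspace_def adj_apply[symmetric]
          by (auto simp: blinfun.add_right blinfun.scaleR_right scaleR_add_right)
      qed
    qed
    moreover have "independent (v ` ?J)"
    proof (rule pairwise_orthogonal_independent)
      show "pairwise real_inner_class.orthogonal (v ` ?J)"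
      proof (rule pairwiseI)
        fix x y assume "x \<in> v ` ?J" "y \<in> v ` ?J" "x \<noteq> y"
        then obtain i j where ij: "x = v i" "y = v j" by blast
        then have "i \<noteq> j" using \<open>x \<noteq> y\<close> by blast
        then show "real_inner_class.orthogonal x y"
          using ons_orthogonal[OF svd_ons(2)[OF svd], of i j] by (simp add: real_inner_class.orthogonal_def ij)
      qed
      show "0 \<notin> v ` ?J"
      proof
        assume "0 \<in> v ` ?J"
        then obtain j where "j \<in> ?J" "0 = v j" by (rule imageE)
        then show False using one[of j] by simp
      qed
    qed
    ultimately have "dim ?E = card (v ` ?J)" by (simp add: dim_eq_card_independent)
    then show ?thesis by (simp add: card_image[OF inj])
  qed
  then have "is_singular_value_seq T s"
    unfolding is_singular_value_seq_def using dec fin svd_nonneg[OF svd] by auto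
  then show ?thesis
    unfolding singular_value_def by (blast intro: the_equality is_singular_value_seq_unique)
qed

text \<open>
  Let \<open>X m\<close> be unit vectors with \<open>norm (T (X m))\<close> tending to \<open>s =
  norm T\<close>. Then \<open>T\<^sup>* T (X m) - s\<^sup>2 X m\<close> tends to \<open>0\<close>;
  by compactness \<open>T (X m)\<close> converges along a subsequence, hence so does \<open>X
  m\<close>, and the limit is an eigenvector.
\<close>

lemma compact_operator_norm_attained:
  fixes T :: operator
  assumes comp: "compact_operator T" and nz: "T \<noteq> 0"
  shows "\<exists>x. norm x = 1 \<and> blinfun_apply (adj T) (blinfun_apply T x) = (norm T)\<^sup>2 *\<^sub>R x"
proof -
  define s where "s = norm T"
  have s: "0 < s" using nz by (simp add: s_def)
  have "\<exists>x. norm x = 1 \<and> s - 1 / real (Suc m) \<le> norm (T x)" for m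
  proof (rule ccontr)
    assume no: "\<not> (\<exists>x. norm x = 1 \<and> s - 1 / real (Suc m) \<le> norm (T x))"
    obtain y where y: "T y \<noteq> 0" using nz by (metis blinfun_eqI zero_blinfun.rep_eq)
    then have "y \<noteq> 0" by auto
    then have "norm (y /\<^sub>R norm y) = 1" by simp
    then have "norm (T (y /\<^sub>R norm y)) < s - 1 / real (Suc m)" using no by (meson not_le)
    then have pos: "0 \<le> s - 1 / real (Suc m)" by (meson norm_ge_zero le_less_trans less_imp_le)
    have "norm T \<le> s - 1 / real (Suc m)"
    proof (rule norm_blinfun_bound[OF pos])
      fix x
      show "norm (T x) \<le> (s - 1 / real (Suc m)) * norm x"
      proof (cases "x = 0")
        case False
        then have "norm (x /\<^sub>R norm x) = 1" by simp
        then have "norm (T (x /\<^sub>R norm x)) < s - 1 / real (Suc m)" using no by (meson not_le)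
        then show ?thesis using False by (simp add: blinfun.scaleR_right field_simps)
      qed simp
    qed
    then show False by (simp add: s_def)
  qed
  then obtain X where X: "\<And>m. norm (X m) = 1" "\<And>m. s - 1 / real (Suc m) \<le> norm (T (X m))" by metis
  have "compact (closure (blinfun_apply T ` cball 0 1))" using comp by (auto simp: compact_operator_def)
  moreover have "T (X m) \<in> closure (blinfun_apply T ` cball 0 1)" for m
    by (rule subsetD[OF closure_subset imageI]) (simp add: X)
  ultimately obtain y r where r: "strict_mono r" and y: "((\<lambda>m. T (X m)) \<circ> r) \<longlonglongrightarrow> y"
    unfolding compact_def by (metis (no_types, lifting))
  have normlim: "(\<lambda>m. norm (T (X m))) \<longlonglongrightarrow> s"
  proof (rule tendsto_sandwich)
    show "(\<lambda>m. s - 1 / real (Suc m)) \<longlonglongrightarrow> s"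
      using tendsto_diff[OF tendsto_const[of s] LIMSEQ_Suc[OF lim_1_over_n]] by simp
    show "\<forall>\<^sub>F m in sequentially. s - 1 / real (Suc m) \<le> norm (T (X m))" using X by simp
    show "\<forall>\<^sub>F m in sequentially. norm (T (X m)) \<le> s"
      using norm_blinfun[of T "X _"] X by (simp add: s_def)
  qed simp
  \<comment> \<open>A maximising sequence consists of approximate eigenvectors of the positive operator.\<close>
  define E where "E m = adj T (T (X m)) - s\<^sup>2 *\<^sub>R X m" for m
  have E: "(norm (E m))\<^sup>2 \<le> 2 * s ^ 4 - 2 * s\<^sup>2 * (norm (T (X m)))\<^sup>2" for m
  proof -
    have "norm (adj T (T (X m))) \<le> norm (adj T) * norm (T (X m))" by (rule norm_blinfun)
    also have "\<dots> \<le> s * (s * 1)"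
      using norm_blinfun[of T "X m"] X s by (intro mult_mono) (auto simp: s_def norm_adj)
    finally have "(norm (adj T (T (X m))))\<^sup>2 \<le> (s * s)\<^sup>2" by (intro power_mono) auto
    moreover have "inner (adj T (T (X m))) (X m) = (norm (T (X m)))\<^sup>2"
      by (simp add: inner_adj power2_norm_eq_inner)
    moreover have "(norm (E m))\<^sup>2 = (norm (adj T (T (X m))))\<^sup>2 - 2 * s\<^sup>2 * inner (adj T (T (X m))) (X m) + s ^ 4 * (norm (X m))\<^sup>2"
      unfolding E_def power2_norm_eq_inner
      by (simp add: inner_diff_left inner_diff_right inner_commute algebra_simps power2_eq_square power4_eq_xxxx)
    ultimately show ?thesis by (simp add: X power2_eq_square power4_eq_xxxx)
  qed
  have "(\<lambda>m. 2 * s ^ 4 - 2 * s\<^sup>2 * (norm (T (X m)))\<^sup>2) \<longlonglongrightarrow> 2 * s ^ 4 - 2 * s\<^sup>2 * s\<^sup>2"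
    by (intro tendsto_intros normlim)
  then have "(\<lambda>m. 2 * s ^ 4 - 2 * s\<^sup>2 * (norm (T (X m)))\<^sup>2) \<longlonglongrightarrow> 0"
    by (simp only: power2_eq_square power4_eq_xxxx mult.assoc diff_self)
  then have "(\<lambda>m. (norm (E m))\<^sup>2) \<longlonglongrightarrow> 0"
    by (rule Lim_null_comparison[rotated]) (intro always_eventually allI, simp add: E)
  then have "(\<lambda>m. sqrt ((norm (E m))\<^sup>2)) \<longlonglongrightarrow> sqrt 0" by (rule tendsto_real_sqrt)
  then have E0: "E \<longlonglongrightarrow> 0" by (simp add: tendsto_norm_zero_iff)
  then have Er: "(\<lambda>m. E (r m)) \<longlonglongrightarrow> 0" using LIMSEQ_subseq_LIMSEQ[OF E0 r] by (simp add: o_def)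
  have "(\<lambda>m. (1 / s\<^sup>2) *\<^sub>R (adj T (T (X (r m))) - E (r m))) \<longlonglongrightarrow> (1 / s\<^sup>2) *\<^sub>R (adj T y - 0)"
    using y by (intro tendsto_intros Er) (simp add: o_def)
  moreover have "(1 / s\<^sup>2) *\<^sub>R (adj T (T (X (r m))) - E (r m)) = X (r m)" for m
    using s by (simp add: E_def)
  ultimately have x: "(\<lambda>m. X (r m)) \<longlonglongrightarrow> (1 / s\<^sup>2) *\<^sub>R adj T y" (is "_ \<longlonglongrightarrow> ?x") by simp
  have "(\<lambda>m. norm (X (r m))) \<longlonglongrightarrow> norm ?x" by (intro tendsto_intros x)
  then have "norm ?x = 1" unfolding X(1) by (rule LIMSEQ_unique[OF _ tendsto_const])
  moreover have "(\<lambda>m. E (r m)) \<longlonglongrightarrow> adj T (T ?x) - s\<^sup>2 *\<^sub>R ?x"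
    unfolding E_def by (intro tendsto_intros x)
  then have "adj T (T ?x) - s\<^sup>2 *\<^sub>R ?x = 0" using Er LIMSEQ_unique by blast
  then have "adj T (T ?x) = s\<^sup>2 *\<^sub>R ?x" by (simp only: right_minus_eq)
  ultimately show ?thesis unfolding s_def by blast
qed

text \<open>
  The value \<open>0\<close> at \<open>T = 0\<close> lets the iteration of \<open>deflate\<close>
  stop at an operator of finite rank without a case distinction.
\<close>

definition top_vec :: "operator \<Rightarrow> ell2"
  where "top_vec T = (SOME x. if T = 0 then x = 0
    else norm x = 1 \<and> blinfun_apply (adj T) (blinfun_apply T x) = (norm T)\<^sup>2 *\<^sub>R x)"

definition deflate :: "operator \<Rightarrow> operator"
  where "deflate T = T - rank1 (blinfun_apply T (top_vec T)) (top_vec T)"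

lemma top_vec:
  assumes "compact_operator T"
  shows "T = 0 \<Longrightarrow> top_vec T = 0" "T \<noteq> 0 \<Longrightarrow> norm (top_vec T) = 1"
    "blinfun_apply (adj T) (blinfun_apply T (top_vec T)) = (norm T)\<^sup>2 *\<^sub>R top_vec T"
proof -
  have "\<exists>x. if T = 0 then x = 0 else norm x = 1 \<and> blinfun_apply (adj T) (blinfun_apply T x) = (norm T)\<^sup>2 *\<^sub>R x"
    using compact_operator_norm_attained[OF assms] by (cases "T = 0") auto
  then have *: "if T = 0 then top_vec T = 0 else norm (top_vec T) = 1 \<and>
      blinfun_apply (adj T) (blinfun_apply T (top_vec T)) = (norm T)\<^sup>2 *\<^sub>R top_vec T"
    unfolding top_vec_def by (rule someI_ex)
  then show "T = 0 \<Longrightarrow> top_vec T = 0" "T \<noteq> 0 \<Longrightarrow> norm (top_vec T) = 1"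
    "blinfun_apply (adj T) (blinfun_apply T (top_vec T)) = (norm T)\<^sup>2 *\<^sub>R top_vec T"
    by (auto split: if_splits simp: blinfun.zero_left)
qed

lemma deflate_apply: "blinfun_apply (deflate T) x = blinfun_apply T (x - inner (top_vec T) x *\<^sub>R top_vec T)"
  by (simp add: deflate_def blinfun.diff_left blinfun.diff_right blinfun.scaleR_right)

lemma compact_deflate: "compact_operator T \<Longrightarrow> compact_operator (deflate T)"
proof -
  assume "compact_operator T"
  moreover have "deflate T = T + (-1) *\<^sub>R rank1 (blinfun_apply T (top_vec T)) (top_vec T)"
    by (simp add: deflate_def)
  ultimately show ?thesis
    by (metis compact_operator_add compact_operator_scaleR compact_operator_rank1)
qed

text \<open>
  What the iteration preserves: the kernel grows by \<open>top_vec T\<close>, the range becomes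
  orthogonal to \<open>T (top_vec T)\<close>, and the norm does not increase.
\<close>

lemma deflate_kernel:
  assumes T: "compact_operator T"
  shows "blinfun_apply (deflate T) (top_vec T) = 0"
    "blinfun_apply T z = 0 \<Longrightarrow> inner (top_vec T) z = 0"
    "blinfun_apply T z = 0 \<Longrightarrow> blinfun_apply (deflate T) z = 0"
    "inner (blinfun_apply T (top_vec T)) (blinfun_apply (deflate T) x) = 0"
    "norm (deflate T) \<le> norm T"
    "norm (blinfun_apply T (top_vec T)) = norm T"
proof -
  let ?v = "top_vec T"
  have vv: "inner ?v ?v *\<^sub>R ?v = ?v" using top_vec[OF T] by (cases "T = 0") (auto simp: dot_square_norm)
  show "deflate T ?v = 0" by (simp add: deflate_apply vv)
  have TvTz: "inner (T ?v) (T z) = (norm T)\<^sup>2 * inner ?v z" for z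
    using top_vec(3)[OF T] by (metis inner_adj inner_commute inner_scaleR_left)
  show ker: "inner ?v z = 0" if "T z = 0" for z
    using TvTz[of z] top_vec(1)[OF T] that by (cases "T = 0") auto
  show "deflate T z = 0" if "T z = 0" for z
    using that ker[OF that] by (simp add: deflate_apply)
  have "inner ?v (x - inner ?v x *\<^sub>R ?v) = 0" for x
    using top_vec(1,2)[OF T] by (cases "T = 0") (auto simp: inner_diff_right dot_square_norm)
  then show "inner (T ?v) (deflate T x) = 0" by (simp add: deflate_apply TvTz)
  show "norm (deflate T) \<le> norm T"
  proof (rule norm_blinfun_bound)
    fix x
    have v1: "norm ?v = 0 \<or> norm ?v = 1" using top_vec[OF T] by (cases "T = 0") auto
    have "(norm (x - inner ?v x *\<^sub>R ?v))\<^sup>2 = (norm x)\<^sup>2 - (inner ?v x)\<^sup>2"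
    proof -
      have "(norm (x - inner ?v x *\<^sub>R ?v))\<^sup>2
          = inner x x - 2 * (inner ?v x)\<^sup>2 + (inner ?v x)\<^sup>2 * inner ?v ?v"
        unfolding power2_norm_eq_inner inner_diff_left inner_diff_right
        by (simp add: inner_commute power2_eq_square)
      then show ?thesis using v1 by (auto simp: dot_square_norm)
    qed
    also have "\<dots> \<le> (norm x)\<^sup>2" by simp
    finally have "norm (x - inner ?v x *\<^sub>R ?v) \<le> norm x" by (rule power2_le_imp_le) simp
    then show "norm (deflate T x) \<le> norm T * norm x"
      unfolding deflate_apply by (meson norm_blinfun mult_left_mono norm_ge_zero order_trans)
  qed simp
  have "(norm (T ?v))\<^sup>2 = (norm T)\<^sup>2" unfolding power2_norm_eq_inner[of "T ?v"] TvTz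
    using top_vec[OF T] by (cases "T = 0") (auto simp: dot_square_norm)
  then show "norm (T ?v) = norm T" by (simp add: power2_eq_iff_nonneg)
qed

text \<open>
  Repeated deflation splits off one singular triple at a time. The norms of the remainders tend to
  \<open>0\<close>: otherwise the vectors \<open>T (v k)\<close> would form an orthogonal sequence
  bounded away from \<open>0\<close> inside a relatively compact set.
\<close>

theorem compact_svd_exists:
  assumes T: "compact_operator T"
  shows "\<exists>s u v. svd T s u v \<and> decseq s"
proof -
  define D where "D k = (deflate ^^ k) T" for k
  define v where "v k = top_vec (D k)" for k
  define s where "s k = norm (D k)" for k
  define u where "u k = (1 / s k) *\<^sub>R blinfun_apply (D k) (v k)" for k
  have D_Suc: "D (Suc k) = deflate (D k)" and D_0: "D 0 = T" for k by (simp_all add: D_def)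
  have comp: "compact_operator (D k)" for k
    by (induction k) (auto simp: D_0 D_Suc T compact_deflate)
  have Dv: "D k (v j) = 0" if "j < k" for j k
    using that
  proof (induction k)
    case (Suc k)
    show ?case
    proof (cases "j = k")
      case True
      then show ?thesis by (simp add: D_Suc v_def deflate_kernel(1)[OF comp])
    next
      case False
      then show ?thesis using Suc by (simp add: D_Suc deflate_kernel(3)[OF comp])
    qed
  qed simp
  have range: "\<exists>y. D k x = D j y" if "j \<le> k" for j k x
    using that by (induction k arbitrary: x rule: dec_induct) (auto simp: D_Suc deflate_apply[of "D _"])
  have orthD: "inner (D j (v j)) (D k x) = 0" if jk: "j < k" for j k x
  proof -
    obtain y where "D k x = D (Suc j) y" using range[of "Suc j" k x] jk by auto
    then show ?thesis by (simp add: D_Suc v_def deflate_kernel(4)[OF comp])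
  qed
  have dec: "decseq s" unfolding decseq_Suc_iff s_def D_Suc by (simp add: deflate_kernel(5)[OF comp])
  have Dvs: "D k (v k) = s k *\<^sub>R u k" for k
    by (cases "s k = 0") (auto simp: u_def s_def blinfun.zero_left)
  have norm_u: "norm (u k) = 1" if "s k \<noteq> 0" for k
    using that deflate_kernel(6)[OF comp[of k]] by (simp add: u_def v_def s_def)
  have u0: "u k = 0" if "s k = 0" for k using that by (simp add: u_def)
  have v0: "v k = 0" if "s k = 0" for k using that top_vec(1)[OF comp] by (simp add: v_def s_def)
  have norm_v: "norm (v k) = 1" if "s k \<noteq> 0" for k
    using that top_vec(2)[OF comp[of k]] by (auto simp: v_def s_def)
  have uo: "inner (u i) (u j) = 0" if "i < j" for i j using orthD[OF that] by (simp add: u_def)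
  have vo: "inner (v i) (v j) = 0" if "i < j" for i j
    using deflate_kernel(2)[OF comp Dv[OF that]] by (simp add: v_def inner_commute)
  have ons: "ons u" "ons v"
    unfolding ons_def using uo vo norm_u norm_v u0 v0 by (metis inner_commute linorder_neqE_nat norm_zero)+
  have step: "T - D N = (\<Sum>k<N. s k *\<^sub>R rank1 (u k) (v k))" for N
  proof (induction N)
    case (Suc N)
    have "D N - D (Suc N) = rank1 (D N (v N)) (v N)" by (simp add: D_Suc deflate_def v_def)
    also have "\<dots> = s N *\<^sub>R rank1 (u N) (v N)"
      by (rule blinfun_eqI) (simp add: Dvs blinfun.scaleR_left mult.commute)
    finally show ?case using Suc by (simp add: algebra_simps)
  qed (simp add: D_0)
  have Tv: "T (v k) = s k *\<^sub>R u k" for k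
  proof -
    have "(T - D k) (v k) = 0"
      unfolding step blinfun.sum_left by (rule sum.neutral) (auto simp: blinfun.scaleR_left vo)
    then show ?thesis using Dvs by (simp add: blinfun.diff_left)
  qed
  have lim: "s \<longlonglongrightarrow> 0"
  proof (rule ccontr)
    assume "\<not> s \<longlonglongrightarrow> 0"
    then obtain e where e: "0 < e" "\<forall>N. \<exists>k\<ge>N. e \<le> \<bar>s k\<bar>"
      unfolding LIMSEQ_iff by (auto simp: not_less)
    have big: "e \<le> s k" for k
    proof -
      obtain l where "l \<ge> k" "e \<le> \<bar>s l\<bar>" using e by blast
      then show ?thesis using decseqD[OF dec, of k l] by (simp add: s_def)
    qed
    have "compact (closure (blinfun_apply T ` cball 0 1))" using T by (auto simp: compact_operator_def)
    moreover have "T (v k) \<in> closure (blinfun_apply T ` cball 0 1)" for k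
      by (rule subsetD[OF closure_subset imageI]) (use ons_norm_le[OF ons(2)] in simp)
    ultimately obtain y r where r: "strict_mono r" and y: "((\<lambda>m. T (v m)) \<circ> r) \<longlonglongrightarrow> y"
      unfolding compact_def by (metis (no_types, lifting))
    then have "Cauchy ((\<lambda>m. T (v m)) \<circ> r)" by (intro LIMSEQ_imp_Cauchy)
    then obtain M where M: "dist (((\<lambda>m. T (v m)) \<circ> r) M) (((\<lambda>m. T (v m)) \<circ> r) (Suc M)) < e"
      using metric_CauchyD[OF _ e(1)] by (meson le_Suc_eq order_refl)
    define i j where "i = r M" and "j = r (Suc M)"
    have ij: "i < j" using r by (simp add: i_def j_def strict_mono_def)
    have si: "s i \<noteq> 0" using big[of i] e(1) by auto
    have "(norm (s i *\<^sub>R u i - s j *\<^sub>R u j))\<^sup>2 = (s i)\<^sup>2 * inner (u i) (u i) + (norm (s j *\<^sub>R u j))\<^sup>2"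
      using uo[OF ij] unfolding power2_norm_eq_inner
      by (simp add: inner_diff_left inner_diff_right inner_commute power2_eq_square)
    then have "(norm (s i *\<^sub>R u i - s j *\<^sub>R u j))\<^sup>2 = (s i)\<^sup>2 + (norm (s j *\<^sub>R u j))\<^sup>2"
      using norm_u[OF si] by (simp add: dot_square_norm)
    then have "e\<^sup>2 \<le> (norm (s i *\<^sub>R u i - s j *\<^sub>R u j))\<^sup>2"
      using power_mono[OF big[of i], of 2] e(1) by (simp add: add_increasing2)
    then have "e \<le> norm (s i *\<^sub>R u i - s j *\<^sub>R u j)" by (rule power2_le_imp_le) simp
    then show False using M by (simp add: Tv dist_norm i_def j_def)
  qed
  have "(\<lambda>N. D N) \<longlonglongrightarrow> 0" using lim unfolding s_def by (simp add: tendsto_norm_zero_iff)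
  then have "(\<lambda>N. T - D N) \<longlonglongrightarrow> T - 0" by (intro tendsto_intros)
  then have "(\<lambda>k. s k *\<^sub>R rank1 (u k) (v k)) sums T" unfolding sums_def step by simp
  then have "svd T s u v" unfolding svd_def using ons norm_u norm_v by (auto simp: s_def)
  then show ?thesis using dec by blast
qed

corollary compact_svd:
  assumes "compact_operator T"
  obtains u v where "svd T (singular_value T) u v"
  using compact_svd_exists[OF assms] svd_singular_value by metis

section \<open>Schatten sums against Bessel systems\<close>

lemma square_powr_half: "0 \<le> a \<Longrightarrow> (a\<^sup>2) powr (p / 2) = a powr (p :: real)"
  by (cases "a = 0") (auto simp: powr_powr simp flip: powr_numeral)

lemma powr_sums_le:
  fixes s :: "nat \<Rightarrow> real"
  assumes "\<And>N. (\<Sum>k<N. s k powr p) \<le> M"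
  shows "summable (\<lambda>k. s k powr p)" "(\<Sum>k. s k powr p) \<le> M"
proof -
  show *: "summable (\<lambda>k. s k powr p)" by (rule summableI_nonneg_bounded[OF _ assms]) simp
  show "(\<Sum>k. s k powr p) \<le> M" by (rule suminf_le_const[OF * assms])
qed

lemma sum_le_sums:
  fixes f :: "nat \<Rightarrow> real"
  assumes "f sums s" "\<And>k. 0 \<le> f k"
  shows "(\<Sum>k<K. f k) \<le> s"
  using sum_le_suminf[OF sums_summable[OF assms(1)], of "{..<K}"] assms by (simp add: sums_iff)

lemma sums_le_const:
  fixes f :: "nat \<Rightarrow> real"
  assumes "f sums s" "\<And>K. (\<Sum>k<K. f k) \<le> M"
  shows "s \<le> M"
  using LIMSEQ_le_const2[OF assms(1)[unfolded sums_def]] assms(2) by blast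

text \<open>
  Here \<open>norm (T (x j))\<close> squared is \<open>\<Sum>k. s k\<^sup>2 * (inner (v k) (x
  j))\<^sup>2\<close>, and the matrix of weights is doubly substochastic. Jensen applies to each
  row, and summing over the columns gives the claim.
\<close>

lemma sum_norm_apply_le:
  assumes svd: "svd T s u v" and sum: "summable (\<lambda>k. s k powr p)" and p: "2 \<le> p" and x: "bessel x"
  shows "(\<Sum>j<N. norm (blinfun_apply T (x j)) powr p) \<le> (\<Sum>k. s k powr p)"
proof -
  have le: "(\<Sum>j<N. (\<Sum>k<K. (s k)\<^sup>2 * (inner (v k) (x j))\<^sup>2) powr (p / 2)) \<le> (\<Sum>k. s k powr p)" for K
  proof -
    have "(\<Sum>j<N. (\<Sum>k<K. (s k)\<^sup>2 * (inner (v k) (x j))\<^sup>2) powr (p / 2))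
        \<le> (\<Sum>j<N. \<Sum>k<K. (inner (v k) (x j))\<^sup>2 * s k powr p)"
    proof (rule sum_mono)
      fix j
      have "(\<Sum>k<K. (inner (v k) (x j))\<^sup>2) \<le> (norm (x j))\<^sup>2"
        by (rule bessel_sum_le[OF ons_bessel[OF svd_ons(2)[OF svd]]])
      also have "\<dots> \<le> 1" using bessel_norm_le[OF x, of j] by (simp add: power_le_one)
      finally have "(\<Sum>k<K. (inner (v k) (x j))\<^sup>2 * (s k)\<^sup>2) powr (p / 2)
          \<le> (\<Sum>k<K. (inner (v k) (x j))\<^sup>2 * ((s k)\<^sup>2) powr (p / 2))"
        by (intro powr_sum_le_sum_powr) (use p in auto)
      then show "(\<Sum>k<K. (s k)\<^sup>2 * (inner (v k) (x j))\<^sup>2) powr (p / 2)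
          \<le> (\<Sum>k<K. (inner (v k) (x j))\<^sup>2 * s k powr p)"
        by (simp add: square_powr_half svd_nonneg[OF svd] mult.commute)
    qed
    also have "\<dots> = (\<Sum>k<K. (\<Sum>j<N. (inner (x j) (v k))\<^sup>2) * s k powr p)"
      by (subst sum.swap) (simp add: sum_distrib_right inner_commute)
    also have "\<dots> \<le> (\<Sum>k<K. 1 * s k powr p)"
    proof (intro sum_mono mult_right_mono)
      fix k
      have "(\<Sum>j<N. (inner (x j) (v k))\<^sup>2) \<le> (norm (v k))\<^sup>2" by (rule bessel_sum_le[OF x])
      also have "\<dots> \<le> 1" using ons_norm_le[OF svd_ons(2)[OF svd], of k] by (simp add: power_le_one)
      finally show "(\<Sum>j<N. (inner (x j) (v k))\<^sup>2) \<le> 1" .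
    qed simp
    also have "\<dots> \<le> (\<Sum>k. s k powr p)" by (simp add: sum_le_suminf[OF sum])
    finally show ?thesis .
  qed
  have "(\<lambda>K. \<Sum>j<N. (\<Sum>k<K. (s k)\<^sup>2 * (inner (v k) (x j))\<^sup>2) powr (p / 2))
      \<longlonglongrightarrow> (\<Sum>j<N. ((norm (T (x j)))\<^sup>2) powr (p / 2))"
    using svd_norm_sums[OF svd, unfolded sums_def] p
    by (intro tendsto_sum tendsto_powr2 tendsto_const always_eventually allI sum_nonneg) auto
  then have "(\<Sum>j<N. ((norm (T (x j)))\<^sup>2) powr (p / 2)) \<le> (\<Sum>k. s k powr p)"
    by (rule LIMSEQ_le_const2) (use le in blast)
  then show ?thesis by (simp add: square_powr_half)
qed

text \<open>
  The remainder of the orthogonal expansion of \<open>z\<close> is orthogonal to the system, hence to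
  \<open>z\<close>, hence it is \<open>0\<close>.
\<close>

lemma Parseval_sums:
  assumes x: "ons x" and complete: "\<And>y. (\<And>j. inner (x j) y = 0) \<Longrightarrow> inner y z = 0"
  shows "(\<lambda>j. (inner (x j) z)\<^sup>2) sums (norm z)\<^sup>2"
proof -
  have sq: "summable (\<lambda>j. (inner (x j) z)\<^sup>2)" by (rule bessel_summable[OF ons_bessel[OF x]])
  have "summable (\<lambda>j. inner (x j) z *\<^sub>R x j)" unfolding summable_Cauchy
  proof (intro allI impI)
    fix e :: real assume e: "0 < e"
    then have "0 < e\<^sup>2" by simp
    then obtain M where M: "\<forall>m\<ge>M. \<forall>n. norm (\<Sum>j\<in>{m..<n}. (inner (x j) z)\<^sup>2) < e\<^sup>2"
      using sq unfolding summable_Cauchy by blast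
    have "norm (\<Sum>j\<in>{m..<n}. inner (x j) z *\<^sub>R x j) < e" if "m \<ge> M" for m n
    proof -
      have "(norm (\<Sum>j\<in>{m..<n}. inner (x j) z *\<^sub>R x j))\<^sup>2 = (\<Sum>j\<in>{m..<n}. (inner (x j) z)\<^sup>2 * (norm (x j))\<^sup>2)"
        by (rule ons_norm_sum[OF x]) simp
      also have "\<dots> \<le> (\<Sum>j\<in>{m..<n}. (inner (x j) z)\<^sup>2 * 1)"
        using ons_norm_le[OF x] by (intro sum_mono mult_left_mono) (auto simp: power_le_one)
      also have "\<dots> = norm (\<Sum>j\<in>{m..<n}. (inner (x j) z)\<^sup>2)" by (simp add: sum_nonneg)
      also have "\<dots> < e\<^sup>2" using M that by blast
      finally show ?thesis using e by (metis less_imp_le power_less_imp_less_base)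
    qed
    then show "\<exists>M. \<forall>m\<ge>M. \<forall>n. norm (\<Sum>j\<in>{m..<n}. inner (x j) z *\<^sub>R x j) < e" by blast
  qed
  then obtain P where P: "(\<lambda>j. inner (x j) z *\<^sub>R x j) sums P" by (auto simp: summable_def)
  have "inner (x i) (z - P) = 0" for i
  proof -
    have "(\<lambda>j. inner (x i) (inner (x j) z *\<^sub>R x j)) sums inner (x i) P"
      by (rule bounded_linear.sums[OF bounded_linear_inner_right P])
    moreover have "(\<lambda>j. inner (x i) (inner (x j) z *\<^sub>R x j)) = (\<lambda>j. if j = i then inner (x i) z else 0)"
      using ons_orthogonal[OF x, of i] ons_inner_norm[OF x, of i z]
      by (auto simp: dot_square_norm mult.commute)
    ultimately have "(\<lambda>j. if j = i then inner (x i) z else 0) sums inner (x i) P" by simp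
    moreover have "(\<lambda>j. if j = i then inner (x i) z else 0) sums inner (x i) z"
      using sums_single[of i "\<lambda>_. inner (x i) z"] by (simp add: eq_commute)
    ultimately show ?thesis by (simp add: inner_diff_right sums_unique2)
  qed
  then have "inner (z - P) z = 0" by (rule complete)
  then have "(norm z)\<^sup>2 = inner P z" by (simp add: inner_diff_left power2_norm_eq_inner)
  moreover have "(\<lambda>j. (inner (x j) z)\<^sup>2) sums inner P z"
    using bounded_linear.sums[OF bounded_linear_inner_left P, of z] by (simp add: power2_eq_square)
  ultimately show ?thesis by simp
qed

text \<open>
  The reverse estimate for \<open>p \<le> 2\<close>, where Jensen is concave. A lower bound needs
  the weights attached to each \<open>v k\<close> with \<open>s k \<noteq> 0\<close> to sum to
  \<open>1\<close>, hence the completeness assumption, which is Parseval's identity for these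
  \<open>v k\<close>.
\<close>

lemma sum_powr_le_sum_norm_apply:
  assumes svd: "svd T s u v" and p: "0 < p" "p \<le> 2" and x: "ons x"
    and complete: "\<And>y. (\<And>j. inner (x j) y = 0) \<Longrightarrow> blinfun_apply T y = 0"
    and sum: "summable (\<lambda>j. norm (blinfun_apply T (x j)) powr p)"
  shows "(\<Sum>k<K. s k powr p) \<le> (\<Sum>j. norm (blinfun_apply T (x j)) powr p)"
proof -
  have parseval: "(\<lambda>j. (inner (x j) (v k))\<^sup>2) sums 1" if "s k \<noteq> 0" for k
  proof -
    have "(\<lambda>j. (inner (x j) (v k))\<^sup>2) sums (norm (v k))\<^sup>2"
    proof (rule Parseval_sums[OF x])
      fix y assume "\<And>j. inner (x j) y = 0"
      then have "T y = 0" by (rule complete)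
      then have "s k * inner (v k) y = 0" using svd_inner_left[OF svd, of k y] by simp
      then show "inner y (v k) = 0" using that by (simp add: inner_commute)
    qed
    then show ?thesis using svd_norm_one(2)[OF svd that] by simp
  qed
  have le: "(\<Sum>k<K. s k powr p * (\<Sum>j<N. (inner (x j) (v k))\<^sup>2))
      \<le> (\<Sum>j. norm (T (x j)) powr p)" for N
  proof -
    have "(\<Sum>k<K. s k powr p * (\<Sum>j<N. (inner (x j) (v k))\<^sup>2))
        = (\<Sum>j<N. \<Sum>k<K. (inner (v k) (x j))\<^sup>2 * s k powr p)"
      by (subst sum.swap) (simp add: sum_distrib_left inner_commute mult.commute)
    also have "\<dots> \<le> (\<Sum>j<N. norm (T (x j)) powr p)"
    proof (rule sum_mono)
      fix j
      have "(\<Sum>k<K. (inner (v k) (x j))\<^sup>2) \<le> (norm (x j))\<^sup>2"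
        by (rule bessel_sum_le[OF ons_bessel[OF svd_ons(2)[OF svd]]])
      also have "\<dots> \<le> 1" using ons_norm_le[OF x, of j] by (simp add: power_le_one)
      finally have "(\<Sum>k<K. (inner (v k) (x j))\<^sup>2 * ((s k)\<^sup>2) powr (p / 2))
          \<le> (\<Sum>k<K. (inner (v k) (x j))\<^sup>2 * (s k)\<^sup>2) powr (p / 2)"
        by (intro sum_powr_le_powr_sum) (use p in auto)
      also have "\<dots> \<le> ((norm (T (x j)))\<^sup>2) powr (p / 2)"
      proof (rule powr_mono2)
        have "(\<Sum>k<K. (s k)\<^sup>2 * (inner (v k) (x j))\<^sup>2) \<le> (norm (T (x j)))\<^sup>2"
          by (rule sum_le_sums[OF svd_norm_sums[OF svd]]) simp
        then show "(\<Sum>k<K. (inner (v k) (x j))\<^sup>2 * (s k)\<^sup>2) \<le> (norm (T (x j)))\<^sup>2"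
          by (simp add: mult.commute)
      qed (use p in \<open>auto intro: sum_nonneg\<close>)
      finally show "(\<Sum>k<K. (inner (v k) (x j))\<^sup>2 * s k powr p) \<le> norm (T (x j)) powr p"
        by (simp add: square_powr_half svd_nonneg[OF svd])
    qed
    also have "\<dots> \<le> (\<Sum>j. norm (T (x j)) powr p)" by (rule sum_le_suminf[OF sum]) auto
    finally show ?thesis .
  qed
  have "(\<lambda>N. \<Sum>k<K. s k powr p * (\<Sum>j<N. (inner (x j) (v k))\<^sup>2)) \<longlonglongrightarrow> (\<Sum>k<K. s k powr p * 1)"
  proof (rule tendsto_sum)
    fix k
    show "(\<lambda>N. s k powr p * (\<Sum>j<N. (inner (x j) (v k))\<^sup>2)) \<longlonglongrightarrow> s k powr p * 1"
    proof (cases "s k = 0")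
      case False
      show ?thesis by (rule tendsto_mult_left[OF parseval[OF False, unfolded sums_def]])
    qed simp
  qed
  then have "(\<Sum>k<K. s k powr p * 1) \<le> (\<Sum>j. norm (T (x j)) powr p)"
    by (rule LIMSEQ_le_const2) (use le in blast)
  then show ?thesis by simp
qed

text \<open>
  The weights \<open>\<bar>inner (v k) (x j)\<bar> * \<bar>inner (u k) (y j)\<bar>\<close> are
  doubly substochastic by the inequality between arithmetic and geometric means. Equality holds
  for the singular vectors of \<open>T\<close>, so the Schatten sum is a supremum of functions
  that are continuous in \<open>T\<close>. This yields both the summability of columns and lower
  semicontinuity.
\<close>

lemma sum_abs_inner_le:
  assumes svd: "svd T s u v" and sum: "summable (\<lambda>k. s k powr p)" and p: "1 \<le> p"
    and x: "bessel x" and y: "bessel y"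
  shows "(\<Sum>j<N. \<bar>inner (blinfun_apply T (x j)) (y j)\<bar> powr p) \<le> (\<Sum>k. s k powr p)"
proof -
  define w where "w j k = \<bar>inner (v k) (x j)\<bar> * \<bar>inner (u k) (y j)\<bar>" for j k
  have w0: "0 \<le> w j k" for j k by (simp add: w_def)
  have amgm: "w j k \<le> ((inner (v k) (x j))\<^sup>2 + (inner (u k) (y j))\<^sup>2) / 2" for j k
    using sum_squares_bound[of "\<bar>inner (v k) (x j)\<bar>" "\<bar>inner (u k) (y j)\<bar>"] by (simp add: w_def)
  have le1: "a\<^sup>2 \<le> 1" if "0 \<le> a" "a \<le> 1" for a :: real using that by (simp add: power_le_one)
  have wk: "(\<Sum>k<K. w j k) \<le> 1" for j K
  proof -
    have "(\<Sum>k<K. w j k) \<le> ((\<Sum>k<K. (inner (v k) (x j))\<^sup>2) + (\<Sum>k<K. (inner (u k) (y j))\<^sup>2)) / 2"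
      unfolding sum.distrib[symmetric] sum_divide_distrib by (rule sum_mono[OF amgm])
    also have "\<dots> \<le> ((norm (x j))\<^sup>2 + (norm (y j))\<^sup>2) / 2"
      using bessel_sum_le[OF ons_bessel[OF svd_ons(2)[OF svd]], of "x j" K]
        bessel_sum_le[OF ons_bessel[OF svd_ons(1)[OF svd]], of "y j" K] by simp
    also have "\<dots> \<le> 1"
      using le1[OF _ bessel_norm_le[OF x, of j]] le1[OF _ bessel_norm_le[OF y, of j]] by simp
    finally show ?thesis .
  qed
  have wj: "(\<Sum>j<N. w j k) \<le> 1" for k
  proof -
    have "(\<Sum>j<N. w j k) \<le> ((\<Sum>j<N. (inner (x j) (v k))\<^sup>2) + (\<Sum>j<N. (inner (y j) (u k))\<^sup>2)) / 2"
      unfolding sum.distrib[symmetric] sum_divide_distrib inner_commute[of "x _"] inner_commute[of "y _"]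
      by (rule sum_mono[OF amgm])
    also have "\<dots> \<le> ((norm (v k))\<^sup>2 + (norm (u k))\<^sup>2) / 2"
      using bessel_sum_le[OF x, of "v k" N] bessel_sum_le[OF y, of "u k" N] by simp
    also have "\<dots> \<le> 1"
      using le1[OF _ ons_norm_le[OF svd_ons(1)[OF svd], of k]] le1[OF _ ons_norm_le[OF svd_ons(2)[OF svd], of k]] by simp
    finally show ?thesis .
  qed
  have le: "(\<Sum>j<N. \<bar>\<Sum>k<K. s k * inner (v k) (x j) * inner (u k) (y j)\<bar> powr p) \<le> (\<Sum>k. s k powr p)" for K
  proof -
    have "(\<Sum>j<N. \<bar>\<Sum>k<K. s k * inner (v k) (x j) * inner (u k) (y j)\<bar> powr p)
        \<le> (\<Sum>j<N. \<Sum>k<K. w j k * s k powr p)"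
    proof (rule sum_mono)
      fix j
      have "\<bar>\<Sum>k<K. s k * inner (v k) (x j) * inner (u k) (y j)\<bar> \<le> (\<Sum>k<K. \<bar>s k * inner (v k) (x j) * inner (u k) (y j)\<bar>)"
        by (rule sum_abs)
      also have "\<dots> = (\<Sum>k<K. w j k * s k)"
        by (intro sum.cong) (auto simp: w_def abs_mult svd_nonneg[OF svd])
      finally have "\<bar>\<Sum>k<K. s k * inner (v k) (x j) * inner (u k) (y j)\<bar> powr p \<le> (\<Sum>k<K. w j k * s k) powr p"
        by (intro powr_mono2) (use p in auto)
      also have "\<dots> \<le> (\<Sum>k<K. w j k * s k powr p)"
        by (rule powr_sum_le_sum_powr) (use wk w0 svd_nonneg[OF svd] p in auto)
      finally show "\<bar>\<Sum>k<K. s k * inner (v k) (x j) * inner (u k) (y j)\<bar> powr p \<le> (\<Sum>k<K. w j k * s k powr p)" .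
    qed
    also have "\<dots> = (\<Sum>k<K. (\<Sum>j<N. w j k) * s k powr p)"
      by (subst sum.swap) (simp add: sum_distrib_right)
    also have "\<dots> \<le> (\<Sum>k<K. 1 * s k powr p)" by (intro sum_mono mult_right_mono wj) simp
    also have "\<dots> \<le> (\<Sum>k. s k powr p)" by (simp add: sum_le_suminf[OF sum])
    finally show ?thesis .
  qed
  have "(\<lambda>K. \<Sum>j<N. \<bar>\<Sum>k<K. s k * inner (v k) (x j) * inner (u k) (y j)\<bar> powr p)
      \<longlonglongrightarrow> (\<Sum>j<N. \<bar>inner (T (x j)) (y j)\<bar> powr p)"
    using svd_inner_sums[OF svd, unfolded sums_def] p
    by (intro tendsto_sum tendsto_powr2 tendsto_rabs tendsto_const always_eventually allI) auto
  then show ?thesis by (rule LIMSEQ_le_const2) (use le in blast)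
qed

lemma svd_kernel:
  assumes "svd T s u v" "\<And>k. s k * inner (v k) x = 0"
  shows "blinfun_apply T x = 0"
proof -
  have "(\<lambda>k. 0) sums blinfun_apply T x" using svd_apply_sums[OF assms(1), of x] by (simp add: assms(2))
  then show ?thesis using sums_zero sums_unique2 by blast
qed

section \<open>Interpolation along a density\<close>

definition schatten_sum :: "real \<Rightarrow> operator \<Rightarrow> real"
  where "schatten_sum p T = (\<Sum>j. singular_value T j powr p)"

abbreviation schatten_summable :: "real \<Rightarrow> operator \<Rightarrow> bool"
  where "schatten_summable p T \<equiv> summable (\<lambda>j. singular_value T j powr p)"

lemma schatten_sum_nonneg: "schatten_summable r T \<Longrightarrow> 0 \<le> schatten_sum r T"
  unfolding schatten_sum_def by (rule suminf_nonneg) auto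

text \<open>
  Think of \<open>\<delta>\<close> as the diagonal of a positive operator \<open>\<rho>\<close> of
  trace at most \<open>1\<close> with eigenvectors \<open>e\<close>. Up to the partial isometry
  taking \<open>e\<close> to \<open>w\<close>, \<open>density_root r\<close> is
  \<open>\<rho>\<close> to the power \<open>1 / r\<close>, and the Schatten \<open>r\<close>-norm
  of \<open>twist R r\<close> is a one-sided, noncommutative version of the norm of
  \<open>R\<close> in \<open>L\<^sub>r(\<rho>)\<close>, with the operator norm of \<open>R\<close>
  for \<open>r = \<infinity>\<close>. The estimates below are the usual inclusion and
  interpolation inequalities between such norms over a probability space.
\<close>

locale density =
  fixes \<delta> :: "nat \<Rightarrow> real" and w e :: "nat \<Rightarrow> ell2"
  assumes \<delta>_nonneg: "0 \<le> \<delta> k" and \<delta>_summable: "summable \<delta>" and \<delta>_le_1: "suminf \<delta> \<le> 1"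
    and w: "ons w" and e: "ons e"
    and norm_one: "\<delta> k \<noteq> 0 \<Longrightarrow> norm (w k) = 1 \<and> norm (e k) = 1"
begin

definition density_root :: "real \<Rightarrow> operator"
  where "density_root r = (SOME T. svd T (\<lambda>k. \<delta> k powr (1 / r)) w e)"

lemma svd_density_root:
  assumes "0 < r"
  shows "svd (density_root r) (\<lambda>k. \<delta> k powr (1 / r)) w e"
proof -
  have "(\<lambda>k. \<delta> k powr (1 / r)) \<longlonglongrightarrow> 0 powr (1 / r)"
    using assms summable_LIMSEQ_zero[OF \<delta>_summable]
    by (intro tendsto_powr2 tendsto_const always_eventually allI \<delta>_nonneg) auto
  then have "\<exists>T. svd T (\<lambda>k. \<delta> k powr (1 / r)) w e"
    by (intro svd_exists w e) (auto simp: norm_one)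
  then show ?thesis unfolding density_root_def by (rule someI_ex)
qed

definition twist :: "operator \<Rightarrow> real \<Rightarrow> operator"
  where "twist R r = R o\<^sub>L density_root r"

lemma compact_twist: "0 < r \<Longrightarrow> compact_operator (twist R r)"
  unfolding twist_def by (intro compact_operator_compose svd_compact[OF svd_density_root])

lemma adj_twist: "blinfun_apply (adj (twist R r)) x = blinfun_apply (adj (density_root r)) (blinfun_apply (adj R) x)"
  by (simp add: twist_def adj_compose)

lemma inner_adj_twist:
  "0 < r \<Longrightarrow> inner (e k) (blinfun_apply (adj (twist R r)) x) = \<delta> k powr (1 / r) * inner (w k) (blinfun_apply (adj R) x)"
  unfolding adj_twist by (rule svd_inner_left[OF svd_adj[OF svd_density_root]])

lemma powr_half_square: "(\<delta> k powr a)\<^sup>2 = \<delta> k powr (2 * a)"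
  by (simp add: power2_eq_square flip: powr_add)

lemma norm_adj_twist_sums:
  assumes "0 < r"
  shows "(\<lambda>k. \<delta> k powr (2 / r) * (inner (w k) (blinfun_apply (adj R) x))\<^sup>2) sums (norm (blinfun_apply (adj (twist R r)) x))\<^sup>2"
  using svd_norm_sums[OF svd_adj[OF svd_density_root[OF assms]], of "blinfun_apply (adj R) x"]
  by (simp add: adj_twist powr_half_square)

lemma adj_twist_kernel:
  assumes r: "0 < r" and s: "0 < s" and "blinfun_apply (adj (twist R r)) x = 0"
  shows "blinfun_apply (adj (twist R s)) x = 0"
  unfolding adj_twist
proof (rule svd_kernel[OF svd_adj[OF svd_density_root[OF s]]])
  fix k
  have "\<delta> k powr (1 / r) * inner (w k) (blinfun_apply (adj R) x) = 0"
    using inner_adj_twist[OF r, of k R x] assms(3) by simp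
  then show "\<delta> k powr (1 / s) * inner (w k) (blinfun_apply (adj R) x) = 0" by auto
qed

text \<open>
  The kernel of the adjoint of \<open>twist R r\<close> does not depend on \<open>r\<close>.
  Therefore the left singular vectors for one exponent are complete for every other exponent.
\<close>

lemma adj_twist_complete:
  assumes r: "0 < r" and s: "0 < s" and svd: "svd (twist R r) g y z"
    and "\<And>j. inner (y j) x = 0"
  shows "blinfun_apply (adj (twist R s)) x = 0"
  by (rule adj_twist_kernel[OF r s]) (rule svd_kernel[OF svd_adj[OF svd]], simp add: assms(4))

text \<open>
  Interpolation between \<open>r\<close> and \<open>\<infinity>\<close> for a single vector. With
  \<open>y = R\<^sup>* x\<close> of norm at most \<open>L\<close> it is Jensen's inequality for
  the weights \<open>(inner (w k) y)\<^sup>2 / L\<^sup>2\<close>.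
\<close>

lemma norm_adj_twist_le:
  assumes rs: "0 < r" "r \<le> s" and L: "norm R \<le> L" and x: "norm x \<le> 1"
  shows "norm (blinfun_apply (adj (twist R s)) x) powr s
    \<le> L powr (s - r) * norm (blinfun_apply (adj (twist R r)) x) powr r"
proof (cases "L = 0")
  case True
  then have "adj R = 0" using L norm_adj[of R] by simp
  then show ?thesis by (simp add: adj_twist blinfun.zero_left)
next
  case False
  then have L0: "0 < L" using order_trans[OF norm_ge_zero L] by simp
  define y where "y = blinfun_apply (adj R) x"
  define A where "A = norm (blinfun_apply (adj (twist R s)) x) / L"
  define B where "B = norm (blinfun_apply (adj (twist R r)) x) / L"
  have A0: "0 \<le> A" and B0: "0 \<le> B" using L0 by (simp_all add: A_def B_def)
  have "norm y \<le> norm (adj R) * norm x" unfolding y_def by (rule norm_blinfun)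
  also have "\<dots> \<le> L * 1" using L x L0 by (intro mult_mono) (auto simp: norm_adj)
  finally have y: "norm y \<le> L" by simp
  define c where "c k = (inner (w k) y)\<^sup>2 / L\<^sup>2" for k
  have c0: "0 \<le> c k" for k by (simp add: c_def)
  have c1: "(\<Sum>k<K. c k) \<le> 1" for K
  proof -
    have "(\<Sum>k<K. (inner (w k) y)\<^sup>2) \<le> (norm y)\<^sup>2" by (rule bessel_sum_le[OF ons_bessel[OF w]])
    also have "\<dots> \<le> L\<^sup>2" using y by (intro power_mono) auto
    finally show ?thesis using L0 by (simp add: c_def flip: sum_divide_distrib)
  qed
  have sums: "(\<lambda>k. c k * \<delta> k powr (2 / q)) sums ((norm (blinfun_apply (adj (twist R q)) x) / L)\<^sup>2)" if "0 < q" for q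
    using sums_divide[OF norm_adj_twist_sums[OF that, of R x], of "L\<^sup>2"]
    by (simp add: c_def y_def power_divide mult.commute)
  have "A\<^sup>2 \<le> (B\<^sup>2) powr (r / s)"
  proof (rule sums_le_const)
    show "(\<lambda>k. c k * \<delta> k powr (2 / s)) sums A\<^sup>2" unfolding A_def by (rule sums) (use rs in simp)
    fix K
    have "(\<Sum>k<K. c k * \<delta> k powr (2 / s)) = (\<Sum>k<K. c k * (\<delta> k powr (2 / r)) powr (r / s))"
      using rs by (simp add: powr_powr)
    also have "\<dots> \<le> (\<Sum>k<K. c k * \<delta> k powr (2 / r)) powr (r / s)"
      by (rule sum_powr_le_powr_sum) (use c0 c1 rs in auto)
    also have "\<dots> \<le> (B\<^sup>2) powr (r / s)"
    proof (rule powr_mono2)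
      show "(\<Sum>k<K. c k * \<delta> k powr (2 / r)) \<le> B\<^sup>2"
        unfolding B_def using sums[OF rs(1)] by (rule sum_le_sums) (auto simp: c0)
    qed (use rs c0 in \<open>auto intro!: sum_nonneg\<close>)
    finally show "(\<Sum>k<K. c k * \<delta> k powr (2 / s)) \<le> (B\<^sup>2) powr (r / s)" .
  qed
  then have "(A\<^sup>2) powr (s / 2) \<le> ((B\<^sup>2) powr (r / s)) powr (s / 2)"
    by (intro powr_mono2) (use rs in auto)
  then have AB: "A powr s \<le> B powr r" using rs A0 B0 by (simp add: powr_powr square_powr_half)
  have "norm (blinfun_apply (adj (twist R s)) x) powr s = (L * A) powr s" using L0 by (simp add: A_def)
  also have "\<dots> = L powr s * A powr s" using L0 A0 by (simp add: powr_mult)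
  also have "\<dots> \<le> L powr s * B powr r" using AB by (simp add: mult_left_mono)
  also have "\<dots> = L powr (s - r) * (L * B) powr r" using L0 B0 by (simp add: powr_mult powr_diff)
  finally show ?thesis using L0 by (simp add: B_def)
qed

lemma norm_adj_left: "svd T s u v \<Longrightarrow> norm (blinfun_apply (adj T) (u k)) = s k"
  by (rule svd_norm_apply[OF svd_adj])

text \<open>
  For \<open>s \<le> 2\<close> a complete orthonormal system bounds a Schatten sum from above, so the
  vector estimate is summed over the left singular vectors for the exponent \<open>r\<close>,
  where its right-hand side is exact.
\<close>

lemma twist_upper_low:
  assumes rs: "0 < r" "r \<le> s" "s \<le> 2" and L: "norm R \<le> L" and sum: "schatten_summable r (twist R r)"
  shows "schatten_summable s (twist R s) \<and> schatten_sum s (twist R s) \<le> L powr (s - r) * schatten_sum r (twist R r)"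
proof -
  obtain y z where g: "svd (twist R r) (singular_value (twist R r)) y z"
    using compact_svd[OF compact_twist[OF rs(1)]] by blast
  have s: "0 < s" using rs by simp
  obtain y' z' where h: "svd (twist R s) (singular_value (twist R s)) y' z'"
    using compact_svd[OF compact_twist[OF s]] by blast
  let ?f = "\<lambda>j. norm (blinfun_apply (adj (twist R s)) (y j)) powr s"
  have le: "?f j \<le> L powr (s - r) * singular_value (twist R r) j powr r" for j
    using norm_adj_twist_le[OF rs(1,2) L ons_norm_le[OF svd_ons(1)[OF g], of j]] by (simp add: norm_adj_left[OF g])
  have sum2: "summable (\<lambda>j. L powr (s - r) * singular_value (twist R r) j powr r)" by (rule summable_mult[OF sum])
  have f: "summable ?f" by (rule summable_comparison_test'[OF sum2]) (use le in simp)
  have "(\<Sum>k<K. singular_value (twist R s) k powr s) \<le> L powr (s - r) * schatten_sum r (twist R r)" for K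
  proof -
    have "(\<Sum>k<K. singular_value (twist R s) k powr s) \<le> suminf ?f"
      by (rule sum_powr_le_sum_norm_apply[OF svd_adj[OF h] s rs(3) svd_ons(1)[OF g] _ f])
         (rule adj_twist_complete[OF rs(1) s g])
    also have "\<dots> \<le> (\<Sum>j. L powr (s - r) * singular_value (twist R r) j powr r)"
      by (rule suminf_le[OF le f sum2])
    also have "\<dots> = L powr (s - r) * schatten_sum r (twist R r)"
      unfolding schatten_sum_def by (rule suminf_mult[OF sum])
    finally show ?thesis .
  qed
  then show ?thesis unfolding schatten_sum_def[of s] by (intro conjI powr_sums_le)
qed

text \<open>
  For \<open>r \<ge> 2\<close> an orthonormal system bounds a Schatten sum from below, so the
  vector estimate is summed over the left singular vectors for the exponent \<open>s\<close>,
  where its left-hand side is exact.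
\<close>

lemma twist_upper_high:
  assumes rs: "2 \<le> r" "r \<le> s" and L: "norm R \<le> L" and sum: "schatten_summable r (twist R r)"
  shows "schatten_summable s (twist R s) \<and> schatten_sum s (twist R s) \<le> L powr (s - r) * schatten_sum r (twist R r)"
proof -
  have r: "0 < r" and s: "0 < s" using rs by auto
  obtain y z where g: "svd (twist R r) (singular_value (twist R r)) y z"
    using compact_svd[OF compact_twist[OF r]] by blast
  obtain y' z' where h: "svd (twist R s) (singular_value (twist R s)) y' z'"
    using compact_svd[OF compact_twist[OF s]] by blast
  have "(\<Sum>k<K. singular_value (twist R s) k powr s) \<le> L powr (s - r) * schatten_sum r (twist R r)" for K
  proof -
    have "(\<Sum>k<K. singular_value (twist R s) k powr s)
        \<le> (\<Sum>k<K. L powr (s - r) * norm (blinfun_apply (adj (twist R r)) (y' k)) powr r)"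
      using norm_adj_twist_le[OF r rs(2) L ons_norm_le[OF svd_ons(1)[OF h]]]
      by (intro sum_mono) (simp add: norm_adj_left[OF h])
    also have "\<dots> = L powr (s - r) * (\<Sum>k<K. norm (blinfun_apply (adj (twist R r)) (y' k)) powr r)"
      by (simp add: sum_distrib_left)
    also have "\<dots> \<le> L powr (s - r) * schatten_sum r (twist R r)"
      unfolding schatten_sum_def
      by (intro mult_left_mono sum_norm_apply_le[OF svd_adj[OF g] sum rs(1) ons_bessel[OF svd_ons(1)[OF h]]]) simp
    finally show ?thesis .
  qed
  then show ?thesis unfolding schatten_sum_def[of s] by (intro conjI powr_sums_le)
qed

lemma twist_upper:
  assumes rs: "0 < r" "r \<le> s" and L: "norm R \<le> L" and sum: "schatten_summable r (twist R r)"
  shows "schatten_summable s (twist R s) \<and> schatten_sum s (twist R s) \<le> L powr (s - r) * schatten_sum r (twist R r)"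
proof -
  consider "s \<le> 2" | "2 \<le> r" | "r \<le> 2" "2 \<le> s" by linarith
  then show ?thesis
  proof cases
    case 1
    then show ?thesis using twist_upper_low assms by blast
  next
    case 2
    then show ?thesis using twist_upper_high assms by blast
  next
    case 3
    note a = twist_upper_low[OF rs(1) 3(1) order_refl L sum]
    note b = twist_upper_high[OF order_refl 3(2) L conjunct1[OF a]]
    have "L powr (s - 2) * schatten_sum 2 (twist R 2) \<le> L powr (s - 2) * (L powr (2 - r) * schatten_sum r (twist R r))"
      by (intro mult_left_mono conjunct2[OF a]) simp
    also have "\<dots> = L powr (s - r) * schatten_sum r (twist R r)"
      by (simp flip: powr_add mult.assoc)
    finally show ?thesis using b by linarith
  qed
qed

lemma sum_norm_root_le:
  assumes t: "2 \<le> t" and z: "bessel z"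
  shows "(\<Sum>j<N. norm (blinfun_apply (density_root t) (z j)) powr t) \<le> 1"
proof -
  have t0: "0 < t" using t by simp
  have pw: "(\<delta> k powr (1 / t)) powr t = \<delta> k" for k using t0 \<delta>_nonneg by (simp add: powr_powr)
  have "(\<Sum>j<N. norm (blinfun_apply (density_root t) (z j)) powr t) \<le> (\<Sum>k. (\<delta> k powr (1 / t)) powr t)"
    by (rule sum_norm_apply_le[OF svd_density_root[OF t0] _ t z]) (simp add: pw \<delta>_summable)
  then show ?thesis using \<delta>_le_1 by (simp add: pw)
qed

text \<open>
  Hoelder's inequality with \<open>1 / r = 1 / s + 1 / t\<close>. On a left singular vector for
  the exponent \<open>s\<close>, the adjoint for the exponent \<open>r\<close> factors through
  \<open>density_root t\<close> at the corresponding right singular vector; \<open>t \<ge>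
  2\<close> makes the \<open>t\<close>-th powers of the second factors sum to at most
  \<open>1\<close>.
\<close>

lemma twist_lower_low:
  assumes rs: "1 \<le> r" "r < s" "s \<le> 2" and sum: "schatten_summable s (twist R s)"
  shows "schatten_sum r (twist R r) \<le> schatten_sum s (twist R s) powr (r / s)"
proof -
  have r: "0 < r" and s: "0 < s" using rs by auto
  obtain y z where g: "svd (twist R r) (singular_value (twist R r)) y z"
    using compact_svd[OF compact_twist[OF r]] by blast
  obtain y' z' where h: "svd (twist R s) (singular_value (twist R s)) y' z'"
    using compact_svd[OF compact_twist[OF s]] by blast
  define t where "t = r * s / (s - r)"
  have t: "1 / t = 1 / r - 1 / s" using rs by (simp add: t_def field_simps)
  have t0: "0 < t" using rs by (simp add: t_def)
  have "1 / r \<le> 1" "1 / 2 \<le> 1 / s" using rs by (simp_all add: field_simps)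
  then have "1 / t \<le> 1 / 2" unfolding t by linarith
  then have t2: "2 \<le> t" using t0 by (simp add: field_simps)
  let ?f = "\<lambda>j. norm (blinfun_apply (adj (twist R r)) (y' j)) powr r"
  have norm: "norm (blinfun_apply (adj (twist R r)) (y' j)) = singular_value (twist R s) j * norm (blinfun_apply (density_root t) (z' j))" for j
  proof -
    have "(\<lambda>k. (singular_value (twist R s) j)\<^sup>2 * ((\<delta> k powr (1 / t))\<^sup>2 * (inner (e k) (z' j))\<^sup>2))
        sums ((singular_value (twist R s) j)\<^sup>2 * (norm (blinfun_apply (density_root t) (z' j)))\<^sup>2)"
      by (rule sums_mult[OF svd_norm_sums[OF svd_density_root[OF t0]]])
    moreover have "(singular_value (twist R s) j)\<^sup>2 * ((\<delta> k powr (1 / t))\<^sup>2 * (inner (e k) (z' j))\<^sup>2)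
        = \<delta> k powr (2 / r) * (inner (w k) (blinfun_apply (adj R) (y' j)))\<^sup>2" for k
    proof -
      have "singular_value (twist R s) j * inner (e k) (z' j) = \<delta> k powr (1 / s) * inner (w k) (blinfun_apply (adj R) (y' j))"
        using inner_adj_twist[OF s, of k R "y' j"] svd_apply_right[OF svd_adj[OF h], of j] by simp
      then have "\<delta> k powr (1 / t) * (singular_value (twist R s) j * inner (e k) (z' j))
          = (\<delta> k powr (1 / t) * \<delta> k powr (1 / s)) * inner (w k) (blinfun_apply (adj R) (y' j))" by simp
      also have "\<dots> = \<delta> k powr (1 / r) * inner (w k) (blinfun_apply (adj R) (y' j))"
        by (simp add: t flip: powr_add)
      finally have "(\<delta> k powr (1 / t) * (singular_value (twist R s) j * inner (e k) (z' j)))\<^sup>2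
          = (\<delta> k powr (1 / r) * inner (w k) (blinfun_apply (adj R) (y' j)))\<^sup>2" by simp
      then show ?thesis by (simp only: power_mult_distrib powr_half_square) (simp add: mult_ac)
    qed
    ultimately have "(norm (blinfun_apply (adj (twist R r)) (y' j)))\<^sup>2
        = (singular_value (twist R s) j)\<^sup>2 * (norm (blinfun_apply (density_root t) (z' j)))\<^sup>2"
      using norm_adj_twist_sums[OF r, of R "y' j"] by (simp add: sums_unique2)
    then have "(norm (blinfun_apply (adj (twist R r)) (y' j)))\<^sup>2
        = (singular_value (twist R s) j * norm (blinfun_apply (density_root t) (z' j)))\<^sup>2"
      by (simp only: power_mult_distrib)
    then show ?thesis by (rule power2_eq_imp_eq) (auto simp: svd_nonneg[OF h])
  qed
  have bound: "(\<Sum>j<N. ?f j) \<le> schatten_sum s (twist R s) powr (r / s)" for N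
  proof -
    have "(\<Sum>j<N. ?f j) \<le> (\<Sum>j<N. singular_value (twist R s) j powr s) powr (r / s)"
      unfolding norm
      by (rule Hoelder_sum_powr[OF _ _ _ r rs(2) t sum_norm_root_le[OF t2 ons_bessel[OF svd_ons(2)[OF h]]]])
         (auto simp: svd_nonneg[OF h])
    also have "\<dots> \<le> schatten_sum s (twist R s) powr (r / s)"
      unfolding schatten_sum_def using rs sum
      by (intro powr_mono2 sum_le_suminf) (auto intro: sum_nonneg)
    finally show ?thesis .
  qed
  note f = powr_sums_le[OF bound]
  have "(\<Sum>k<K. singular_value (twist R r) k powr r) \<le> schatten_sum s (twist R s) powr (r / s)" for K
  proof -
    have "(\<Sum>k<K. singular_value (twist R r) k powr r) \<le> suminf ?f"
      by (rule sum_powr_le_sum_norm_apply[OF svd_adj[OF g] r _ svd_ons(1)[OF h] _ f(1)])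
         (use rs in simp, rule adj_twist_complete[OF s r h])
    with f(2) show ?thesis by linarith
  qed
  then show ?thesis unfolding schatten_sum_def[of r] by (rule powr_sums_le)
qed

text \<open>
  Again Hoelder's inequality with \<open>1 / r = 1 / s + 1 / t\<close>, now on the singular
  vectors for the exponent \<open>r\<close>: the density in \<open>inner (twist R r z) y\<close>
  is split between the two arguments by the Cauchy-Schwarz inequality.
\<close>

lemma twist_lower_high:
  assumes rs: "2 \<le> r" "r < s" and sum: "schatten_summable s (twist R s)"
  shows "schatten_sum r (twist R r) \<le> schatten_sum s (twist R s) powr (r / s)"
proof -
  have r: "0 < r" and s: "0 < s" using rs by auto
  obtain y z where g: "svd (twist R r) (singular_value (twist R r)) y z"
    using compact_svd[OF compact_twist[OF r]] by blast
  obtain y' z' where h: "svd (twist R s) (singular_value (twist R s)) y' z'"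
    using compact_svd[OF compact_twist[OF s]] by blast
  define t where "t = r * s / (s - r)"
  have t: "1 / t = 1 / r - 1 / s" using rs by (simp add: t_def field_simps)
  have t0: "0 < t" using rs by (simp add: t_def)
  have "1 / r \<le> 1 / 2" "0 < 1 / s" using rs by (simp_all add: field_simps)
  then have "1 / t \<le> 1 / 2" unfolding t by linarith
  then have t2: "2 \<le> t" using t0 by (simp add: field_simps)
  let ?\<alpha> = "\<lambda>j. norm (blinfun_apply (adj (twist R s)) (y j))"
  let ?\<beta> = "\<lambda>j. norm (blinfun_apply (density_root t) (z j))"
  have le: "singular_value (twist R r) j \<le> ?\<alpha> j * ?\<beta> j" for j
  proof (cases "singular_value (twist R r) j = 0")
    case False
    have "inner (twist R r (z j)) (y j) = singular_value (twist R r) j"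
      using svd_norm_one[OF g False] by (simp add: svd_apply_right[OF g] dot_square_norm)
    then have eq: "singular_value (twist R r) j = inner (density_root r (z j)) (adj R (y j))"
      by (simp add: twist_def inner_adj inner_commute[of _ "adj R _"]) (simp add: inner_commute)
    have "inner (density_root r (z j)) (adj R (y j)) \<le> ?\<beta> j * ?\<alpha> j"
    proof (rule sums_le_const)
      show "(\<lambda>k. \<delta> k powr (1 / r) * inner (e k) (z j) * inner (w k) (adj R (y j))) sums inner (density_root r (z j)) (adj R (y j))"
        by (rule svd_inner_sums[OF svd_density_root[OF r]])
      fix K
      let ?a = "\<lambda>k. \<delta> k powr (1 / t) * inner (e k) (z j)"
      let ?b = "\<lambda>k. \<delta> k powr (1 / s) * inner (w k) (adj R (y j))"
      have split: "\<delta> k powr (1 / r) = \<delta> k powr (1 / t) * \<delta> k powr (1 / s)" for k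
        by (simp add: t flip: powr_add)
      have "(\<Sum>k<K. \<delta> k powr (1 / r) * inner (e k) (z j) * inner (w k) (adj R (y j))) = (\<Sum>k<K. ?a k * ?b k)"
        unfolding split by (intro sum.cong) (auto simp: mult_ac)
      also have "\<dots> \<le> (\<Sum>k<K. \<bar>?a k\<bar> * \<bar>?b k\<bar>)"
        by (intro sum_mono) (metis abs_mult abs_ge_self)
      also have "\<dots> \<le> L2_set ?a {..<K} * L2_set ?b {..<K}" by (rule L2_set_mult_ineq)
      also have "\<dots> \<le> ?\<beta> j * ?\<alpha> j"
      proof (rule mult_mono)
        have "(\<Sum>k<K. (?a k)\<^sup>2) \<le> (?\<beta> j)\<^sup>2"
          unfolding power_mult_distrib
          by (rule sum_le_sums[OF svd_norm_sums[OF svd_density_root[OF t0]]]) simp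
        then show "L2_set ?a {..<K} \<le> ?\<beta> j" unfolding L2_set_def by (rule real_le_lsqrt[rotated]) simp
        have "(\<Sum>k<K. (?b k)\<^sup>2) \<le> (?\<alpha> j)\<^sup>2"
          using sum_le_sums[OF norm_adj_twist_sums[OF s, of R "y j"], of K]
          by (simp add: power_mult_distrib powr_half_square)
        then show "L2_set ?b {..<K} \<le> ?\<alpha> j" unfolding L2_set_def by (rule real_le_lsqrt[rotated]) simp
      qed auto
      finally show "(\<Sum>k<K. \<delta> k powr (1 / r) * inner (e k) (z j) * inner (w k) (adj R (y j))) \<le> ?\<beta> j * ?\<alpha> j" .
    qed
    then show ?thesis by (simp add: eq mult.commute)
  qed simp
  have "(\<Sum>k<K. singular_value (twist R r) k powr r) \<le> schatten_sum s (twist R s) powr (r / s)" for K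
  proof -
    have "(\<Sum>k<K. singular_value (twist R r) k powr r) \<le> (\<Sum>k<K. (?\<alpha> k * ?\<beta> k) powr r)"
      using le svd_nonneg[OF g] r by (intro sum_mono powr_mono2) auto
    also have "\<dots> \<le> (\<Sum>k<K. ?\<alpha> k powr s) powr (r / s)"
      by (rule Hoelder_sum_powr[OF _ _ _ r rs(2) t sum_norm_root_le[OF t2 ons_bessel[OF svd_ons(2)[OF g]]]]) auto
    also have "\<dots> \<le> schatten_sum s (twist R s) powr (r / s)"
      unfolding schatten_sum_def using rs
      by (intro powr_mono2 sum_norm_apply_le[OF svd_adj[OF h] sum _ ons_bessel[OF svd_ons(1)[OF g]]])
         (auto intro: sum_nonneg)
    finally show ?thesis .
  qed
  then show ?thesis unfolding schatten_sum_def[of r] by (rule powr_sums_le)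
qed

lemma twist_lower:
  assumes rs: "1 \<le> r" "r < s" and sum: "schatten_summable r (twist R r)"
  shows "schatten_sum r (twist R r) \<le> schatten_sum s (twist R s) powr (r / s)"
proof -
  have r: "0 < r" using rs by simp
  have sum': "schatten_summable q (twist R q)" if "r \<le> q" for q
    using twist_upper[OF r that order_refl sum] by blast
  consider "s \<le> 2" | "2 \<le> r" | "r < 2" "2 < s" by linarith
  then show ?thesis
  proof cases
    case 1
    then show ?thesis using twist_lower_low rs sum'[of s] by simp
  next
    case 2
    then show ?thesis using twist_lower_high rs sum'[of s] by simp
  next
    case 3
    have a: "schatten_sum r (twist R r) \<le> schatten_sum 2 (twist R 2) powr (r / 2)"
      by (rule twist_lower_low) (use rs 3 sum' in auto)
    have b: "schatten_sum 2 (twist R 2) \<le> schatten_sum s (twist R s) powr (2 / s)"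
      by (rule twist_lower_high) (use rs 3 sum' in auto)
    note a
    also have "schatten_sum 2 (twist R 2) powr (r / 2) \<le> (schatten_sum s (twist R s) powr (2 / s)) powr (r / 2)"
      by (rule powr_mono2[OF _ schatten_sum_nonneg b]) (use rs 3 sum' in auto)
    also have "\<dots> = schatten_sum s (twist R s) powr (r / s)" by (simp add: powr_powr)
    finally show ?thesis .
  qed
qed

text \<open>
  The left-hand side is a partial sum of the squared Hilbert-Schmidt norm of \<open>twist R
  2\<close>, evaluated on the system \<open>e\<close>.
\<close>

lemma sum_density_norm_le:
  assumes p: "0 < p" "p \<le> 2" and L: "norm R \<le> L" and sum: "schatten_summable p (twist R p)"
  shows "(\<Sum>k<K. \<delta> k * (norm (blinfun_apply R (w k)))\<^sup>2) \<le> L powr (2 - p) * schatten_sum p (twist R p)"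
proof -
  obtain y z where g: "svd (twist R 2) (singular_value (twist R 2)) y z"
    using compact_svd[OF compact_twist[of 2]] by auto
  note up = twist_upper[OF p L sum]
  have "(\<Sum>k<K. \<delta> k * (norm (R (w k)))\<^sup>2) = (\<Sum>k<K. norm (twist R 2 (e k)) powr 2)"
  proof (rule sum.cong)
    fix k
    have "norm (twist R 2 (e k)) = \<delta> k powr (1 / 2) * norm (R (w k))"
      by (simp add: twist_def svd_apply_right[OF svd_density_root[of 2]] blinfun.scaleR_right)
    then show "\<delta> k * (norm (R (w k)))\<^sup>2 = norm (twist R 2 (e k)) powr 2"
      using \<delta>_nonneg[of k] by (simp add: power_mult_distrib powr_half_square)
  qed simp
  also have "\<dots> \<le> schatten_sum 2 (twist R 2)"
    unfolding schatten_sum_def by (rule sum_norm_apply_le[OF g _ order_refl ons_bessel[OF e]]) (use up in simp)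
  finally show ?thesis using up by linarith
qed

end

section \<open>Columns of operators\<close>

text \<open>
  The coordinates of \<open>x\<close> are placed on the residue class of \<open>i\<close> modulo
  \<open>n\<close>. The \<open>n\<close> maps are isometries with mutually orthogonal ranges, so
  they realise the sum of \<open>n\<close> copies of the space inside the space itself.
\<close>

definition slot_fun :: "nat \<Rightarrow> nat \<Rightarrow> ell2 \<Rightarrow> ell2"
  where "slot_fun n i x = Abs_ell2 (\<lambda>k. if k mod n = i then coord x (k div n) else 0)"

definition slot :: "nat \<Rightarrow> nat \<Rightarrow> operator"
  where "slot n i = Blinfun (slot_fun n i)"

lemma slot_index:
  fixes i n k m :: nat
  assumes "i < n"
  shows "strict_mono (\<lambda>m. m * n + i)" "k \<notin> range (\<lambda>m. m * n + i) \<Longrightarrow> k mod n \<noteq> i"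
    "(m * n + i) mod n = i" "(m * n + i) div n = m"
proof -
  show "strict_mono (\<lambda>m. m * n + i)" using assms
    by (intro strict_monoI add_strict_right_mono mult_strict_right_mono) auto
  show "k mod n \<noteq> i" if "k \<notin> range (\<lambda>m. m * n + i)"
  proof
    assume "k mod n = i"
    then have "k = k div n * n + i" using div_mult_mod_eq[of k n] by simp
    then show False using that by blast
  qed
qed (use assms in auto)

lemma coord_slot_fun:
  assumes "i < n"
  shows "coord (slot_fun n i x) k = (if k mod n = i then coord x (k div n) else 0)"
proof -
  have "summable (\<lambda>k. (if k mod n = i then coord x (k div n) else 0)\<^sup>2)"
    using summable_mono_reindex[OF slot_index(1)[OF assms], of "\<lambda>k. (if k mod n = i then coord x (k div n) else 0)\<^sup>2"]
      slot_index[OF assms] summable_coord_square[of x] by simp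
  then show ?thesis by (simp add: slot_fun_def Abs_ell2_inverse)
qed

lemma inner_slot_fun:
  assumes i: "i < n" and j: "j < n"
  shows "inner (slot_fun n i x) (slot_fun n j y) = (if i = j then inner x y else 0)"
proof (cases "i = j")
  case True
  let ?f = "\<lambda>k. coord (slot_fun n i x) k * coord (slot_fun n i y) k"
  have "inner x y = (\<Sum>m. ?f (m * n + i))"
    using slot_index(3,4)[OF i] by (simp add: inner_ell2_def coord_slot_fun[OF i])
  also have "\<dots> = (\<Sum>k. ?f k)"
    by (rule suminf_mono_reindex[OF slot_index(1)[OF i]])
       (use slot_index(2)[OF i] in \<open>simp add: coord_slot_fun[OF i]\<close>)
  finally show ?thesis using True by (simp add: inner_ell2_def)
next
  case False
  then have "(\<lambda>k. coord (slot_fun n i x) k * coord (slot_fun n j y) k) = (\<lambda>_. 0)"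
    by (auto simp: coord_slot_fun[OF i] coord_slot_fun[OF j])
  then show ?thesis using False by (simp add: inner_ell2_def)
qed

lemma slot_apply:
  assumes i: "i < n"
  shows "blinfun_apply (slot n i) x = slot_fun n i x"
proof -
  have "bounded_linear (slot_fun n i)"
  proof (rule bounded_linear_intro[of _ 1])
    fix x y :: ell2 and r :: real
    show "slot_fun n i (x + y) = slot_fun n i x + slot_fun n i y"
      by (auto simp: coord_inject[symmetric] fun_eq_iff plus_ell2.rep_eq coord_slot_fun[OF i])
    show "slot_fun n i (r *\<^sub>R x) = r *\<^sub>R slot_fun n i x"
      by (auto simp: coord_inject[symmetric] fun_eq_iff scaleR_ell2.rep_eq coord_slot_fun[OF i])
    show "norm (slot_fun n i x) \<le> norm x * 1" by (simp add: norm_eq_sqrt_inner inner_slot_fun[OF i i])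
  qed
  then show ?thesis unfolding slot_def by (simp add: bounded_linear_Blinfun_apply)
qed

lemma inner_slot:
  "i < n \<Longrightarrow> j < n \<Longrightarrow> inner (blinfun_apply (slot n i) x) (blinfun_apply (slot n j) y) = (if i = j then inner x y else 0)"
  by (simp add: slot_apply inner_slot_fun)

text \<open>
  The modulus of the column is the square root of \<open>\<Sum>i<n.
  (T i)\<^sup>* (T i)\<close>.
\<close>

definition column_op :: "nat \<Rightarrow> (nat \<Rightarrow> operator) \<Rightarrow> operator"
  where "column_op n T = (\<Sum>i<n. slot n i o\<^sub>L T i)"

text \<open>
  The scalar row \<open>a\<close>, by which a column is multiplied to form the linear combination
  \<open>\<Sum>i<n. a i *\<^sub>R T i\<close>.
\<close>

definition row_op :: "nat \<Rightarrow> (nat \<Rightarrow> real) \<Rightarrow> operator"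
  where "row_op n a = (\<Sum>i<n. a i *\<^sub>R adj (slot n i))"

lemma col_apply: "blinfun_apply (column_op n T) x = (\<Sum>i<n. slot n i (T i x))"
  by (simp add: column_op_def blinfun.sum_left)

lemma inner_slot_sum:
  assumes "i < n"
  shows "inner (slot n i x) (\<Sum>j<n. slot n j (y j)) = inner x (y i)"
proof -
  have "inner (slot n i x) (\<Sum>j<n. slot n j (y j)) = (\<Sum>j<n. if i = j then inner x (y j) else 0)"
    unfolding inner_sum_right by (intro sum.cong) (auto simp: inner_slot assms)
  then show ?thesis using assms by simp
qed

lemma norm_slot_sum: "(norm (\<Sum>i<n. slot n i (y i)))\<^sup>2 = (\<Sum>i<n. (norm (y i))\<^sup>2)"
  unfolding power2_norm_eq_inner inner_sum_left by (intro sum.cong) (auto simp: inner_slot_sum)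

lemma norm_column: "(norm (blinfun_apply (column_op n T) x))\<^sup>2 = (\<Sum>i<n. (norm (T i x))\<^sup>2)"
  unfolding col_apply by (rule norm_slot_sum)

lemma row_column: "row_op n a o\<^sub>L column_op n T = (\<Sum>i<n. a i *\<^sub>R T i)"
proof (rule operator_eqI)
  fix x y
  have "inner ((row_op n a o\<^sub>L column_op n T) x) y = (\<Sum>i<n. a i * inner (slot n i y) (\<Sum>j<n. slot n j (T j x)))"
    by (simp add: row_op_def blinfun.sum_left inner_sum_left blinfun.scaleR_left inner_adj col_apply)
       (simp add: inner_commute inner_sum_right)
  also have "\<dots> = (\<Sum>i<n. a i * inner y (T i x))" by (intro sum.cong) (simp_all add: inner_slot_sum)
  finally show "inner ((row_op n a o\<^sub>L column_op n T) x) y = inner ((\<Sum>i<n. a i *\<^sub>R T i) x) y"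
    by (simp add: blinfun.sum_left inner_sum_right blinfun.scaleR_left inner_commute[of _ y])
qed

lemma norm_row_le: "norm (row_op n a) \<le> L2_set a {..<n}"
proof -
  have "adj (row_op n a) x = (\<Sum>i<n. slot n i (a i *\<^sub>R x))" for x
  proof -
    have "adj (row_op n a) = (\<Sum>i<n. adj (a i *\<^sub>R adj (slot n i)))"
      unfolding row_op_def by (rule linear_sum[OF bounded_linear.linear[OF bounded_linear_adj]])
    then show ?thesis by (simp add: adj_scaleR blinfun.sum_left blinfun.scaleR_left blinfun.scaleR_right)
  qed
  then have "(norm (adj (row_op n a) x))\<^sup>2 = (\<Sum>i<n. (a i)\<^sup>2 * (norm x)\<^sup>2)" for x
    by (simp add: norm_slot_sum power_mult_distrib)
  then have "(norm (adj (row_op n a) x))\<^sup>2 = (L2_set a {..<n} * norm x)\<^sup>2" for x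
    by (simp add: power_mult_distrib L2_set_def sum_nonneg sum_distrib_right)
  then have "norm (adj (row_op n a) x) = L2_set a {..<n} * norm x" for x
    by (rule power2_eq_imp_eq) auto
  then have "norm (adj (row_op n a)) \<le> L2_set a {..<n}" by (intro norm_blinfun_bound) auto
  then show ?thesis by (simp add: norm_adj)
qed

lemma compact_column: "(\<And>i. i < n \<Longrightarrow> compact_operator (T i)) \<Longrightarrow> compact_operator (column_op n T)"
  unfolding column_op_def by (auto intro!: compact_operator_sum compact_operator_compose)

lemma schattenD: "T \<in> schatten p \<Longrightarrow> compact_operator T" "T \<in> schatten p \<Longrightarrow> schatten_summable p T"
  by (simp_all add: schatten_def)

lemma svd_pairing_powr:
  assumes "svd T s u v"
  shows "\<bar>inner (blinfun_apply T (v k)) (u k)\<bar> powr p = s k powr p"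
  using svd_nonneg[OF assms, of k] svd_norm_one(1)[OF assms, of k]
  by (cases "s k = 0") (auto simp: svd_apply_right[OF assms] dot_square_norm)

lemma bessel_adj:
  assumes "bessel u" "\<And>y. norm (blinfun_apply J y) \<le> norm y"
  shows "bessel (\<lambda>k. blinfun_apply (adj J) (u k))"
  unfolding bessel_def
proof (intro allI)
  fix y N
  have "(\<Sum>j<N. (inner (adj J (u j)) y)\<^sup>2) = (\<Sum>j<N. (inner (u j) (J y))\<^sup>2)" by (simp add: inner_adj)
  also have "\<dots> \<le> (norm (J y))\<^sup>2" by (rule bessel_sum_le[OF assms(1)])
  also have "\<dots> \<le> (norm y)\<^sup>2" by (intro power_mono assms(2)) simp
  finally show "(\<Sum>j<N. (inner (adj J (u j)) y)\<^sup>2) \<le> (norm y)\<^sup>2" .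
qed

text \<open>
  Each pairing with singular vectors of the column is a sum of \<open>n\<close> pairings of the
  entries with Bessel systems. Only finiteness matters, so the sum over the entries is estimated
  crudely.
\<close>

lemma column_schatten:
  assumes n: "0 < n" and p: "1 \<le> p" and T: "\<And>i. i < n \<Longrightarrow> T i \<in> schatten p"
  shows "column_op n T \<in> schatten p"
proof -
  have comp: "compact_operator (column_op n T)" by (rule compact_column) (rule schattenD[OF T])
  then obtain u v where svd: "svd (column_op n T) (singular_value (column_op n T)) u v" by (rule compact_svd)
  have "(\<Sum>k<N. singular_value (column_op n T) k powr p) \<le> (\<Sum>i<n. (1 / real n) * (real n powr p * schatten_sum p (T i)))" for N
  proof -
    have J: "bessel (\<lambda>k. adj (slot n i) (u k))" if "i < n" for i
      by (rule bessel_adj[OF ons_bessel[OF svd_ons(1)[OF svd]]]) (simp add: norm_eq_sqrt_inner inner_slot that)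
    have term_le: "singular_value (column_op n T) k powr p
        \<le> (\<Sum>i<n. (1 / real n) * (real n powr p * \<bar>inner (T i (v k)) (adj (slot n i) (u k))\<bar> powr p))" for k
    proof -
      let ?c = "\<lambda>i. \<bar>inner (T i (v k)) (adj (slot n i) (u k))\<bar>"
      have "inner (column_op n T (v k)) (u k) = (\<Sum>i<n. inner (T i (v k)) (adj (slot n i) (u k)))"
        by (simp add: col_apply inner_sum_left inner_adj inner_commute[of _ "adj _ _"]) (simp add: inner_commute)
      then have "\<bar>inner (column_op n T (v k)) (u k)\<bar> \<le> (\<Sum>i<n. (1 / real n) * (real n * ?c i))"
        using n by (simp add: sum_abs)
      then have "\<bar>inner (column_op n T (v k)) (u k)\<bar> powr p \<le> (\<Sum>i<n. (1 / real n) * (real n * ?c i)) powr p"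
        by (intro powr_mono2) (use p in auto)
      also have "\<dots> \<le> (\<Sum>i<n. (1 / real n) * (real n * ?c i) powr p)"
        by (rule powr_sum_le_sum_powr) (use n p in auto)
      finally show ?thesis unfolding svd_pairing_powr[OF svd] by (simp add: powr_mult)
    qed
    have "(\<Sum>k<N. singular_value (column_op n T) k powr p)
        \<le> (\<Sum>k<N. \<Sum>i<n. (1 / real n) * (real n powr p * \<bar>inner (T i (v k)) (adj (slot n i) (u k))\<bar> powr p))"
      by (rule sum_mono[OF term_le])
    also have "\<dots> = (\<Sum>i<n. (1 / real n) * (real n powr p * (\<Sum>k<N. \<bar>inner (T i (v k)) (adj (slot n i) (u k))\<bar> powr p)))"
      by (subst sum.swap) (simp only: sum_distrib_left)
    also have "\<dots> \<le> (\<Sum>i<n. (1 / real n) * (real n powr p * schatten_sum p (T i)))"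
    proof (intro sum_mono mult_left_mono)
      fix i assume "i \<in> {..<n}"
      then have i: "i < n" by simp
      obtain u' v' where svd': "svd (T i) (singular_value (T i)) u' v'" by (rule compact_svd[OF schattenD(1)[OF T[OF i]]])
      show "(\<Sum>k<N. \<bar>inner (T i (v k)) (adj (slot n i) (u k))\<bar> powr p) \<le> schatten_sum p (T i)"
        unfolding schatten_sum_def
        by (rule sum_abs_inner_le[OF svd' schattenD(2)[OF T[OF i]] p ons_bessel[OF svd_ons(2)[OF svd]] J[OF i]])
    qed auto
    finally show ?thesis .
  qed
  then have "schatten_summable p (column_op n T)" by (rule powr_sums_le(1))
  then show ?thesis using comp by (simp add: schatten_def)
qed

section \<open>Schatten norms as functions of the operator\<close>

lemma decseq_singular_value:
  assumes "compact_operator T"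
  shows "decseq (singular_value T)"
  using compact_svd_exists[OF assms] svd_singular_value by metis

lemma singular_value_nonneg: "compact_operator T \<Longrightarrow> 0 \<le> singular_value T k"
  using compact_svd svd_nonneg by metis

lemma svd_zero: "svd 0 (\<lambda>_. 0) (\<lambda>_. 0) (\<lambda>_. 0)"
  unfolding svd_def ons_def by simp

lemma singular_value_scaleR:
  assumes "compact_operator T"
  shows "singular_value (c *\<^sub>R T) = (\<lambda>k. \<bar>c\<bar> * singular_value T k)"
proof (cases "c = 0")
  case True
  then show ?thesis using svd_singular_value[OF svd_zero] by (simp add: decseq_def)
next
  case False
  obtain u v where svd: "svd T (singular_value T) u v" by (rule compact_svd[OF assms])
  have "svd (c *\<^sub>R T) (\<lambda>k. \<bar>c\<bar> * singular_value T k) (\<lambda>k. sgn c *\<^sub>R u k) v"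
    unfolding svd_def
  proof (intro conjI allI)
    show "ons (\<lambda>k. sgn c *\<^sub>R u k)"
      using svd_ons(1)[OF svd] False by (auto simp: ons_def abs_sgn_eq)
    have "(\<lambda>k. c *\<^sub>R singular_value T k *\<^sub>R rank1 (u k) (v k)) sums (c *\<^sub>R T)"
      using svd by (intro sums_scaleR_right) (simp add: svd_def)
    moreover have "c *\<^sub>R singular_value T k *\<^sub>R rank1 (u k) (v k)
        = (\<bar>c\<bar> * singular_value T k) *\<^sub>R rank1 (sgn c *\<^sub>R u k) (v k)" for k
    proof (rule blinfun_eqI)
      fix x
      have "c = \<bar>c\<bar> * sgn c" by (simp add: abs_mult_sgn mult.commute)
      then show "(c *\<^sub>R singular_value T k *\<^sub>R rank1 (u k) (v k)) x
        = ((\<bar>c\<bar> * singular_value T k) *\<^sub>R rank1 (sgn c *\<^sub>R u k) (v k)) x"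
        by (simp add: blinfun.scaleR_left)
    qed
    ultimately show "(\<lambda>k. (\<bar>c\<bar> * singular_value T k) *\<^sub>R rank1 (sgn c *\<^sub>R u k) (v k)) sums (c *\<^sub>R T)"
      by simp
  qed (use svd False in \<open>auto simp: svd_def abs_sgn_eq\<close>)
  moreover have "decseq (\<lambda>k. \<bar>c\<bar> * singular_value T k)"
    using decseq_singular_value[OF assms] by (auto simp: decseq_def intro: mult_left_mono)
  ultimately show ?thesis by (rule svd_singular_value)
qed

lemma schatten_norm_eq: "schatten_norm p T = schatten_sum p T powr (1 / p)"
  by (simp add: schatten_norm_def schatten_sum_def)

lemma schatten_norm_nonneg: "0 \<le> schatten_norm p T"
  by (simp add: schatten_norm_def)

lemma schatten_norm_powr:
  assumes "0 < p" "schatten_summable p T"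
  shows "schatten_norm p T powr p = schatten_sum p T"
  using assms schatten_sum_nonneg[OF assms(2)] by (simp add: schatten_norm_eq powr_powr)

lemma schatten_norm_scaleR:
  assumes p: "0 < p" and "T \<in> schatten p"
  shows "schatten_norm p (c *\<^sub>R T) = \<bar>c\<bar> * schatten_norm p T"
proof -
  note T = schattenD[OF assms(2)]
  have "schatten_sum p (c *\<^sub>R T) = (\<Sum>k. \<bar>c\<bar> powr p * singular_value T k powr p)"
    unfolding schatten_sum_def singular_value_scaleR[OF T(1)]
    by (simp add: powr_mult singular_value_nonneg[OF T(1)])
  also have "\<dots> = \<bar>c\<bar> powr p * schatten_sum p T"
    unfolding schatten_sum_def by (rule suminf_mult[OF T(2)])
  finally show ?thesis
    using p schatten_sum_nonneg[OF T(2)] by (simp add: schatten_norm_eq powr_mult powr_powr)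
qed

lemma norm_le_schatten_norm:
  assumes p: "0 < p" and "T \<in> schatten p"
  shows "norm T \<le> schatten_norm p T"
proof -
  note T = schattenD[OF assms(2)]
  obtain u v where svd: "svd T (singular_value T) u v" by (rule compact_svd[OF T(1)])
  let ?s = "singular_value T"
  have "norm T \<le> ?s 0"
  proof (rule norm_blinfun_bound)
    show "0 \<le> ?s 0" by (rule singular_value_nonneg[OF T(1)])
    fix x
    have "(norm (T x))\<^sup>2 \<le> (?s 0)\<^sup>2 * (norm x)\<^sup>2"
    proof (rule sums_le_const[OF svd_norm_sums[OF svd]])
      fix K
      have "(\<Sum>k<K. (?s k)\<^sup>2 * (inner (v k) x)\<^sup>2) \<le> (\<Sum>k<K. (?s 0)\<^sup>2 * (inner (v k) x)\<^sup>2)"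
        using decseqD[OF decseq_singular_value[OF T(1)], of 0] singular_value_nonneg[OF T(1)]
        by (intro sum_mono mult_right_mono power_mono) auto
      also have "\<dots> = (?s 0)\<^sup>2 * (\<Sum>k<K. (inner (v k) x)\<^sup>2)" by (simp add: sum_distrib_left)
      also have "\<dots> \<le> (?s 0)\<^sup>2 * (norm x)\<^sup>2"
        by (intro mult_left_mono bessel_sum_le ons_bessel svd_ons(2)[OF svd]) simp
      finally show "(\<Sum>k<K. (?s k)\<^sup>2 * (inner (v k) x)\<^sup>2) \<le> (?s 0)\<^sup>2 * (norm x)\<^sup>2" .
    qed
    then have "(norm (T x))\<^sup>2 \<le> (?s 0 * norm x)\<^sup>2" by (simp only: power_mult_distrib)
    then show "norm (T x) \<le> ?s 0 * norm x"
      by (rule power2_le_imp_le) (simp add: singular_value_nonneg[OF T(1)])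
  qed
  also have "?s 0 = (?s 0 powr p) powr (1 / p)" using p singular_value_nonneg[OF T(1)] by (simp add: powr_powr)
  also have "\<dots> \<le> schatten_norm p T"
    unfolding schatten_norm_eq schatten_sum_def
    using sum_le_suminf[OF T(2), of "{0}"] p by (intro powr_mono2) auto
  finally show ?thesis .
qed

text \<open>
  The partial sums of the Schatten sum of \<open>T\<close> are pairings with fixed singular
  vectors, hence limits of the corresponding pairings for \<open>X m\<close>.
\<close>

lemma schatten_sum_lower_semicontinuous:
  assumes p: "1 \<le> p" and T: "compact_operator T" and X: "\<And>m. X m \<in> schatten p" "X \<longlonglongrightarrow> T"
    and le: "\<And>m. schatten_sum p (X m) \<le> M"
  shows "schatten_sum p T \<le> M"
proof -
  obtain u v where svd: "svd T (singular_value T) u v" by (rule compact_svd[OF T])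
  have "(\<Sum>k<N. singular_value T k powr p) \<le> M" for N
  proof -
    have "(\<Sum>k<N. \<bar>inner (X m (v k)) (u k)\<bar> powr p) \<le> M" for m
    proof -
      obtain u' v' where svd': "svd (X m) (singular_value (X m)) u' v'" by (rule compact_svd[OF schattenD(1)[OF X(1)]])
      show ?thesis
        using sum_abs_inner_le[OF svd' schattenD(2)[OF X(1)] p ons_bessel[OF svd_ons(2)[OF svd]] ons_bessel[OF svd_ons(1)[OF svd]], of N] le[of m]
        by (simp add: schatten_sum_def)
    qed
    moreover have "(\<lambda>m. \<Sum>k<N. \<bar>inner (X m (v k)) (u k)\<bar> powr p) \<longlonglongrightarrow> (\<Sum>k<N. \<bar>inner (T (v k)) (u k)\<bar> powr p)"
      using p by (intro tendsto_sum tendsto_powr2 tendsto_rabs tendsto_inner tendsto_const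
          always_eventually allI bounded_linear.tendsto[OF blinfun.bounded_linear_left X(2)]) auto
    ultimately have "(\<Sum>k<N. \<bar>inner (T (v k)) (u k)\<bar> powr p) \<le> M"
      using LIMSEQ_le_const2[of "\<lambda>m. \<Sum>k<N. \<bar>inner (X m (v k)) (u k)\<bar> powr p"] by blast
    then show ?thesis by (simp add: svd_pairing_powr[OF svd])
  qed
  then show ?thesis unfolding schatten_sum_def by (rule powr_sums_le)
qed

section \<open>The noncommutative Lewis lemma\<close>

lemma powr_le_linear:
  fixes x r :: real
  assumes "0 \<le> x" "0 < r" "r \<le> 1"
  shows "(1 + x) powr r \<le> 1 + r * x"
proof -
  have "(1 + x) powr r * 1 powr (1 - r) \<le> r * (1 + x) + (1 - r) * 1"
    by (rule Youngs_inequality_0) (use assms in auto)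
  then show ?thesis by (simp add: algebra_simps)
qed

text \<open>
  Adding \<open>\<kappa> a i S\<close> with \<open>S = \<Sum>l<n. a l *\<^sub>R T l\<close> to the
  \<open>i\<close>-th entry changes \<open>\<Sum>i<n. (T i)\<^sup>* (T i)\<close> only by a
  multiple of \<open>S\<^sup>* S\<close>, because the cross terms sum up to \<open>S\<^sup>*
  S\<close> as well.
\<close>

lemma norm_column_update:
  "(norm (blinfun_apply (column_op n (\<lambda>i. T i + (\<kappa> * a i) *\<^sub>R (\<Sum>l<n. a l *\<^sub>R T l))) x))\<^sup>2
    = (norm (blinfun_apply (column_op n T) x))\<^sup>2
      + (2 * \<kappa> + \<kappa>\<^sup>2 * (L2_set a {..<n})\<^sup>2) * (norm ((\<Sum>l<n. a l *\<^sub>R T l) x))\<^sup>2"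
proof -
  define S where "S = (\<Sum>l<n. a l *\<^sub>R T l)"
  have "(norm ((T i + (\<kappa> * a i) *\<^sub>R S) x))\<^sup>2
      = (norm (T i x))\<^sup>2 + 2 * \<kappa> * inner (a i *\<^sub>R T i x) (S x) + \<kappa>\<^sup>2 * ((a i)\<^sup>2 * (norm (S x))\<^sup>2)" for i
    unfolding power2_norm_eq_inner blinfun.add_left blinfun.scaleR_left inner_add_left inner_add_right
    by (simp add: inner_commute power2_eq_square algebra_simps)
  then have "(\<Sum>i<n. (norm ((T i + (\<kappa> * a i) *\<^sub>R S) x))\<^sup>2)
      = (\<Sum>i<n. (norm (T i x))\<^sup>2) + 2 * \<kappa> * inner (\<Sum>i<n. a i *\<^sub>R T i x) (S x) + \<kappa>\<^sup>2 * ((\<Sum>i<n. (a i)\<^sup>2) * (norm (S x))\<^sup>2)"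
    by (simp add: sum.distrib sum_distrib_left sum_distrib_right inner_sum_left)
  also have "(\<Sum>i<n. a i *\<^sub>R T i x) = S x" by (simp add: S_def blinfun.sum_left blinfun.scaleR_left)
  also have "(\<Sum>i<n. (a i)\<^sup>2) = (L2_set a {..<n})\<^sup>2" by (simp add: L2_set_def sum_nonneg)
  finally show ?thesis unfolding S_def[symmetric] norm_column
    by (simp add: power2_norm_eq_inner algebra_simps)
qed

text \<open>
  A tuple that maximises the determinant among all tuples whose column has Schatten norm at most
  \<open>1\<close>. The determinant enters only through \<open>extremal\<close>: the perturbation
  in the direction \<open>a\<close> multiplies the determinant by \<open>1 + \<kappa> * (L2_set a
  {..<n})\<^sup>2\<close>, and by homogeneity the norm of the perturbed column, raised to the
  power \<open>n\<close>, is at least this factor.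
\<close>

locale lewis_position =
  fixes n :: nat and p :: real and T :: "nat \<Rightarrow> operator"
  assumes n: "0 < n" and p: "1 \<le> p"
    and combination: "\<And>a. (\<Sum>l<n. a l *\<^sub>R T l) \<in> schatten p"
    and perturbed: "\<And>\<kappa> a. column_op n (\<lambda>i. T i + (\<kappa> * a i) *\<^sub>R (\<Sum>l<n. a l *\<^sub>R T l)) \<in> schatten p"
    and normalised: "schatten_sum p (column_op n T) \<le> 1"
    and extremal: "\<And>\<kappa> a. 0 \<le> \<kappa> \<Longrightarrow> 1 + \<kappa> * (L2_set a {..<n})\<^sup>2
      \<le> schatten_norm p (column_op n (\<lambda>i. T i + (\<kappa> * a i) *\<^sub>R (\<Sum>l<n. a l *\<^sub>R T l))) ^ n"
begin

lemma column: "column_op n T \<in> schatten p"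
  using perturbed[of 0] by simp

abbreviation comb :: "(nat \<Rightarrow> real) \<Rightarrow> operator"
  where "comb a \<equiv> (\<Sum>l<n. a l *\<^sub>R T l)"

text \<open>
  The first-order condition at the maximum: since the Schatten sum of the perturbed column
  grows at most at the rate \<open>m * b\<close> in \<open>\<epsilon>\<close>, so does the determinant, up to
  the homogeneity factor \<open>2 * n / p\<close>. The perturbed column is known only through the norms of its values, that is,
  through its modulus.
\<close>

lemma first_order_bound:
  assumes b: "0 \<le> b" and \<kappa>: "\<And>\<epsilon>. 0 < \<epsilon> \<Longrightarrow>
      (\<And>C. compact_operator C \<Longrightarrow> schatten_summable p C \<Longrightarrow> (\<And>x. (norm (blinfun_apply C x))\<^sup>2
        = (norm (blinfun_apply (column_op n T) x))\<^sup>2 + \<epsilon> * (norm (blinfun_apply (comb a) x))\<^sup>2)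
        \<Longrightarrow> schatten_sum p C \<le> (1 + \<epsilon> * b) powr m)"
    and m: "0 \<le> m"
  shows "(L2_set a {..<n})\<^sup>2 \<le> 2 * n / p * m * b"
proof (cases "L2_set a {..<n} = 0")
  case True
  then show ?thesis using b m p by simp
next
  case False
  define L where "L = L2_set a {..<n}"
  have L: "0 < L" using False by (simp add: L_def less_le)
  have p0: "0 < p" using p by simp
  have "1 + \<epsilon> * L\<^sup>2 \<le> (1 + \<epsilon> * b) powr (2 * n / p * m)" if \<epsilon>: "0 < \<epsilon>" for \<epsilon>
  proof -
    \<comment> \<open>The solution of \<open>(1 + \<kappa> L\<^sup>2)\<^sup>2 = 1 + \<epsilon> L\<^sup>2\<close>, for which the squared modulus grows by exactly \<open>\<epsilon>\<close> times that of \<open>comb a\<close>.\<close>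
    define \<kappa> where "\<kappa> = (sqrt (1 + \<epsilon> * L\<^sup>2) - 1) / L\<^sup>2"
    have \<kappa>L: "1 + \<kappa> * L\<^sup>2 = sqrt (1 + \<epsilon> * L\<^sup>2)" using L by (simp add: \<kappa>_def)
    have \<kappa>0: "0 \<le> \<kappa>" using \<epsilon> by (simp add: \<kappa>_def)
    have sq: "(1 + \<kappa> * L\<^sup>2)\<^sup>2 = 1 + \<epsilon> * L\<^sup>2" unfolding \<kappa>L using \<epsilon> by simp
    then have "(2 * \<kappa> + \<kappa>\<^sup>2 * L\<^sup>2) * L\<^sup>2 = \<epsilon> * L\<^sup>2" by (simp add: power2_eq_square algebra_simps)
    then have \<epsilon>': "2 * \<kappa> + \<kappa>\<^sup>2 * L\<^sup>2 = \<epsilon>" using L by simp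
    let ?C = "column_op n (\<lambda>i. T i + (\<kappa> * a i) *\<^sub>R comb a)"
    note C = schattenD[OF perturbed[of \<kappa> a]]
    have S: "schatten_sum p ?C \<le> (1 + \<epsilon> * b) powr m"
      by (rule assms(2)[OF \<epsilon> C]) (simp only: norm_column_update \<epsilon>'[unfolded L_def])
    have "1 + \<epsilon> * L\<^sup>2 = (1 + \<kappa> * L\<^sup>2)\<^sup>2" by (simp only: sq)
    also have "\<dots> \<le> (schatten_norm p ?C ^ n)\<^sup>2"
      using extremal[OF \<kappa>0, of a] \<kappa>0 by (intro power_mono) (auto simp: L_def)
    also have "\<dots> = schatten_norm p ?C powr (2 * n)"
      using powr_realpow'[OF schatten_norm_nonneg[of p ?C], of "n * 2"] n
      by (simp only: power_mult[symmetric]) (simp add: mult.commute)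
    also have "\<dots> = schatten_sum p ?C powr (2 * n / p)"
      using schatten_sum_nonneg[OF C(2)] by (simp add: schatten_norm_eq powr_powr)
    also have "\<dots> \<le> ((1 + \<epsilon> * b) powr m) powr (2 * n / p)"
      using S p0 schatten_sum_nonneg[OF C(2)] by (intro powr_mono2) auto
    also have "\<dots> = (1 + \<epsilon> * b) powr (2 * n / p * m)" by (simp add: powr_powr mult.commute)
    finally show ?thesis .
  qed
  then show ?thesis using le_of_linear_le_powr[OF b, of "2 * n / p * m" "L\<^sup>2"] m p0 by (simp add: L_def)
qed

text \<open>
  For \<open>p \<ge> 2\<close> the Schatten sum is convex in the squared modulus. The squared
  modulus of the perturbed column is a multiple of a convex combination of those of the original
  column and of \<open>comb a\<close>, the latter rescaled to have Schatten sum at most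
  \<open>1\<close>. Evaluating along the singular vectors of the perturbed column bounds its
  Schatten sum.
\<close>

lemma Lewis_high:
  assumes p2: "2 \<le> p"
  shows "L2_set a {..<n} powr p \<le> n powr (p / 2) * schatten_sum p (comb a)"
proof -
  have p0: "0 < p" using p by simp
  note C = schattenD[OF column] and Ta = schattenD[OF combination[of a]]
  define \<tau> where "\<tau> = schatten_norm p (comb a)"
  have \<tau>0: "0 \<le> \<tau>" and \<tau>p: "\<tau> powr p = schatten_sum p (comb a)"
    using schatten_norm_powr[OF p0 Ta(2)] by (simp_all add: \<tau>_def schatten_norm_nonneg)
  \<comment> \<open>Taking \<open>b\<close> slightly larger than \<open>\<tau>\<^sup>2\<close> avoids a division by \<open>0\<close> when \<open>comb a = 0\<close>.\<close>
  have "(L2_set a {..<n})\<^sup>2 \<le> n * b" if b: "\<tau>\<^sup>2 < b" for b :: real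
  proof -
    have b0: "0 < b" using b by (meson le_less_trans zero_le_power2)
    have bp: "schatten_sum p (comb a) \<le> b powr (p / 2)"
    proof -
      have "schatten_sum p (comb a) = (\<tau>\<^sup>2) powr (p / 2)" by (simp add: \<tau>p square_powr_half[OF \<tau>0])
      also have "\<dots> \<le> b powr (p / 2)" using b p0 by (intro powr_mono2) auto
      finally show ?thesis .
    qed
    have "(L2_set a {..<n})\<^sup>2 \<le> 2 * n / p * (p / 2) * b"
    proof (rule first_order_bound)
      fix \<epsilon> :: real and C' :: operator
      assume \<epsilon>: "0 < \<epsilon>" and C': "compact_operator C'" "schatten_summable p C'"
        and nC': "\<And>x. (norm (C' x))\<^sup>2 = (norm (column_op n T x))\<^sup>2 + \<epsilon> * (norm (comb a x))\<^sup>2"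
      obtain u v where svd': "svd C' (singular_value C') u v" by (rule compact_svd[OF C'(1)])
      obtain u1 v1 where svd1: "svd (column_op n T) (singular_value (column_op n T)) u1 v1" by (rule compact_svd[OF C(1)])
      obtain u2 v2 where svd2: "svd (comb a) (singular_value (comb a)) u2 v2" by (rule compact_svd[OF Ta(1)])
      let ?D = "1 + \<epsilon> * b"
      have D: "0 < ?D" using \<epsilon> b0 by (simp add: add_pos_pos)
      have "(\<Sum>k<K. singular_value C' k powr p) \<le> ?D powr (p / 2)" for K
      proof -
        let ?\<alpha> = "\<lambda>k. norm (column_op n T (v k))" and ?\<beta> = "\<lambda>k. norm (comb a (v k))"
        have term_le: "singular_value C' k powr p
            \<le> ?D powr (p / 2) * (1 / ?D * ?\<alpha> k powr p + \<epsilon> * b / ?D * (?\<beta> k powr p / b powr (p / 2)))" for k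
        proof -
          \<comment> \<open>The convex combination with weights \<open>1 / ?D\<close> and \<open>\<epsilon> b / ?D\<close>.\<close>
          let ?W = "\<lambda>i :: bool. if i then 1 / ?D else \<epsilon> * b / ?D"
          let ?V = "\<lambda>i :: bool. if i then (?\<alpha> k)\<^sup>2 * ?D else (?\<beta> k)\<^sup>2 * ?D / b"
          have "singular_value C' k powr p = ((norm (C' (v k)))\<^sup>2) powr (p / 2)"
            by (simp add: svd_norm_apply[OF svd'] square_powr_half svd_nonneg[OF svd'])
          also have "(norm (C' (v k)))\<^sup>2 = (\<Sum>i\<in>UNIV. ?W i * ?V i)"
            using D b0 unfolding nC' UNIV_bool by simp
          also have "\<dots> powr (p / 2) \<le> (\<Sum>i\<in>UNIV. ?W i * ?V i powr (p / 2))"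
          proof (rule powr_sum_le_sum_powr)
            show "(\<Sum>i\<in>UNIV. ?W i) \<le> 1" using D by (simp add: UNIV_bool flip: add_divide_distrib)
          qed (use D \<epsilon> b0 p2 in auto)
          also have "\<dots> = 1 / ?D * (?\<alpha> k powr p * ?D powr (p / 2)) + \<epsilon> * b / ?D * (?\<beta> k powr p * ?D powr (p / 2) / b powr (p / 2))"
            using D b0 by (simp add: UNIV_bool powr_mult powr_divide square_powr_half)
          finally show ?thesis by (simp add: algebra_simps)
        qed
        have \<alpha>: "(\<Sum>k<K. ?\<alpha> k powr p) \<le> 1"
          using sum_norm_apply_le[OF svd1 C(2) p2 ons_bessel[OF svd_ons(2)[OF svd']], of K] normalised
          by (simp add: schatten_sum_def)
        have \<beta>: "(\<Sum>k<K. ?\<beta> k powr p) \<le> b powr (p / 2)"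
          using sum_norm_apply_le[OF svd2 Ta(2) p2 ons_bessel[OF svd_ons(2)[OF svd']], of K] bp
          by (simp add: schatten_sum_def)
        have "(\<Sum>k<K. singular_value C' k powr p)
            \<le> (\<Sum>k<K. ?D powr (p / 2) * (1 / ?D * ?\<alpha> k powr p + \<epsilon> * b / ?D * (?\<beta> k powr p / b powr (p / 2))))"
          by (rule sum_mono[OF term_le])
        also have "\<dots> = ?D powr (p / 2) * (1 / ?D * (\<Sum>k<K. ?\<alpha> k powr p) + \<epsilon> * b / ?D * ((\<Sum>k<K. ?\<beta> k powr p) / b powr (p / 2)))"
          by (simp only: sum.distrib sum_distrib_left[symmetric] sum_divide_distrib[symmetric])
        also have "\<dots> \<le> ?D powr (p / 2) * (1 / ?D * 1 + \<epsilon> * b / ?D * 1)"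
          using \<alpha> \<beta> D \<epsilon> b0 by (intro mult_left_mono add_mono) (auto simp: divide_le_eq)
        also have "\<dots> = ?D powr (p / 2)" using D by (simp flip: add_divide_distrib)
        finally show ?thesis .
      qed
      then show "schatten_sum p C' \<le> ?D powr (p / 2)" unfolding schatten_sum_def by (rule powr_sums_le)
    qed (use b0 p0 in auto)
    then show ?thesis using p0 by simp
  qed
  then have "(L2_set a {..<n})\<^sup>2 / n \<le> b" if "\<tau>\<^sup>2 < b" for b
    using that n by (simp add: divide_le_eq mult.commute)
  then have "(L2_set a {..<n})\<^sup>2 / n \<le> \<tau>\<^sup>2" by (rule dense_ge)
  then have "(L2_set a {..<n})\<^sup>2 \<le> n * \<tau>\<^sup>2" using n by (simp add: divide_le_eq mult.commute)
  then have "((L2_set a {..<n})\<^sup>2) powr (p / 2) \<le> (n * \<tau>\<^sup>2) powr (p / 2)" using p0 by (intro powr_mono2) auto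
  then show ?thesis by (simp add: powr_mult square_powr_half \<tau>0 \<tau>p)
qed

text \<open>
  The density is the \<open>p\<close>-th power of the modulus of the extremal column, so that the
  column itself is \<open>density_root p\<close>.
\<close>

definition density_value :: "nat \<Rightarrow> real" where "density_value k = singular_value (column_op n T) k powr p"
definition left_vec :: "nat \<Rightarrow> ell2" where "left_vec = (SOME u. \<exists>v. svd (column_op n T) (singular_value (column_op n T)) u v)"
definition right_vec :: "nat \<Rightarrow> ell2" where "right_vec = (SOME v. svd (column_op n T) (singular_value (column_op n T)) left_vec v)"

lemma svd_column: "svd (column_op n T) (singular_value (column_op n T)) left_vec right_vec"
proof -
  have "\<exists>u v. svd (column_op n T) (singular_value (column_op n T)) u v"
    using compact_svd[OF schattenD(1)[OF column]] by blast
  then have "\<exists>v. svd (column_op n T) (singular_value (column_op n T)) left_vec v" unfolding left_vec_def by (rule someI_ex)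
  then show ?thesis unfolding right_vec_def by (rule someI_ex)
qed

sublocale density density_value left_vec right_vec
proof
  show "summable density_value" using schattenD(2)[OF column] by (simp add: density_value_def[abs_def])
  show "suminf density_value \<le> 1" using normalised by (simp add: schatten_sum_def density_value_def[abs_def])
qed (use svd_column svd_ons[OF svd_column] svd_norm_one[OF svd_column] in \<open>auto simp: density_value_def\<close>)

lemma density_root_p: "density_root p = column_op n T"
proof -
  have p0: "0 < p" using p by simp
  have "(\<lambda>k. density_value k powr (1 / p)) = singular_value (column_op n T)"
    using p0 svd_nonneg[OF svd_column] by (auto simp: density_value_def powr_powr)
  then have "svd (density_root p) (singular_value (column_op n T)) left_vec right_vec"
    using svd_density_root[OF p0] by simp
  then show ?thesis using svd_column unfolding svd_def by (blast intro: sums_unique2)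
qed

lemma twist_row: "twist (row_op n a) p = comb a"
  by (simp add: twist_def density_root_p row_column)

text \<open>
  For \<open>p \<le> 2\<close> the Schatten sum of the perturbed column is bounded by the sum
  along the singular vectors of the original column. There the perturbation is explicit, and its
  first-order term is the squared norm of \<open>row_op n a\<close> in \<open>L\<^sub>2\<close> of
  the density. This gives \<open>L\<^sup>2 \<le> n * H\<close> with \<open>H\<close> bounded by
  interpolation between \<open>p\<close> and \<open>\<infinity>\<close>; the excess power of
  \<open>L\<close> cancels.
\<close>

lemma Lewis_low:
  assumes p2: "p \<le> 2"
  shows "L2_set a {..<n} powr p \<le> n * schatten_sum p (comb a)"
proof -
  have p0: "0 < p" using p by simp
  define L where "L = L2_set a {..<n}"
  note C = schattenD[OF column] and Ta = schattenD[OF combination[of a]]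
  define H where "H = L powr (2 - p) * schatten_sum p (comb a)"
  have H0: "0 \<le> H" unfolding H_def using schatten_sum_nonneg[OF Ta(2)] by simp
  have H: "(\<Sum>k<K. density_value k * (norm (row_op n a (left_vec k)))\<^sup>2) \<le> H" for K
    unfolding H_def L_def
    using sum_density_norm_le[OF p0 p2 norm_row_le, of n a K] Ta(2) by (simp add: twist_row)
  have "L\<^sup>2 \<le> 2 * n / p * 1 * (p / 2 * H)"
    unfolding L_def
  proof (rule first_order_bound)
    fix \<epsilon> :: real and C' :: operator
    assume \<epsilon>: "0 < \<epsilon>" and C': "compact_operator C'" "schatten_summable p C'"
      and nC': "\<And>x. (norm (C' x))\<^sup>2 = (norm (column_op n T x))\<^sup>2 + \<epsilon> * (norm (comb a x))\<^sup>2"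
    obtain u v where svd': "svd C' (singular_value C') u v" by (rule compact_svd[OF C'(1)])
    let ?e = right_vec
    have term_le: "norm (C' (?e k)) powr p \<le> density_value k + \<epsilon> * (p / 2) * (density_value k * (norm (row_op n a (left_vec k)))\<^sup>2)" for k
    proof -
      let ?s = "singular_value (column_op n T) k" and ?N = "(norm (row_op n a (left_vec k)))\<^sup>2"
      have s0: "0 \<le> ?s" by (rule svd_nonneg[OF svd_column])
      have Ta: "comb a (?e k) = ?s *\<^sub>R row_op n a (left_vec k)"
        by (simp add: svd_apply_right[OF svd_column] blinfun.scaleR_right flip: row_column)
      have "norm (C' (?e k)) powr p = ((norm (C' (?e k)))\<^sup>2) powr (p / 2)" by (simp add: square_powr_half)
      also have "(norm (C' (?e k)))\<^sup>2 = ?s\<^sup>2 * (1 + \<epsilon> * ?N)"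
        unfolding nC' Ta svd_norm_apply[OF svd_column] by (simp add: power_mult_distrib algebra_simps)
      also have "\<dots> powr (p / 2) = density_value k * (1 + \<epsilon> * ?N) powr (p / 2)"
        using \<epsilon> s0 by (simp add: powr_mult square_powr_half density_value_def)
      also have "\<dots> \<le> density_value k * (1 + p / 2 * (\<epsilon> * ?N))"
        using \<epsilon> p0 p2 by (intro mult_left_mono powr_le_linear) (auto simp: density_value_def)
      finally show ?thesis by (simp add: algebra_simps)
    qed
    have bound: "(\<Sum>k<K. norm (C' (?e k)) powr p) \<le> 1 + \<epsilon> * (p / 2 * H)" for K
    proof -
      have "(\<Sum>k<K. norm (C' (?e k)) powr p)
          \<le> (\<Sum>k<K. density_value k + \<epsilon> * (p / 2) * (density_value k * (norm (row_op n a (left_vec k)))\<^sup>2))"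
        by (rule sum_mono[OF term_le])
      also have "\<dots> = (\<Sum>k<K. density_value k) + \<epsilon> * (p / 2) * (\<Sum>k<K. density_value k * (norm (row_op n a (left_vec k)))\<^sup>2)"
        by (simp only: sum.distrib sum_distrib_left)
      also have "\<dots> \<le> 1 + \<epsilon> * (p / 2) * H"
        using H[of K] \<delta>_le_1 sum_le_suminf[OF \<delta>_summable, of "{..<K}"] \<delta>_nonneg \<epsilon> p0
        by (intro add_mono mult_left_mono) auto
      finally show ?thesis by (simp add: mult.assoc)
    qed
    note f = powr_sums_le[OF bound]
    have "(\<Sum>k<K. singular_value C' k powr p) \<le> 1 + \<epsilon> * (p / 2 * H)" for K
    proof -
      have "(\<Sum>k<K. singular_value C' k powr p) \<le> (\<Sum>k. norm (C' (?e k)) powr p)"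
      proof (rule sum_powr_le_sum_norm_apply[OF svd' p0 p2 svd_ons(2)[OF svd_column] _ f(1)])
        fix y assume "\<And>j. inner (?e j) y = 0"
        then have 0: "column_op n T y = 0" by (intro svd_kernel[OF svd_column]) simp
        then have "comb a y = 0" by (simp flip: row_column)
        then have "(norm (C' y))\<^sup>2 = 0" unfolding nC' 0 by simp
        then show "C' y = 0" by simp
      qed
      with f(2) show ?thesis by linarith
    qed
    then have "schatten_sum p C' \<le> 1 + \<epsilon> * (p / 2 * H)" unfolding schatten_sum_def by (rule powr_sums_le)
    then show "schatten_sum p C' \<le> (1 + \<epsilon> * (p / 2 * H)) powr 1" using \<epsilon> H0 p0 by simp
  qed (use H0 p0 in auto)
  then have L2: "L\<^sup>2 \<le> n * H" using p0 by simp
  show ?thesis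
  proof (cases "L = 0")
    case False
    then have L: "0 < L" by (simp add: L_def less_le)
    have "L powr 2 \<le> (n * schatten_sum p (comb a)) * L powr (2 - p)" using L2 L by (simp add: H_def mult_ac)
    then have "L powr (2 - p) * L powr p \<le> L powr (2 - p) * (n * schatten_sum p (comb a))"
      by (simp add: mult.commute flip: powr_add)
    then show ?thesis using L by (simp add: L_def mult_le_cancel_left_pos)
  qed (use schatten_sum_nonneg[OF Ta(2)] in \<open>simp add: L_def\<close>)
qed

text \<open>
  The lower estimate is the inclusion between the norms over the density. The upper one is
  interpolation between \<open>p\<close> and \<open>\<infinity>\<close>, where the operator norm
  of \<open>row_op n a\<close> is at most the Euclidean norm of \<open>a\<close>, which the two
  preceding estimates bound by the Schatten norm of \<open>comb a\<close>.
\<close>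

lemma twist_embedding:
  assumes q: "p < q"
  shows "twist (row_op n a) q \<in> schatten q"
    and "schatten_norm p (comb a) \<le> schatten_norm q (twist (row_op n a) q)"
    and "schatten_norm q (twist (row_op n a) q)
      \<le> n powr (if p \<le> 2 then 1 / p - 1 / q else p / 2 * (1 / p - 1 / q)) * schatten_norm p (comb a)"
proof -
  have p0: "0 < p" and q0: "0 < q" using p q by auto
  define L where "L = L2_set a {..<n}"
  define c where "c = (if p \<le> 2 then 1 else p / 2)"
  note Ta = schattenD(2)[OF combination[of a]]
  let ?G = "twist (row_op n a) q" and ?S = "schatten_sum p (comb a)"
  have S0: "0 \<le> ?S" by (rule schatten_sum_nonneg[OF Ta])
  have up: "schatten_summable q ?G" "schatten_sum q ?G \<le> L powr (q - p) * ?S"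
    using twist_upper[OF p0 less_imp_le[OF q] norm_row_le, of n a] Ta by (auto simp: twist_row L_def)
  show "?G \<in> schatten q" using up(1) compact_twist[OF q0] by (simp add: schatten_def)
  have G0: "0 \<le> schatten_sum q ?G" by (rule schatten_sum_nonneg[OF up(1)])
  have "?S \<le> schatten_sum q ?G powr (p / q)"
    using twist_lower[OF p q, of "row_op n a"] Ta by (simp add: twist_row)
  then have "?S powr (1 / p) \<le> (schatten_sum q ?G powr (p / q)) powr (1 / p)"
    using S0 p0 by (intro powr_mono2) auto
  then show "schatten_norm p (comb a) \<le> schatten_norm q ?G"
    using p0 by (simp add: schatten_norm_eq powr_powr)
  have Lp: "L powr p \<le> n powr c * ?S"
    using Lewis_low[of a] Lewis_high[of a] by (auto simp: c_def L_def)
  have "L powr (q - p) = (L powr p) powr ((q - p) / p)" using p0 by (simp add: powr_powr)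
  also have "\<dots> \<le> (n powr c * ?S) powr ((q - p) / p)" using Lp p0 q by (intro powr_mono2) auto
  finally have "L powr (q - p) * ?S \<le> (n powr c * ?S) powr ((q - p) / p) * ?S" using S0 by (rule mult_right_mono)
  also have "\<dots> = n powr (c * ((q - p) / p)) * (?S powr ((q - p) / p) * ?S powr 1)"
    using S0 by (simp add: powr_mult powr_powr)
  also have "\<dots> = n powr (c * ((q - p) / p)) * ?S powr (q / p)"
    using p0 by (simp only: powr_add[symmetric]) (simp add: diff_divide_distrib)
  finally have "schatten_sum q ?G \<le> n powr (c * ((q - p) / p)) * ?S powr (q / p)" using up(2) by linarith
  then have "schatten_sum q ?G powr (1 / q) \<le> (n powr (c * ((q - p) / p)) * ?S powr (q / p)) powr (1 / q)"
    using G0 q0 by (intro powr_mono2) auto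
  also have "\<dots> = n powr (c * ((q - p) / p) / q) * ?S powr (1 / p)"
    using q0 by (simp add: powr_mult powr_powr)
  also have "c * ((q - p) / p) / q = (if p \<le> 2 then 1 / p - 1 / q else p / 2 * (1 / p - 1 / q))"
    using p0 q0 by (simp add: c_def field_simps)
  finally show "schatten_norm q ?G
      \<le> n powr (if p \<le> 2 then 1 / p - 1 / q else p / 2 * (1 / p - 1 / q)) * schatten_norm p (comb a)"
    unfolding schatten_norm_eq .
qed

end

section \<open>Compactness in coordinates\<close>

lemma compact_cube: "compact {f :: 'i \<Rightarrow> real. \<forall>x. f x \<in> {- k..k}}"
proof -
  have "compactin (product_topology (\<lambda>_ :: 'i. euclidean) UNIV) (PiE UNIV (\<lambda>_. {- k..k :: real}))"
    unfolding compactin_PiE by simp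
  moreover have "PiE UNIV (\<lambda>_ :: 'i. {- k..k :: real}) = {f. \<forall>x. f x \<in> {- k..k}}" by (auto simp: PiE_def Pi_def)
  ultimately show ?thesis by (simp add: euclidean_product_topology)
qed

lemma tendsto_coordinate:
  fixes X :: "nat \<Rightarrow> 'i :: countable \<Rightarrow> real"
  assumes "X \<longlonglongrightarrow> f"
  shows "(\<lambda>m. X m x) \<longlonglongrightarrow> f x"
proof -
  have "continuous_on UNIV (\<lambda>g :: 'i \<Rightarrow> real. g x)" by (rule continuous_on_product_coordinates)
  then have "isCont (\<lambda>g :: 'i \<Rightarrow> real. g x) f"
    using continuous_on_eq_continuous_at[OF open_UNIV] UNIV_I by blast
  then show ?thesis using assms by (rule isCont_tendsto_compose)
qed

lemma nonemptyI: "x \<in> A \<Longrightarrow> A \<noteq> {}"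
  by auto

text \<open>
  The norm of a linear combination attains a minimum on the compact set of coefficients with
  absolute sum \<open>1\<close>, and linear independence makes this minimum positive.
\<close>

lemma independent_coordinates_bounded:
  fixes B :: "nat \<Rightarrow> 'a :: real_normed_vector"
  assumes inj: "inj_on B {..<n}" and ind: "independent (B ` {..<n})"
  shows "\<exists>K. \<forall>c. \<forall>j<n. \<bar>c j\<bar> \<le> K * norm (\<Sum>i<n. c i *\<^sub>R B i)"
proof (cases "n = 0")
  case False
  let ?N = "\<lambda>c :: nat \<Rightarrow> real. norm (\<Sum>i<n. c i *\<^sub>R B i)"
  let ?C = "{c :: nat \<Rightarrow> real. \<forall>x. c x \<in> {- 1..1}}" and ?E = "{c :: nat \<Rightarrow> real. (\<Sum>i<n. \<bar>c i\<bar>) = 1}"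
  have "closed ?E"
    by (intro closed_Collect_eq continuous_intros continuous_on_product_coordinates)
  then have "compact (?C \<inter> ?E)" by (intro compact_Int_closed compact_cube)
  moreover have "(\<lambda>i. if i = 0 then 1 else 0) \<in> ?C \<inter> ?E"
    using False by (simp add: if_distrib[of abs] cong: if_cong)
  then have "?C \<inter> ?E \<noteq> {}" by (rule nonemptyI)
  moreover have "continuous_on (?C \<inter> ?E) ?N"
    by (intro continuous_intros continuous_on_subset[OF continuous_on_product_coordinates]) auto
  ultimately obtain c0 where c0: "c0 \<in> ?C \<inter> ?E" "\<And>c. c \<in> ?C \<inter> ?E \<Longrightarrow> ?N c0 \<le> ?N c"
    by (rule continuous_attains_inf[THEN bexE]) blast
  have "?N c0 \<noteq> 0"
  proof
    assume "?N c0 = 0"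
    then have "(\<Sum>i<n. c0 i *\<^sub>R B i) = 0" by simp
    then have "(\<Sum>v\<in>B ` {..<n}. c0 (the_inv_into {..<n} B v) *\<^sub>R v) = 0"
      by (simp add: sum.reindex[OF inj] the_inv_into_f_f[OF inj])
    then have "c0 (the_inv_into {..<n} B (B i)) = 0" if "i < n" for i
      using independentD[OF ind _ subset_refl, of "\<lambda>v. c0 (the_inv_into {..<n} B v)"] that by simp
    then have "c0 i = 0" if "i < n" for i using that by (simp add: the_inv_into_f_f[OF inj])
    then show False using c0(1) by simp
  qed
  then have r: "0 < ?N c0" by simp
  have "\<bar>c j\<bar> \<le> 1 / ?N c0 * ?N c" if j: "j < n" for c j
  proof -
    define s where "s = (\<Sum>i<n. \<bar>c i\<bar>)"
    have le: "\<bar>c i\<bar> \<le> s" if "i < n" for i unfolding s_def by (rule member_le_sum) (use that in auto)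
    show ?thesis
    proof (cases "s = 0")
      case True
      then have "\<bar>c j\<bar> = 0" using le[OF j] by simp
      moreover have "0 \<le> 1 / ?N c0 * ?N c" by simp
      ultimately show ?thesis by linarith
    next
      case False
      then have s: "0 < s" by (simp add: s_def less_le sum_nonneg)
      define d where "d i = (if i < n then c i / s else 0)" for i
      have "d \<in> ?C"
        using le s by (auto simp: d_def abs_le_iff divide_le_eq le_divide_eq minus_le_iff)
      moreover have "(\<Sum>i<n. \<bar>d i\<bar>) = 1" using s by (simp add: d_def s_def flip: sum_divide_distrib)
      ultimately have "?N c0 \<le> ?N d" by (intro c0(2)) simp
      also have "(\<Sum>i<n. d i *\<^sub>R B i) = (1 / s) *\<^sub>R (\<Sum>i<n. c i *\<^sub>R B i)"
        by (simp add: d_def scaleR_sum_right)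
      finally have "?N c0 \<le> ?N c / s" using s by simp
      then have "s \<le> 1 / ?N c0 * ?N c" using r s by (simp add: field_simps)
      then show ?thesis using le[OF j] by simp
    qed
  qed
  then show ?thesis by blast
qed simp

section \<open>Matrices of maximal determinant\<close>

abbreviation block_det :: "nat \<Rightarrow> (nat \<times> nat \<Rightarrow> real) \<Rightarrow> real"
  where "block_det n A \<equiv> Determinant.det (Matrix.mat n n A)"

text \<open>
  The block matrix with diagonal blocks \<open>1\<close> and off-diagonal blocks \<open>u\<close>
  and \<open>v\<close> is factored into triangular block matrices in two ways, eliminating either
  corner.
\<close>

lemma det_one_plus_rank1:
  fixes a :: "nat \<Rightarrow> real"
  shows "block_det n (\<lambda>(i, j). (if i = j then 1 else 0) + \<kappa> * a i * a j) = 1 + \<kappa> * (\<Sum>i<n. (a i)\<^sup>2)"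
proof -
  define M where "M = Matrix.mat n n (\<lambda>(i, j). (if i = j then 1 else 0) + \<kappa> * a i * a j)"
  define u where "u = Matrix.mat n 1 (\<lambda>(i, j). \<kappa> * a i)"
  define v where "v = Matrix.mat 1 n (\<lambda>(i, j). - a j)"
  define S where "S = Matrix.mat 1 1 (\<lambda>(i, j). 1 + \<kappa> * (\<Sum>i<n. (a i)\<^sup>2))"
  have carr: "M \<in> carrier_mat n n" "u \<in> carrier_mat n 1" "v \<in> carrier_mat 1 n" "S \<in> carrier_mat 1 1"
    by (simp_all add: M_def u_def v_def S_def)
  let ?In = "1\<^sub>m n :: real mat" and ?I1 = "1\<^sub>m 1 :: real mat"
  let ?P = "four_block_mat ?In u (0\<^sub>m 1 n) ?I1" and ?Q = "four_block_mat M (0\<^sub>m n 1) v ?I1"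
  let ?P' = "four_block_mat ?In (0\<^sub>m n 1) v ?I1" and ?Q' = "four_block_mat ?In u (0\<^sub>m 1 n) S"
  have uv: "M + u * v = ?In"
    by (rule eq_matI) (auto simp: M_def u_def v_def scalar_prod_def)
  have vu: "v * u + S = ?I1"
    by (rule eq_matI) (auto simp: u_def v_def S_def scalar_prod_def sum_negf sum_distrib_left power2_eq_square
        lessThan_atLeast0 mult_ac)
  have "?P * ?Q = four_block_mat ?In u v ?I1"
    using carr by (subst mult_four_block_mat[where ?nr1.0 = n and ?nr2.0 = 1 and ?nc1.0 = n and ?nc2.0 = 1 and ?n1.0 = n and ?n2.0 = 1])
      (auto simp: uv)
  moreover have "?P' * ?Q' = four_block_mat ?In u v ?I1"
    using carr by (subst mult_four_block_mat[where ?nr1.0 = n and ?nr2.0 = 1 and ?nc1.0 = n and ?nc2.0 = 1 and ?n1.0 = n and ?n2.0 = 1])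
      (auto simp: vu)
  ultimately have "Determinant.det (?P * ?Q) = Determinant.det (?P' * ?Q')" by simp
  moreover have "Determinant.det (?P * ?Q) = Determinant.det ?P * Determinant.det ?Q"
    by (rule det_mult[of _ "n + 1"]) (use carr in auto)
  moreover have "Determinant.det (?P' * ?Q') = Determinant.det ?P' * Determinant.det ?Q'"
    by (rule det_mult[of _ "n + 1"]) (use carr in auto)
  moreover have "Determinant.det ?P = 1"
    using carr by (subst det_four_block_mat_lower_left_zero[of _ n _ 1]) auto
  moreover have "Determinant.det ?Q = Determinant.det M"
    using carr by (subst det_four_block_mat_upper_right_zero[of _ n _ 1]) auto
  moreover have "Determinant.det ?P' = 1"
    using carr by (subst det_four_block_mat_upper_right_zero[of _ n _ 1]) auto
  moreover have "Determinant.det ?Q' = Determinant.det S"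
    using carr by (subst det_four_block_mat_lower_left_zero[of _ n _ 1]) auto
  ultimately have "Determinant.det M = Determinant.det S" by simp
  also have "\<dots> = 1 + \<kappa> * (\<Sum>i<n. (a i)\<^sup>2)" by (simp add: S_def det_single)
  finally show ?thesis by (simp add: M_def)
qed

lemma det_rank1_update:
  fixes a :: "nat \<Rightarrow> real"
  shows "block_det n (\<lambda>(i, j). A (i, j) + \<kappa> * a i * (\<Sum>l<n. a l * A (l, j)))
    = (1 + \<kappa> * (\<Sum>i<n. (a i)\<^sup>2)) * block_det n A"
proof -
  let ?M = "Matrix.mat n n (\<lambda>(i, j). (if i = j then 1 else 0) + \<kappa> * a i * a j)"
  have entry: "A (i, j) + \<kappa> * a i * (\<Sum>l<n. a l * A (l, j))
      = (\<Sum>l<n. ((if i = l then 1 else 0) + \<kappa> * a i * a l) * A (l, j))" if "i < n" for i j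
  proof -
    have "(\<Sum>l<n. ((if i = l then 1 else 0) + \<kappa> * a i * a l) * A (l, j))
        = (\<Sum>l<n. (if i = l then A (i, j) else 0) + \<kappa> * a i * (a l * A (l, j)))"
      by (intro sum.cong) (auto simp: algebra_simps)
    then show ?thesis using that by (simp add: sum.distrib sum_distrib_left)
  qed
  have "Matrix.mat n n (\<lambda>(i, j). A (i, j) + \<kappa> * a i * (\<Sum>l<n. a l * A (l, j))) = ?M * Matrix.mat n n A"
    by (rule eq_matI) (simp_all add: entry[unfolded lessThan_atLeast0] scalar_prod_def lessThan_atLeast0)
  then show ?thesis by (simp add: det_mult[of _ n] det_one_plus_rank1)
qed

lemma det_nonzero_rows_span:
  assumes "block_det n A \<noteq> 0"
  shows "\<exists>a. \<forall>j<n. c j = (\<Sum>i<n. a i * A (i, j))"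
proof -
  let ?A = "Matrix.mat n n A"
  have "?A \<in> Units (ring_mat TYPE(real) n ())" by (rule det_non_zero_imp_unit[OF _ assms]) simp
  then obtain B where B: "B \<in> carrier_mat n n" "B * ?A = 1\<^sub>m n"
    by (auto simp: Units_def ring_mat_def)
  have BA: "(\<Sum>i<n. B $$ (k, i) * A (i, j)) = (if k = j then 1 else 0)" if "k < n" "j < n" for k j
  proof -
    have "(B * ?A) $$ (k, j) = (\<Sum>i<n. B $$ (k, i) * A (i, j))"
      using B(1) that by (simp add: scalar_prod_def lessThan_atLeast0)
    then show ?thesis using that by (simp add: B(2))
  qed
  show ?thesis
  proof (intro exI allI impI)
    fix j assume j: "j < n"
    have "(\<Sum>i<n. (\<Sum>k<n. c k * B $$ (k, i)) * A (i, j)) = (\<Sum>k<n. c k * (\<Sum>i<n. B $$ (k, i) * A (i, j)))"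
      unfolding sum_distrib_left sum_distrib_right by (subst sum.swap) (simp add: mult.assoc)
    also have "\<dots> = (\<Sum>k<n. c k * (if k = j then 1 else 0))" by (intro sum.cong refl) (simp add: BA j)
    also have "\<dots> = c j" using j by (simp add: if_distrib cong: if_cong)
    finally show "c j = (\<Sum>i<n. (\<Sum>k<n. c k * B $$ (k, i)) * A (i, j))" by simp
  qed
qed

text \<open>
  The set where \<open>\<psi> \<le> 1\<close> is closed, and its intersection with a cube is
  compact, so the absolute determinant attains its maximum there. Homogeneity turns the maximum
  into the inequality for all \<open>B\<close>. Entries outside the \<open>n \<times> n\<close>
  block are irrelevant to both functions and are set to \<open>0\<close> to remain in the cube.
\<close>

lemma maximal_determinant:
  fixes \<psi> :: "(nat \<times> nat \<Rightarrow> real) \<Rightarrow> real"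
  assumes n: "0 < n"
    and nonneg: "\<And>A. 0 \<le> \<psi> A"
    and scale: "\<And>c A. \<psi> (\<lambda>x. c * A x) = \<bar>c\<bar> * \<psi> A"
    and restrict: "\<And>A B. (\<And>i j. i < n \<Longrightarrow> j < n \<Longrightarrow> A (i, j) = B (i, j)) \<Longrightarrow> \<psi> A = \<psi> B"
    and bound: "\<And>A i j. i < n \<Longrightarrow> j < n \<Longrightarrow> \<bar>A (i, j)\<bar> \<le> K * \<psi> A"
    and lsc: "\<And>X A. (\<And>x. (\<lambda>m. X m x) \<longlonglongrightarrow> A x) \<Longrightarrow> (\<And>m. \<psi> (X m) \<le> 1) \<Longrightarrow> \<psi> A \<le> 1"
  shows "\<exists>A. \<psi> A \<le> 1 \<and> block_det n A \<noteq> 0 \<and> (\<forall>B. \<bar>block_det n B\<bar> \<le> \<bar>block_det n A\<bar> * \<psi> B ^ n)"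
proof -
  let ?D = "block_det n"
  define k where "k = \<bar>K\<bar>"
  have bk: "A (i, j) \<in> {- k..k}" if "i < n" "j < n" "\<psi> A \<le> 1" for A i j
  proof -
    have "\<bar>A (i, j)\<bar> \<le> K * \<psi> A" by (rule bound[OF that(1,2)])
    also have "\<dots> \<le> \<bar>K\<bar> * 1" using that(3) nonneg[of A] by (intro mult_mono) auto
    finally show ?thesis by (auto simp: k_def)
  qed
  let ?C = "{A :: nat \<times> nat \<Rightarrow> real. \<forall>x. A x \<in> {- k..k}}"
  let ?F = "?C \<inter> {A. \<psi> A \<le> 1}"
  have "closed {A. \<psi> A \<le> 1}"
    unfolding closed_sequential_limits using lsc tendsto_coordinate by (metis mem_Collect_eq)
  then have "compact ?F" by (intro compact_Int_closed compact_cube)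
  moreover have "\<psi> (\<lambda>_. 0) = 0" using scale[of 0 "\<lambda>_. 0"] by simp
  then have "(\<lambda>_. 0) \<in> ?F" by (simp add: k_def)
  then have "?F \<noteq> {}" by (rule nonemptyI)
  moreover have "continuous_on ?F (\<lambda>A. \<bar>?D A\<bar>)"
  proof -
    have "?D A = (\<Sum>q\<in>{q. q permutes {0..<n}}. signof q * (\<Prod>i=0..<n. A (i, q i)))" for A
      unfolding det_def'[OF mat_carrier]
    proof (intro sum.cong refl arg_cong2[where f = "(*)"] prod.cong)
      fix q i assume "q \<in> {q. q permutes {0..<n}}" "i \<in> {0..<n}"
      then have "q i \<in> {0..<n}" using permutes_in_image by fastforce
      then show "Matrix.mat n n A $$ (i, q i) = A (i, q i)" using \<open>i \<in> {0..<n}\<close> by simp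
    qed
    then show ?thesis
      by (simp only:) (intro continuous_intros continuous_on_subset[OF continuous_on_product_coordinates]; simp)
  qed
  ultimately obtain A where A: "A \<in> ?F" "\<And>B. B \<in> ?F \<Longrightarrow> \<bar>?D B\<bar> \<le> \<bar>?D A\<bar>"
    by (rule continuous_attains_sup[THEN bexE]) blast

  have max: "\<bar>?D B\<bar> \<le> \<bar>?D A\<bar> * \<psi> B ^ n" for B
  proof (cases "\<psi> B = 0")
    case True
    then have "B (i, j) = 0" if "i < n" "j < n" for i j using bound[OF that, of B] by simp
    then have "Matrix.mat n n B = 0\<^sub>m n n" by (intro eq_matI) auto
    then show ?thesis using n nonneg[of B] by simp
  next
    case False
    then have pos: "0 < \<psi> B" using nonneg[of B] by simp
    \<comment> \<open>The rescaled block, extended by \<open>0\<close> to remain inside the cube.\<close>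
    define B' where "B' x = (if fst x < n \<and> snd x < n then 1 / \<psi> B * B x else 0)" for x
    have eq: "B' (i, j) = 1 / \<psi> B * B (i, j)" if "i < n" "j < n" for i j using that by (simp add: B'_def)
    have "\<psi> B' = \<psi> (\<lambda>x. 1 / \<psi> B * B x)" by (rule restrict) (rule eq)
    then have B'1: "\<psi> B' = 1" using pos by (simp only: scale) simp
    have "B' x \<in> {- k..k}" for x
    proof (cases "fst x < n \<and> snd x < n")
      case True
      then show ?thesis using bk[of "fst x" "snd x" B'] B'1 by simp
    next
      case False
      then have "B' x = 0" by (auto simp: B'_def)
      then show ?thesis by (simp add: k_def)
    qed
    then have "\<bar>?D B'\<bar> \<le> \<bar>?D A\<bar>" by (intro A(2)) (simp add: B'1)
    moreover have "?D B' = (1 / \<psi> B) ^ n * ?D B"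
    proof -
      have "Matrix.mat n n B' = (1 / \<psi> B) \<cdot>\<^sub>m Matrix.mat n n B" by (rule eq_matI) (auto simp: B'_def)
      then show ?thesis by simp
    qed
    ultimately show ?thesis using pos by (simp add: abs_mult power_one_over field_simps)
  qed
  let ?I = "\<lambda>(i, j). if i = j then 1 else 0 :: real"
  have "Matrix.mat n n ?I = 1\<^sub>m n" by (rule eq_matI) auto
  then have "?D ?I = 1" by simp
  then have "?D A \<noteq> 0" using max[of ?I] by auto
  then show ?thesis using A(1) max by blast
qed

section \<open>The embedding\<close>

definition tuple_of_matrix :: "nat \<Rightarrow> (nat \<Rightarrow> operator) \<Rightarrow> (nat \<times> nat \<Rightarrow> real) \<Rightarrow> nat \<Rightarrow> operator"
  where "tuple_of_matrix n B A i = (\<Sum>j<n. A (i, j) *\<^sub>R B j)"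

text \<open>
  A matrix \<open>A\<close> encodes the tuple whose entries have the rows of \<open>A\<close> as
  coordinates in a fixed basis. A maximal determinant is not \<open>0\<close>, so the maximising
  tuple spans \<open>X\<close>.
\<close>

lemma exists_lewis_position:
  fixes B :: "nat \<Rightarrow> operator"
  assumes p: "1 \<le> p" and X: "X \<subseteq> schatten p" "subspace X"
    and n: "0 < n" and B: "bij_betw B {..<n} S" "independent S" "span S = X"
  shows "\<exists>T. lewis_position n p T \<and> X \<subseteq> range (\<lambda>a. \<Sum>i<n. a i *\<^sub>R T i)"
proof -
  have p0: "0 < p" using p by simp
  have inj: "inj_on B {..<n}" and img: "B ` {..<n} = S" using B(1) by (auto simp: bij_betw_def)
  have BX: "B i \<in> X" if "i < n" for i proof -
    have "B i \<in> S" using that img by blast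
    then show ?thesis unfolding B(3)[symmetric] by (rule span_base)
  qed
  let ?T = "tuple_of_matrix n B" and ?D = "block_det n"
  have TX: "?T A i \<in> X" for A i
    unfolding tuple_of_matrix_def by (intro subspace_sum[OF X(2)] subspace_scale[OF X(2)] BX) simp
  have col: "column_op n U \<in> schatten p" if "\<And>i. U i \<in> X" for U
    by (rule column_schatten[OF n p subsetD[OF X(1) that]])
  define \<psi> where "\<psi> A = schatten_norm p (column_op n (?T A))" for A
  have colT: "column_op n (?T A) \<in> schatten p" for A by (rule col) (rule TX)
  have \<psi>_le_1: "\<psi> A \<le> 1 \<longleftrightarrow> schatten_sum p (column_op n (?T A)) \<le> 1" for A
  proof -
    have "\<psi> A \<le> 1 \<longleftrightarrow> \<psi> A powr p \<le> 1 powr p"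
    proof
      show "\<psi> A powr p \<le> 1 powr p" if "\<psi> A \<le> 1"
        using that p0 by (intro powr_mono2) (auto simp: \<psi>_def schatten_norm_nonneg)
      show "\<psi> A \<le> 1" if le: "\<psi> A powr p \<le> 1 powr p"
      proof (rule ccontr)
        assume "\<not> \<psi> A \<le> 1"
        then have "1 powr p < \<psi> A powr p" using p0 by (intro powr_less_mono2) auto
        then show False using le by simp
      qed
    qed
    then show ?thesis using schatten_norm_powr[OF p0 schattenD(2)[OF colT]] by (simp add: \<psi>_def)
  qed
  obtain K where K: "\<And>c j. j < n \<Longrightarrow> \<bar>c j\<bar> \<le> K * norm (\<Sum>i<n. c i *\<^sub>R B i)"
    using independent_coordinates_bounded[OF inj] B(2) unfolding img by metis
  have "\<exists>A. \<psi> A \<le> 1 \<and> ?D A \<noteq> 0 \<and> (\<forall>A'. \<bar>?D A'\<bar> \<le> \<bar>?D A\<bar> * \<psi> A' ^ n)"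
  proof (rule maximal_determinant[OF n])
    fix A
    show "0 \<le> \<psi> A" by (simp add: \<psi>_def schatten_norm_nonneg)
  next
    fix c A
    have "column_op n (?T (\<lambda>x. c * A x)) = c *\<^sub>R column_op n (?T A)"
      by (rule blinfun_eqI)
         (simp add: column_op_def tuple_of_matrix_def blinfun.sum_left blinfun.scaleR_left blinfun.sum_right
            blinfun.scaleR_right scaleR_sum_right)
    then show "\<psi> (\<lambda>x. c * A x) = \<bar>c\<bar> * \<psi> A"
      by (simp add: \<psi>_def schatten_norm_scaleR[OF p0 colT])
  next
    fix A A' :: "nat \<times> nat \<Rightarrow> real"
    assume "\<And>i j. i < n \<Longrightarrow> j < n \<Longrightarrow> A (i, j) = A' (i, j)"
    then have "column_op n (?T A) = column_op n (?T A')"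
      unfolding column_op_def tuple_of_matrix_def by (intro sum.cong refl arg_cong2[where f = "(o\<^sub>L)"]) auto
    then show "\<psi> A = \<psi> A'" by (simp add: \<psi>_def)
  next
    fix A i j assume ij: "i < n" "j < n"
    have "norm (?T A i) \<le> norm (column_op n (?T A))"
    proof (rule norm_blinfun_bound)
      fix x
      have "(norm (?T A i x))\<^sup>2 \<le> (\<Sum>i<n. (norm (?T A i x))\<^sup>2)" by (rule member_le_sum) (use ij in auto)
      also have "\<dots> = (norm (column_op n (?T A) x))\<^sup>2" by (simp add: norm_column)
      finally have "norm (?T A i x) \<le> norm (column_op n (?T A) x)" by (rule power2_le_imp_le) simp
      also have "\<dots> \<le> norm (column_op n (?T A)) * norm x" by (rule norm_blinfun)
      finally show "norm (?T A i x) \<le> norm (column_op n (?T A)) * norm x" .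
    qed simp
    also have "\<dots> \<le> \<psi> A" unfolding \<psi>_def by (rule norm_le_schatten_norm[OF p0 colT])
    finally have le: "norm (?T A i) \<le> \<psi> A" .
    have "\<bar>A (i, j)\<bar> \<le> K * norm (?T A i)" using K[OF ij(2), of "\<lambda>j. A (i, j)"] by (simp add: tuple_of_matrix_def)
    also have "\<dots> \<le> \<bar>K\<bar> * \<psi> A" using le by (intro mult_mono) auto
    finally show "\<bar>A (i, j)\<bar> \<le> \<bar>K\<bar> * \<psi> A" .
  next
    fix Y :: "nat \<Rightarrow> nat \<times> nat \<Rightarrow> real" and A
    assume Y: "\<And>x. (\<lambda>m. Y m x) \<longlonglongrightarrow> A x" "\<And>m. \<psi> (Y m) \<le> 1"
    have lim: "(\<lambda>m. column_op n (?T (Y m))) \<longlonglongrightarrow> column_op n (?T A)"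
      unfolding column_op_def tuple_of_matrix_def
      by (intro tendsto_sum bounded_bilinear.tendsto[OF bounded_bilinear_blinfun_compose] tendsto_const tendsto_scaleR Y)
    show "\<psi> A \<le> 1"
      unfolding \<psi>_le_1
      by (rule schatten_sum_lower_semicontinuous[OF p schattenD(1)[OF colT] colT lim Y(2)[unfolded \<psi>_le_1]])
  qed
  then obtain A where A: "\<psi> A \<le> 1" "?D A \<noteq> 0" "\<And>A'. \<bar>?D A'\<bar> \<le> \<bar>?D A\<bar> * \<psi> A' ^ n" by blast
  have comb: "(\<Sum>l<n. a l *\<^sub>R ?T A l) \<in> X" for a
    by (intro subspace_sum[OF X(2)] subspace_scale[OF X(2)] TX)
  have "lewis_position n p (?T A)"
  proof
    show "0 < n" "1 \<le> p" by (fact n, fact p)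
    show "(\<Sum>l<n. a l *\<^sub>R ?T A l) \<in> schatten p" for a using comb X(1) by blast
    show "column_op n (\<lambda>i. ?T A i + (\<kappa> * a i) *\<^sub>R (\<Sum>l<n. a l *\<^sub>R ?T A l)) \<in> schatten p" for \<kappa> a
      by (intro col subspace_add[OF X(2)] subspace_scale[OF X(2)] comb TX)
    show "schatten_sum p (column_op n (?T A)) \<le> 1" using A(1) \<psi>_le_1 by simp
    fix \<kappa> :: real and a :: "nat \<Rightarrow> real" assume \<kappa>: "0 \<le> \<kappa>"
    let ?A' = "\<lambda>(i, j). A (i, j) + \<kappa> * a i * (\<Sum>l<n. a l * A (l, j))"
    have T': "?T ?A' = (\<lambda>i. ?T A i + (\<kappa> * a i) *\<^sub>R (\<Sum>l<n. a l *\<^sub>R ?T A l))"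
    proof
      fix i
      have "(\<Sum>l<n. a l *\<^sub>R ?T A l) = (\<Sum>j<n. (\<Sum>l<n. a l * A (l, j)) *\<^sub>R B j)"
        unfolding tuple_of_matrix_def scaleR_sum_right scaleR_sum_left by (subst sum.swap) simp
      then show "?T ?A' i = ?T A i + (\<kappa> * a i) *\<^sub>R (\<Sum>l<n. a l *\<^sub>R ?T A l)"
        by (simp add: tuple_of_matrix_def scaleR_add_left sum.distrib scaleR_sum_right)
    qed
    have L: "(L2_set a {..<n})\<^sup>2 = (\<Sum>i<n. (a i)\<^sup>2)" by (simp add: L2_set_def sum_nonneg)
    have "(1 + \<kappa> * (L2_set a {..<n})\<^sup>2) * \<bar>?D A\<bar> = \<bar>?D ?A'\<bar>"
      unfolding det_rank1_update L using \<kappa> by (simp add: abs_mult sum_nonneg)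
    also have "\<dots> \<le> \<psi> ?A' ^ n * \<bar>?D A\<bar>" using A(3)[of ?A'] by (simp add: mult.commute)
    finally have "1 + \<kappa> * (L2_set a {..<n})\<^sup>2 \<le> \<psi> ?A' ^ n"
      by (rule mult_right_le_imp_le) (use A(2) in simp)
    then show "1 + \<kappa> * (L2_set a {..<n})\<^sup>2
        \<le> schatten_norm p (column_op n (\<lambda>i. ?T A i + (\<kappa> * a i) *\<^sub>R (\<Sum>l<n. a l *\<^sub>R ?T A l))) ^ n"
      by (simp only: \<psi>_def T')
  qed
  moreover have "X \<subseteq> range (\<lambda>a. \<Sum>i<n. a i *\<^sub>R ?T A i)"
  proof
    fix x assume "x \<in> X"
    then have "x \<in> span (B ` {..<n})" using B(3) img by simp
    then obtain g where g: "x = (\<Sum>v\<in>B ` {..<n}. g v *\<^sub>R v)" by (auto simp: span_finite)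
    obtain a where a: "\<And>j. j < n \<Longrightarrow> g (B j) = (\<Sum>i<n. a i * A (i, j))"
      using det_nonzero_rows_span[OF A(2), of "\<lambda>j. g (B j)"] by blast
    have "x = (\<Sum>j<n. (\<Sum>i<n. a i * A (i, j)) *\<^sub>R B j)"
      unfolding g sum.reindex[OF inj] by (intro sum.cong) (auto simp: a)
    also have "\<dots> = (\<Sum>i<n. a i *\<^sub>R ?T A i)"
      unfolding tuple_of_matrix_def scaleR_sum_right scaleR_sum_left by (subst sum.swap) simp
    finally show "x \<in> range (\<lambda>a. \<Sum>i<n. a i *\<^sub>R ?T A i)" by blast
  qed
  ultimately show ?thesis by blast
qed

text \<open>
  The embedding is rescaled by \<open>1 / \<alpha>\<close> to meet the normalisation in the
  definition of distortion.
\<close>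

lemma distortion_le:
  assumes \<alpha>: "1 \<le> \<alpha>" and f: "f ` M \<subseteq> N"
    and d: "\<And>x y. x \<in> M \<Longrightarrow> y \<in> M \<Longrightarrow> dM x y \<le> dN (f x) (f y)"
      "\<And>x y. x \<in> M \<Longrightarrow> y \<in> M \<Longrightarrow> dN (f x) (f y) \<le> \<alpha> * dM x y"
    and nonneg: "\<And>x y. 0 \<le> dN x y"
  shows "distortion M dM N dN \<le> ennreal \<alpha>"
  unfolding distortion_def
proof (rule Inf_lower, intro CollectI conjI exI[of _ f] exI[of _ "1 / \<alpha>"] ballI)
  show "1 \<le> ennreal \<alpha>" using \<alpha> by (simp flip: ennreal_1 add: ennreal_leI)
  show "f ` M \<subseteq> N" by fact
  show "0 < 1 / \<alpha>" using \<alpha> by simp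
  fix x y assume xy: "x \<in> M" "y \<in> M"
  show "ennreal (1 / \<alpha> * dN (f x) (f y)) \<le> ennreal (dM x y)"
    using d(2)[OF xy] \<alpha> by (intro ennreal_leI) (simp add: divide_le_eq mult.commute)
  have "ennreal (dM x y) \<le> ennreal (dN (f x) (f y))" by (rule ennreal_leI[OF d(1)[OF xy]])
  also have "\<dots> = ennreal \<alpha> * ennreal (1 / \<alpha> * dN (f x) (f y))"
    using \<alpha> nonneg by (subst ennreal_mult[symmetric]) auto
  finally show "ennreal (dM x y) \<le> ennreal \<alpha> * ennreal (1 / \<alpha> * dN (f x) (f y))" .
qed

theorem theorem12:
  fixes p q :: real and X :: "(ell2 \<Rightarrow>\<^sub>L ell2) set"
  assumes "1 \<le> p" and "p < q"
    and "X \<subseteq> schatten p" and "subspace X"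
    and "\<exists>B. finite B \<and> X = span B" and "X \<noteq> {0}"
  shows "distortion X (schatten_dist p) (schatten q) (schatten_dist q)
    \<le> ennreal (if p \<le> 2 then real (dim X) powr (1 / p - 1 / q)
               else real (dim X) powr (p / 2 * (1 / p - 1 / q)))"
proof -
  obtain B0 where B0: "finite B0" "X = span B0" using assms(5) by blast
  obtain S where S: "S \<subseteq> X" "independent S" "X \<subseteq> span S" "card S = dim X" by (rule basis_exists)
  have fin: "finite S" using independent_span_bound[OF B0(1) S(2)] S(1) B0(2) by blast
  have span: "span S = X" using S(1,3) assms(4) by (metis span_minimal subset_antisym)
  define n where "n = dim X"
  have "S \<noteq> {}" using span assms(6) by auto
  then have n: "0 < n" using S(4) fin by (auto simp: n_def card_gt_0_iff)
  obtain B where B: "bij_betw B {..<n} S"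
    using ex_bij_betw_nat_finite[OF fin] S(4) by (auto simp: n_def lessThan_atLeast0)
  obtain T where "lewis_position n p T" and range: "X \<subseteq> range (\<lambda>a. \<Sum>i<n. a i *\<^sub>R T i)"
    using exists_lewis_position[OF assms(1,3,4) n B S(2) span] by blast
  then interpret lewis_position n p T by blast
  define c where "c = (if p \<le> 2 then 1 / p - 1 / q else p / 2 * (1 / p - 1 / q))"
  have c0: "0 \<le> c" using assms(1,2) by (simp add: c_def field_simps)
  have "\<forall>x\<in>X. \<exists>a. x = comb a" using range by blast
  then obtain a where a: "\<And>x. x \<in> X \<Longrightarrow> x = comb (a x)" by metis
  let ?f = "\<lambda>x. twist (row_op n (a x)) q"
  have diff_comb: "x - y = comb (\<lambda>i. a x i - a y i)" if "x \<in> X" "y \<in> X" for x y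
    using a[OF that(1)] a[OF that(2)] by (simp add: scaleR_diff_left sum_subtractf)
  have diff_f: "?f x - ?f y = twist (row_op n (\<lambda>i. a x i - a y i)) q" for x y
    by (rule blinfun_eqI)
       (simp add: twist_def row_op_def blinfun.diff_left blinfun.sum_left blinfun.scaleR_left scaleR_diff_left sum_subtractf)
  have "distortion X (schatten_dist p) (schatten q) (schatten_dist q) \<le> ennreal (real n powr c)"
  proof (rule distortion_le[where f = ?f])
    show "1 \<le> real n powr c" using n c0 by (simp add: ge_one_powr_ge_zero)
    show "?f ` X \<subseteq> schatten q" using twist_embedding(1)[OF assms(2)] by blast
    fix x y assume xy: "x \<in> X" "y \<in> X"
    show "schatten_dist p x y \<le> schatten_dist q (?f x) (?f y)"
      unfolding schatten_dist_def diff_f diff_comb[OF xy] by (rule twist_embedding(2)[OF assms(2)])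
    show "schatten_dist q (?f x) (?f y) \<le> real n powr c * schatten_dist p x y"
      unfolding schatten_dist_def diff_f diff_comb[OF xy] c_def by (rule twist_embedding(3)[OF assms(2)])
  qed (simp add: schatten_dist_def schatten_norm_nonneg)
  then show ?thesis by (simp add: n_def c_def if_distrib[of "\<lambda>x. _ powr x"])
qed

end
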